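(* Let $\mathcal{I}, \mathcal{J}$ be countable index sets, not both empty. Then $$\Omega^p_{\mathcal{I},\mathcal{J}} \sim_B \Omega_{\mathcal{I},\mathcal{J}} \sim_B \mathrm{TFAG} \sim_B \mathrm{AG}.$$
   Context: For a sentence $\Phi$ of $\mathcal{L}_{\omega_1\omega}$, $\mathrm{Mod}(\Phi)$ is the standard Borel space of models of $\Phi$ with universe $\mathbb{N}$. $\Phi \leq_B \Psi$ means there is a Borel map $f:\mathrm{Mod}(\Phi)\to\mathrm{Mod}(\Psi)$ with $M_1\cong M_2 \iff f(M_1)\cong f(M_2)$ for all $M_1,M_2\in\mathrm{Mod}(\Phi)$; $\Phi\sim_B\Psi$ means $\Phi\leq_B\Psi$ and $\Psi\leq_B\Phi$. $\mathrm{AG}$ is the theory of abelian groups and $\mathrm{TFAG}$ the theory of torsion-free abelian groups. For index sets $\mathcal{I},\mathcal{J}$, $\mathcal{L}_{\mathcal{I},\mathcal{J}}$ is the language of abelian groups together with a unary predicate $G_i$ for each $i\in\mathcal{I}$ and a unary (possibly partial) function symbol $\phi_j$ for each $j\in\mathcal{J}$. $\Omega_{\mathcal{I},\mathcal{J}}$ is the infinitary sentence asserting of $(G,+,G_i:i\in\mathcal{I},\phi_j:j\in\mathcal{J})$: $(G,+)\equiv_{\infty\omega}\bigoplus_\omega\mathbb{Z}$ (so countable models have $(G,+)$ free abelian of countably infinite rank); each $G_i$ is a subgroup of $G$; each $\mathrm{dom}(\phi_j)$ is either $G$ or some $G_i$; each $\phi_j:\mathrm{dom}(\phi_j)\to G$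 is a homomorphism. $\Omega^p_{\mathcal{I},\mathcal{J}}$ additionally asserts each $G_i$ is a pure subgroup of $G$ (i.e. $nG\cap G_i=nG_i$ for all $n<\omega$). *)

theory Defs
  imports "HOL-Analysis.Analysis" "HOL-Algebra.Product_Groups" "HOL-Algebra.Elementary_Groups"
begin

section \<open>Equivalence in \<open>L\<^sub>\<infinity>\<^sub>\<omega>\<close> for groups\<close>

datatype tm = Var nat | Times tm tm

primrec tm_vars :: "tm \<Rightarrow> nat set" where
  "tm_vars (Var k) = {k}"
| "tm_vars (Times s t) = tm_vars s \<union> tm_vars t"

primrec tm_val :: "('a, 'm) monoid_scheme \<Rightarrow> 'a list \<Rightarrow> tm \<Rightarrow> 'a" where
  "tm_val G xs (Var k) = xs ! k"
| "tm_val G xs (Times s t) = tm_val G xs s \<otimes>\<^bsub>G\<^esub> tm_val G xs t"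

definition tuples :: "('a, 'm) monoid_scheme \<Rightarrow> nat \<Rightarrow> 'a list set" where
  "tuples G n = {xs. length xs = n \<and> set xs \<subseteq> carrier G}"

text \<open>
  The formulas of \<open>L\<^sub>\<infinity>\<^sub>\<omega>\<close> in the vocabulary of one binary function symbol form a proper class,
  because conjunctions range over arbitrary sets of formulas. For two fixed structures \<open>G\<close>, \<open>H\<close>
  only the pairs of solution sets \<open>(\<phi>(G), \<phi>(H))\<close> matter, and those form a set.
  \<open>Linf G H n A B\<close> says that there is a formula \<open>\<phi>(v\<^sub>0, \<dots>, v\<^sub>n\<^sub>-\<^sub>1)\<close> of \<open>L\<^sub>\<infinity>\<^sub>\<omega>\<close> with
  \<open>A = \<phi>(G)\<close> and \<open>B = \<phi>(H)\<close>; the rules are the formation rules of formulas, with no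
  restriction on the size of conjunctions, and a quantifier binds the last variable.
\<close>

inductive Linf ::
  "('a, 'm) monoid_scheme \<Rightarrow> ('b, 'k) monoid_scheme \<Rightarrow> nat \<Rightarrow> 'a list set \<Rightarrow> 'b list set \<Rightarrow> bool"
  for G :: "('a, 'm) monoid_scheme" and H :: "('b, 'k) monoid_scheme" where
  Eq: "tm_vars s \<union> tm_vars t \<subseteq> {..<n} \<Longrightarrow>
    Linf G H n {xs \<in> tuples G n. tm_val G xs s = tm_val G xs t}
               {ys \<in> tuples H n. tm_val H ys s = tm_val H ys t}"
| Neg: "Linf G H n A B \<Longrightarrow> Linf G H n (tuples G n - A) (tuples H n - B)"
| Conj: "(\<And>A B. (A, B) \<in> F \<Longrightarrow> Linf G H n A B) \<Longrightarrow>
    Linf G H n {xs \<in> tuples G n. \<forall>(A, B) \<in> F. xs \<in> A} {ys \<in> tuples H n. \<forall>(A, B) \<in> F. ys \<in> B}"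
| Ex: "Linf G H (Suc n) A B \<Longrightarrow>
    Linf G H n {xs \<in> tuples G n. \<exists>x \<in> carrier G. xs @ [x] \<in> A}
               {ys \<in> tuples H n. \<exists>y \<in> carrier H. ys @ [y] \<in> B}"

definition Linf_equiv :: "('a, 'm) monoid_scheme \<Rightarrow> ('b, 'k) monoid_scheme \<Rightarrow> bool" where
  "Linf_equiv G H \<longleftrightarrow> (\<forall>A B. Linf G H 0 A B \<longrightarrow> ([] \<in> A \<longleftrightarrow> [] \<in> B))"


section \<open>Structures with universe the natural numbers\<close>

text \<open>
  A triple of the addition, the unary predicates (indexed by \<open>I\<close>) and the unary partial functions
  (indexed by \<open>J\<close>); a partial function is undefined where its value is \<^const>\<open>None\<close>.
  Outside of \<open>I \<times> \<nat>\<close> and \<open>J \<times> \<nat>\<close> the components are \<^const>\<open>undefined\<close>,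
  see \<^const>\<open>extensional\<close>, so that they carry no information there.
\<close>

type_synonym ('i, 'j) str =
  "(nat \<times> nat \<Rightarrow> nat) \<times> ('i \<times> nat \<Rightarrow> bool) \<times> ('j \<times> nat \<Rightarrow> nat option)"

text \<open>
  The product \<open>\<sigma>\<close>-algebra of countably many countable discrete spaces, which for countable
  \<open>I\<close>, \<open>J\<close> is the Borel \<open>\<sigma>\<close>-algebra of the product topology.
\<close>

definition str_space :: "'i set \<Rightarrow> 'j set \<Rightarrow> ('i, 'j) str measure" where
  "str_space I J =
     (\<Pi>\<^sub>M _ \<in> UNIV. count_space UNIV) \<Otimes>\<^sub>M
     ((\<Pi>\<^sub>M _ \<in> I \<times> UNIV. count_space UNIV) \<Otimes>\<^sub>M (\<Pi>\<^sub>M _ \<in> J \<times> UNIV. count_space UNIV))"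

text \<open>The junk value of \<^const>\<open>The\<close> is harmless: without a neutral element
  the result is not a monoid.\<close>

definition grp :: "('i, 'j) str \<Rightarrow> nat monoid" where
  "grp S = \<lparr>carrier = UNIV, mult = (\<lambda>x y. fst S (x, y)), one = (THE e. \<forall>x. fst S (e, x) = x)\<rparr>"

definition pred :: "('i, 'j) str \<Rightarrow> 'i \<Rightarrow> nat set" where
  "pred S i = {x. fst (snd S) (i, x)}"

definition pfun :: "('i, 'j) str \<Rightarrow> 'j \<Rightarrow> nat \<Rightarrow> nat option" where
  "pfun S j x = snd (snd S) (j, x)"

definition str_iso :: "'i set \<Rightarrow> 'j set \<Rightarrow> ('i, 'j) str \<Rightarrow> ('i, 'j) str \<Rightarrow> bool" where
  "str_iso I J S T \<longleftrightarrow>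
     (\<exists>h \<in> Group.iso (grp S) (grp T).
        (\<forall>i \<in> I. \<forall>x. x \<in> pred S i \<longleftrightarrow> h x \<in> pred T i) \<and>
        (\<forall>j \<in> J. \<forall>x. pfun T j (h x) = map_option h (pfun S j x)))"


section \<open>Borel reducibility\<close>

text \<open>A sentence, given by its vocabulary and the truth of the sentence in a structure.\<close>

record ('i, 'j) sentence =
  preds :: "'i set"
  funs :: "'j set"
  holds :: "('i, 'j) str \<Rightarrow> bool"

definition Models :: "('i, 'j) sentence \<Rightarrow> ('i, 'j) str measure" where
  "Models \<Phi> = restrict_space (str_space (preds \<Phi>) (funs \<Phi>)) {S. holds \<Phi> S}"

definition model_iso :: "('i, 'j) sentence \<Rightarrow> ('i, 'j) str \<Rightarrow> ('i, 'j) str \<Rightarrow> bool" where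
  "model_iso \<Phi> = str_iso (preds \<Phi>) (funs \<Phi>)"

definition borel_reducible :: "('i, 'j) sentence \<Rightarrow> ('k, 'l) sentence \<Rightarrow> bool"
    (infix \<open>\<le>\<^sub>B\<close> 50) where
  "\<Phi> \<le>\<^sub>B \<Psi> \<longleftrightarrow>
     (\<exists>f \<in> Models \<Phi> \<rightarrow>\<^sub>M Models \<Psi>.
        \<forall>S \<in> space (Models \<Phi>). \<forall>T \<in> space (Models \<Phi>). model_iso \<Phi> S T \<longleftrightarrow> model_iso \<Psi> (f S) (f T))"

definition borel_equivalent :: "('i, 'j) sentence \<Rightarrow> ('k, 'l) sentence \<Rightarrow> bool"
    (infix \<open>\<sim>\<^sub>B\<close> 50) where
  "\<Phi> \<sim>\<^sub>B \<Psi> \<longleftrightarrow> \<Phi> \<le>\<^sub>B \<Psi> \<and> \<Psi> \<le>\<^sub>B \<Phi>"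


section \<open>The sentences\<close>

text \<open>The vocabulary of groups has no extra symbols; the index type \<^typ>\<open>unit\<close> is arbitrary.\<close>

definition AG :: "(unit, unit) sentence" where
  "AG = \<lparr>preds = {}, funs = {}, holds = (\<lambda>S. comm_group (grp S))\<rparr>"

definition torsion_free :: "('a, 'm) monoid_scheme \<Rightarrow> bool" where
  "torsion_free G \<longleftrightarrow>
     (\<forall>x \<in> carrier G. \<forall>n::nat. n > 0 \<and> x [^]\<^bsub>G\<^esub> n = \<one>\<^bsub>G\<^esub> \<longrightarrow> x = \<one>\<^bsub>G\<^esub>)"

definition TFAG :: "(unit, unit) sentence" where
  "TFAG = \<lparr>preds = {}, funs = {}, holds = (\<lambda>S. comm_group (grp S) \<and> torsion_free (grp S))\<rparr>"

definition pure :: "'a set \<Rightarrow> ('a, 'm) monoid_scheme \<Rightarrow> bool" where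
  "pure K G \<longleftrightarrow>
     (\<forall>n::nat. (\<lambda>x. x [^]\<^bsub>G\<^esub> n) ` carrier G \<inter> K = (\<lambda>x. x [^]\<^bsub>G\<^esub> n) ` K)"

definition Omega :: "'i set \<Rightarrow> 'j set \<Rightarrow> ('i, 'j) sentence" where
  "Omega I J = \<lparr>preds = I, funs = J, holds = (\<lambda>S.
     Linf_equiv (grp S) (sum_group (UNIV :: nat set) (\<lambda>_. integer_group)) \<and>
     (\<forall>i \<in> I. subgroup (pred S i) (grp S)) \<and>
     (\<forall>j \<in> J. dom (pfun S j) = UNIV \<or> (\<exists>i \<in> I. dom (pfun S j) = pred S i)) \<and>
     (\<forall>j \<in> J. (\<lambda>x. the (pfun S j x)) \<in> hom ((grp S)\<lparr>carrier := dom (pfun S j)\<rparr>) (grp S)))\<rparr>"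

definition Omega_pure :: "'i set \<Rightarrow> 'j set \<Rightarrow> ('i, 'j) sentence" where
  "Omega_pure I J = \<lparr>preds = I, funs = J, holds = (\<lambda>S.
     holds (Omega I J) S \<and> (\<forall>i \<in> I. pure (pred S i) (grp S)))\<rparr>"

end

theory Submission
  imports Defs "HOL-Algebra.FiniteProduct" "HOL-Computational_Algebra.Primes"
begin

text \<open>
  The nontrivial reductions are \<open>\<Omega>\<^sub>I\<^sub>,\<^sub>J \<le>\<^sub>B TFAG\<close> and \<open>AG \<le>\<^sub>B \<Omega>\<^sub>I\<^sub>,\<^sub>J\<close>; the second one lands in
  \<open>\<Omega>\<^sup>p\<^sub>I\<^sub>,\<^sub>J\<close> when it starts from a torsion-free group.

  For the first, a model \<open>G\<close> is coded by \<open>L = G \<times> G\<close> with the subgroups \<open>R\<^sub>k\<close> given by the axes, the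
  diagonal, the \<open>G\<^sub>i\<close> on the diagonal and the graphs of the \<open>\<phi>\<^sub>j\<close>; here \<open>R\<^sub>0 = L\<close>. Inside the rational
  span of \<open>L \<oplus> \<Oplus>\<^sub>k (R\<^sub>k \<oplus> R\<^sub>k)\<close> take the group \<open>H\<close> generated by \<open>L[1/p]\<close>, by the two copies
  \<open>R\<^sub>k[1/q\<^sub>k]\<close>, \<open>R\<^sub>k[1/q'\<^sub>k]\<close>, by the graph of the identity between the copies, made \<open>t\<^sub>k\<close>-divisible,
  and by the graph of the inclusion of the second copy into \<open>L\<close>, made \<open>u\<^sub>k\<close>-divisible, for distinct
  primes. Only the absence of infinitely divisible elements in \<open>G\<close> matters for reading off the
  supports of \<open>p\<^sup>\<infinity>H\<close>, \<open>q\<^sub>k\<^sup>\<infinity>H\<close>, and so on. The intersection of \<open>t\<^sub>k\<^sup>\<infinity>H\<close> with \<open>q\<^sub>k\<^sup>\<infinity>H + q'\<^sub>k\<^sup>\<infinity>H\<close> is the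
  diagonal copy of \<open>R\<^sub>k\<close>, and the inclusion graph carries it to \<open>L\<close>, so \<open>H\<close> determines \<open>(L; R\<^sub>k)\<close>.
  With a single copy of \<open>R\<^sub>k\<close> one would only recover \<open>L \<inter> R\<^sub>k[1/u\<^sub>k]\<close>, which is too big when \<open>R\<^sub>k\<close> is not pure.

  For the second, let \<open>F\<close> be free on the elements of \<open>A\<close> and \<open>K\<close> the kernel of \<open>F \<rightarrow> A\<close>. The group
  \<open>F \<oplus> K\<close> is free, being a subgroup of a free group, and \<open>A\<close> is recovered as the quotient by the
  subgroup \<open>K \<oplus> K\<close>, or as kernel modulo image of the endomorphism \<open>(x, y) \<mapsto> (y, 0)\<close>.
\<close>

section \<open>Borel maps from countable presentations\<close>

lemma measurable_mult [measurable]: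
  "(\<lambda>S. fst S p) \<in> Models \<Phi> \<rightarrow>\<^sub>M count_space UNIV"
  unfolding Models_def str_space_def
  by (rule measurable_restrict_space1) measurable

lemma measurable_pred:
  assumes "i \<in> preds \<Phi>"
  shows "Measurable.pred (Models \<Phi>) (\<lambda>S. x \<in> pred S i)"
  unfolding Models_def str_space_def pred_def mem_Collect_eq
  by (rule measurable_restrict_space1, rule measurable_compose[OF measurable_snd], rule measurable_compose[OF measurable_fst],
      rule measurable_component_singleton) (use assms in auto)

lemma measurable_pfun:
  assumes "j \<in> funs \<Phi>"
  shows "(\<lambda>S. pfun S j x) \<in> Models \<Phi> \<rightarrow>\<^sub>M count_space UNIV"
  unfolding Models_def str_space_def pfun_def
  by (rule measurable_restrict_space1, rule measurable_compose[OF measurable_snd], rule measurable_compose[OF measurable_snd],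
      rule measurable_component_singleton) (use assms in auto)

lemma borel_reducibleI:
  assumes "f \<in> Models \<Phi> \<rightarrow>\<^sub>M str_space (preds \<Psi>) (funs \<Psi>)"
    and "\<And>S. S \<in> space (Models \<Phi>) \<Longrightarrow> holds \<Psi> (f S)"
    and "\<And>S T. S \<in> space (Models \<Phi>) \<Longrightarrow> T \<in> space (Models \<Phi>) \<Longrightarrow>
      model_iso \<Phi> S T \<longleftrightarrow> model_iso \<Psi> (f S) (f T)"
  shows "\<Phi> \<le>\<^sub>B \<Psi>"
  unfolding borel_reducible_def
proof (intro bexI ballI)
  show "f \<in> Models \<Phi> \<rightarrow>\<^sub>M Models \<Psi>"
    unfolding Models_def[of \<Psi>]
    by (rule measurable_restrict_space2) (use assms in auto)
qed (use assms(3) in auto)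

lemma borel_reducible_trans:
  assumes "\<Phi> \<le>\<^sub>B \<Psi>" "\<Psi> \<le>\<^sub>B X"
  shows "\<Phi> \<le>\<^sub>B X"
proof -
  obtain f where f: "f \<in> Models \<Phi> \<rightarrow>\<^sub>M Models \<Psi>"
    "\<And>S T. S \<in> space (Models \<Phi>) \<Longrightarrow> T \<in> space (Models \<Phi>) \<Longrightarrow> model_iso \<Phi> S T \<longleftrightarrow> model_iso \<Psi> (f S) (f T)"
    using assms(1) unfolding borel_reducible_def by blast
  obtain g where g: "g \<in> Models \<Psi> \<rightarrow>\<^sub>M Models X"
    "\<And>S T. S \<in> space (Models \<Psi>) \<Longrightarrow> T \<in> space (Models \<Psi>) \<Longrightarrow> model_iso \<Psi> S T \<longleftrightarrow> model_iso X (g S) (g T)"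
    using assms(2) unfolding borel_reducible_def by blast
  show ?thesis unfolding borel_reducible_def
  proof (intro bexI ballI)
    show "(\<lambda>S. g (f S)) \<in> Models \<Phi> \<rightarrow>\<^sub>M Models X"
      using measurable_compose[OF f(1) g(1)] .
    fix S T assume ST: "S \<in> space (Models \<Phi>)" "T \<in> space (Models \<Phi>)"
    then have "f S \<in> space (Models \<Psi>)" "f T \<in> space (Models \<Psi>)"
      using measurable_space[OF f(1)] by auto
    then show "model_iso \<Phi> S T \<longleftrightarrow> model_iso X (g (f S)) (g (f T))"
      using f(2) g(2) ST by simp
  qed
qed

lemma space_Models: "S \<in> space (Models \<Phi>) \<longleftrightarrow> holds \<Phi> S \<and> S \<in> space (str_space (preds \<Phi>) (funs \<Phi>))"
  unfolding Models_def space_restrict_space by auto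

lemma borel_reducible_strengthen:
  assumes "preds \<Phi> = preds \<Psi>" "funs \<Phi> = funs \<Psi>" "\<And>S. holds \<Phi> S \<Longrightarrow> holds \<Psi> S"
  shows "\<Phi> \<le>\<^sub>B \<Psi>"
proof (rule borel_reducibleI[where f = "\<lambda>S. S"])
  show "(\<lambda>S. S) \<in> Models \<Phi> \<rightarrow>\<^sub>M str_space (preds \<Psi>) (funs \<Psi>)"
    unfolding Models_def assms(1,2) by (rule measurable_restrict_space1) simp
qed (auto simp: space_Models assms model_iso_def)

text \<open>For an infinite set, the first element and each successor are values of
  \<open>LEAST\<close> over a condition on natural numbers, so measurability passes along the
  recursion.\<close>

lemma enumerate_measurable:
  fixes A :: "'s \<Rightarrow> nat set"
  assumes inf: "\<And>S. S \<in> space M \<Longrightarrow> infinite (A S)"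
    and A[measurable]: "\<And>a. Measurable.pred M (\<lambda>S. a \<in> A S)"
  shows "(\<lambda>S. enumerate (A S) n) \<in> M \<rightarrow>\<^sub>M count_space UNIV"
proof (induction n)
  case 0
  show ?case unfolding enumerate_0 by measurable
next
  case (Suc n)
  note [measurable] = Suc
  have "(\<lambda>S. LEAST s. s \<in> A S \<and> enumerate (A S) n < s) \<in> M \<rightarrow>\<^sub>M count_space UNIV"
    by measurable
  then show ?case
    by (subst measurable_cong[OF enumerate_Suc''[OF inf]]) auto
qed

text \<open>Turns structures presented by countably many codes into structures on the natural
  numbers, measurably in \<open>S\<close>. Each element is represented by its least code, and the
  least codes are enumerated in increasing order. Later arguments see the output only through the
  bijection \<open>\<beta> S\<close>, hence the form of the conclusions.\<close>

theorem measurable_presentation: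
  fixes \<nu> :: "'s \<Rightarrow> 'c::countable \<Rightarrow> 'v"
    and mul :: "'s \<Rightarrow> 'v \<Rightarrow> 'v \<Rightarrow> 'v"
    and P :: "'s \<Rightarrow> 'k \<Rightarrow> 'v \<Rightarrow> bool"
    and F :: "'s \<Rightarrow> 'l \<Rightarrow> 'v \<Rightarrow> 'v option"
  assumes inf: "\<And>S. S \<in> space M \<Longrightarrow> infinite (range (\<nu> S))"
    and mul: "\<And>S a b. S \<in> space M \<Longrightarrow> mul S (\<nu> S a) (\<nu> S b) \<in> range (\<nu> S)"
    and F: "\<And>S j a v. S \<in> space M \<Longrightarrow> j \<in> J \<Longrightarrow> F S j (\<nu> S a) = Some v \<Longrightarrow> v \<in> range (\<nu> S)"
    and eq_meas: "\<And>a b. Measurable.pred M (\<lambda>S. \<nu> S a = \<nu> S b)"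
    and mul_meas: "\<And>a b c. Measurable.pred M (\<lambda>S. mul S (\<nu> S a) (\<nu> S b) = \<nu> S c)"
    and P_meas: "\<And>i a. i \<in> I \<Longrightarrow> Measurable.pred M (\<lambda>S. P S i (\<nu> S a))"
    and F_meas: "\<And>j a b. j \<in> J \<Longrightarrow> Measurable.pred M (\<lambda>S. F S j (\<nu> S a) = Some (\<nu> S b))"
  obtains f \<beta> where "f \<in> M \<rightarrow>\<^sub>M str_space I J"
    and "\<And>S. S \<in> space M \<Longrightarrow> bij_betw (\<beta> S) UNIV (range (\<nu> S))"
    and "\<And>S x y. S \<in> space M \<Longrightarrow> \<beta> S (fst (f S) (x, y)) = mul S (\<beta> S x) (\<beta> S y)"
    and "\<And>S i x. S \<in> space M \<Longrightarrow> i \<in> I \<Longrightarrow> x \<in> pred (f S) i \<longleftrightarrow> P S i (\<beta> S x)"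
    and "\<And>S j x. S \<in> space M \<Longrightarrow> j \<in> J \<Longrightarrow> map_option (\<beta> S) (pfun (f S) j x) = F S j (\<beta> S x)"
proof -
  define \<mu> where "\<mu> S n = \<nu> S (from_nat n)" for S n
  have range_\<mu>: "range (\<mu> S) = range (\<nu> S)" for S
  proof -
    have "\<nu> S a \<in> range (\<mu> S)" for a
      using rangeI[of "\<mu> S" "to_nat a"] by (simp add: \<mu>_def)
    moreover have "\<mu> S n \<in> range (\<nu> S)" for n by (simp add: \<mu>_def)
    ultimately show ?thesis by blast
  qed
  \<comment> \<open>Keeps exactly one code per element, the least of those naming it.\<close>
  define A where "A S = {a. \<forall>b<a. \<mu> S b \<noteq> \<mu> S a}" for S
  have im_A: "\<mu> S ` A S = range (\<nu> S)" for S
  proof -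
    have "\<mu> S a \<in> \<mu> S ` A S" for a
    proof -
      have "\<mu> S (LEAST b. \<mu> S b = \<mu> S a) = \<mu> S a" by (rule LeastI) simp
      moreover have "(LEAST b. \<mu> S b = \<mu> S a) \<in> A S"
        unfolding A_def using calculation by (auto dest: not_less_Least)
      ultimately show ?thesis by (metis image_eqI)
    qed
    then show ?thesis unfolding range_\<mu>[symmetric] by auto
  qed
  have infA: "infinite (A S)" if "S \<in> space M" for S
    using inf[OF that] unfolding im_A[symmetric] by auto
  have injA: "inj_on (\<mu> S) (A S)" for S
  proof (rule inj_onI)
    fix a b assume "a \<in> A S" "b \<in> A S" "\<mu> S a = \<mu> S b"
    then show "a = b" unfolding A_def using nat_neq_iff[of a b] by auto
  qed
  have [measurable]: "Measurable.pred M (\<lambda>S. \<mu> S a = \<mu> S b)"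
    "Measurable.pred M (\<lambda>S. mul S (\<mu> S a) (\<mu> S b) = \<mu> S c)" for a b c
    unfolding \<mu>_def using eq_meas mul_meas by auto
  have [measurable]: "Measurable.pred M (\<lambda>S. a \<in> A S)" for a
    unfolding A_def mem_Collect_eq by measurable
  define en where "en S = enumerate (A S)" for S
  have en[measurable]: "(\<lambda>S. en S n) \<in> M \<rightarrow>\<^sub>M count_space UNIV" for n
    unfolding en_def by (rule enumerate_measurable[OF infA]) measurable
  define \<beta> where "\<beta> S n = \<mu> S (en S n)" for S n
  have bij: "bij_betw (\<beta> S) UNIV (range (\<nu> S))" if S: "S \<in> space M" for S
  proof -
    have "bij_betw (\<mu> S \<circ> en S) UNIV (range (\<nu> S))"
      unfolding en_def
      by (rule bij_betw_trans[OF bij_enumerate[OF infA[OF S]]]) (simp add: bij_betw_def injA im_A)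
    then show ?thesis by (simp add: \<beta>_def comp_def fun_eq_iff bij_betw_def inj_on_def image_def)
  qed
  have surj: "\<exists>x. v = \<beta> S x" if "S \<in> space M" "v \<in> range (\<nu> S)" for S v
    using bij[OF that(1)] that(2) unfolding bij_betw_def by auto
  have inS: "\<exists>a. \<beta> S x = \<nu> S a" for S x unfolding \<beta>_def \<mu>_def by auto
  have inj: "\<beta> S x = \<beta> S y \<longleftrightarrow> x = y" if "S \<in> space M" for S x y
    using bij[OF that] unfolding bij_betw_def inj_on_def by auto
  have m_mul[measurable]: "Measurable.pred M (\<lambda>S. mul S (\<beta> S x) (\<beta> S y) = \<beta> S z)" for x y z
  proof -
    \<comment> \<open>The code \<open>en S x\<close> varies with \<open>S\<close>. Splitting over
      its countably many possible values leaves conditions on fixed codes, which are measurable by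
      assumption.\<close>
    have "Measurable.pred M (\<lambda>S. \<exists>a b c. en S x = a \<and> en S y = b \<and> en S z = c \<and>
      mul S (\<mu> S a) (\<mu> S b) = \<mu> S c)" by measurable
    then show ?thesis unfolding \<beta>_def by simp
  qed
  have m_P: "Measurable.pred M (\<lambda>S. P S i (\<beta> S x))" if i: "i \<in> I" for i x
  proof -
    have [measurable]: "Measurable.pred M (\<lambda>S. P S i (\<mu> S a))" for a
      unfolding \<mu>_def using P_meas[OF i] by auto
    have "Measurable.pred M (\<lambda>S. \<exists>a. en S x = a \<and> P S i (\<mu> S a))" by measurable
    then show ?thesis unfolding \<beta>_def by simp
  qed
  have m_F: "Measurable.pred M (\<lambda>S. F S j (\<beta> S x) = Some (\<beta> S y))" if j: "j \<in> J" for j x y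
  proof -
    have [measurable]: "Measurable.pred M (\<lambda>S. F S j (\<mu> S a) = Some (\<mu> S b))" for a b
      unfolding \<mu>_def using F_meas[OF j] by auto
    have "Measurable.pred M (\<lambda>S. \<exists>a b. en S x = a \<and> en S y = b \<and> F S j (\<mu> S a) = Some (\<mu> S b))"
      by measurable
    then show ?thesis unfolding \<beta>_def by simp
  qed
  \<comment> \<open>For \<open>S\<close> in the space the value sought is unique by injectivity of
    \<open>\<beta> S\<close>, so \<open>LEAST\<close> merely names it in a measurable way. The
    restrictions make the components \<open>undefined\<close> off the index sets, as the product
    spaces demand.\<close>
  define f where "f S = ((\<lambda>p\<in>UNIV. LEAST z. mul S (\<beta> S (fst p)) (\<beta> S (snd p)) = \<beta> S z),
    (\<lambda>p\<in>I \<times> UNIV. P S (fst p) (\<beta> S (snd p))),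
    (\<lambda>p\<in>J \<times> UNIV. if \<exists>z. F S (fst p) (\<beta> S (snd p)) = Some (\<beta> S z)
        then Some (LEAST z. F S (fst p) (\<beta> S (snd p)) = Some (\<beta> S z)) else None))" for S
  show thesis
  proof (rule that)
    show "f \<in> M \<rightarrow>\<^sub>M str_space I J"
      unfolding f_def str_space_def
    proof (intro measurable_Pair measurable_restrict)
      fix p :: "nat \<times> nat"
      show "(\<lambda>S. LEAST z. mul S (\<beta> S (fst p)) (\<beta> S (snd p)) = \<beta> S z) \<in> M \<rightarrow>\<^sub>M count_space UNIV"
        by measurable
    next
      fix p :: "'k \<times> nat" assume "p \<in> I \<times> UNIV"
      then show "(\<lambda>S. P S (fst p) (\<beta> S (snd p))) \<in> M \<rightarrow>\<^sub>M count_space UNIV"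
        using m_P by auto
    next
      fix p :: "'l \<times> nat" assume "p \<in> J \<times> UNIV"
      then have [measurable]: "Measurable.pred M (\<lambda>S. F S (fst p) (\<beta> S (snd p)) = Some (\<beta> S z))" for z
        using m_F by auto
      show "(\<lambda>S. if \<exists>z. F S (fst p) (\<beta> S (snd p)) = Some (\<beta> S z)
        then Some (LEAST z. F S (fst p) (\<beta> S (snd p)) = Some (\<beta> S z)) else None) \<in> M \<rightarrow>\<^sub>M count_space UNIV"
        by measurable
    qed
    show "bij_betw (\<beta> S) UNIV (range (\<nu> S))" if "S \<in> space M" for S using bij[OF that] .
    show "\<beta> S (fst (f S) (x, y)) = mul S (\<beta> S x) (\<beta> S y)" if S: "S \<in> space M" for S x y
    proof -
      obtain z where "mul S (\<beta> S x) (\<beta> S y) = \<beta> S z"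
        using surj[OF S] mul[OF S] inS by metis
      then have "mul S (\<beta> S x) (\<beta> S y) = \<beta> S (LEAST z. mul S (\<beta> S x) (\<beta> S y) = \<beta> S z)"
        by (rule LeastI)
      then show ?thesis by (simp add: f_def)
    qed
    show "x \<in> pred (f S) i \<longleftrightarrow> P S i (\<beta> S x)" if "i \<in> I" for S i x
      using that by (simp add: f_def pred_def)
    show "map_option (\<beta> S) (pfun (f S) j x) = F S j (\<beta> S x)" if S: "S \<in> space M" and j: "j \<in> J" for S j x
    proof (cases "F S j (\<beta> S x)")
      case None
      then show ?thesis using j by (simp add: f_def pfun_def)
    next
      case (Some v)
      obtain z where z: "F S j (\<beta> S x) = Some (\<beta> S z)"
        using surj[OF S] F[OF S j] inS Some by metis
      then have "F S j (\<beta> S x) = Some (\<beta> S (LEAST z. F S j (\<beta> S x) = Some (\<beta> S z)))"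
        by (rule LeastI)
      then show ?thesis using j z by (auto simp: f_def pfun_def)
    qed
  qed
qed

section \<open>Back and forth\<close>

lemma tm_val_hom:
  assumes "group G" "h \<in> hom G H" "set xs \<subseteq> carrier G"
  shows "tm_vars t \<subseteq> {..<length xs} \<Longrightarrow>
    tm_val G xs t \<in> carrier G \<and> tm_val H (map h xs) t = h (tm_val G xs t)"
proof (induction t)
  case (Var k)
  then show ?case using assms(3) by auto
next
  case (Times s t)
  interpret group G by fact
  show ?case using Times assms(2) by (auto simp: hom_def)
qed

text \<open>Satisfaction is invariant under isomorphism, by induction on the formation rules: atoms
  use injectivity of \<open>h\<close>, the quantifier uses its surjectivity.\<close>

lemma Linf_iso:
  assumes G: "group G" and h: "h \<in> iso G H" and L: "Linf G H n A B"
  shows "xs \<in> tuples G n \<Longrightarrow> xs \<in> A \<longleftrightarrow> map h xs \<in> B"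
  using L
proof (induction arbitrary: xs)
  have hom: "h \<in> hom G H" and bij: "bij_betw h (carrier G) (carrier H)"
    using h by (auto simp: iso_def)
  have tup: "map h xs \<in> tuples H n" if "xs \<in> tuples G n" for xs n
    using that bij by (auto simp: tuples_def bij_betw_def)
  {
    case (Eq s t n)
    then have xs: "set xs \<subseteq> carrier G" "length xs = n" by (auto simp: tuples_def)
    note * = tm_val_hom[OF G hom xs(1)]
    have s: "tm_val G xs s \<in> carrier G" "tm_val H (map h xs) s = h (tm_val G xs s)"
      and t: "tm_val G xs t \<in> carrier G" "tm_val H (map h xs) t = h (tm_val G xs t)"
      using *[of s] *[of t] Eq(1) xs(2) by auto
    have "h (tm_val G xs s) = h (tm_val G xs t) \<longleftrightarrow> tm_val G xs s = tm_val G xs t"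
      using bij s(1) t(1) by (auto simp: bij_betw_def inj_on_def)
    then show ?case using Eq tup[of xs n] s(2) t(2) by auto
  next
    case (Neg n A B)
    then show ?case using tup by auto
  next
    case (Conj F n)
    have "xs \<in> A \<longleftrightarrow> map h xs \<in> B" if "(A, B) \<in> F" for A B
      using Conj that by blast
    then show ?case using tup[OF Conj.prems] Conj.prems by auto
  next
    case (Ex n A B)
    have "xs @ [x] \<in> A \<longleftrightarrow> map h xs @ [h x] \<in> B" if "x \<in> carrier G" for x
      using Ex.IH[of "xs @ [x]"] Ex.prems that by (auto simp: tuples_def)
    moreover have "(\<exists>y\<in>carrier H. Q y) \<longleftrightarrow> (\<exists>x\<in>carrier G. Q (h x))" for Q
      using bij_betw_imp_surj_on[OF bij, symmetric] by simp
    ultimately show ?case using tup[OF Ex.prems] Ex.prems by auto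
  }
qed

lemma iso_imp_Linf_equiv:
  assumes "group G" "h \<in> iso G H"
  shows "Linf_equiv G H"
  unfolding Linf_equiv_def using Linf_iso[OF assms, of 0 _ _ "[]"] by (auto simp: tuples_def)

text \<open>Equality of the infinitary types of two tuples; this relation is the back-and-forth
  system.\<close>

definition Linf_same ::
  "('a, 'm) monoid_scheme \<Rightarrow> ('b, 'k) monoid_scheme \<Rightarrow> 'a list \<Rightarrow> 'b list \<Rightarrow> bool" where
  "Linf_same G H xs ys \<longleftrightarrow> length xs = length ys \<and> set xs \<subseteq> carrier G \<and> set ys \<subseteq> carrier H \<and>
     (\<forall>A B. Linf G H (length xs) A B \<longrightarrow> (xs \<in> A \<longleftrightarrow> ys \<in> B))"

text \<open>One implication suffices, because formulas are closed under negation.\<close>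

lemma Linf_same_extendI:
  assumes xy: "Linf_same G H xs ys" and x: "x \<in> carrier G" and y: "y \<in> carrier H"
    and imp: "\<And>A B. Linf G H (Suc (length xs)) A B \<Longrightarrow> xs @ [x] \<in> A \<Longrightarrow> ys @ [y] \<in> B"
  shows "Linf_same G H (xs @ [x]) (ys @ [y])"
proof -
  have tup: "xs @ [x] \<in> tuples G (Suc (length xs))" "ys @ [y] \<in> tuples H (Suc (length xs))"
    using xy x y by (auto simp: Linf_same_def tuples_def)
  have "xs @ [x] \<in> A" if L: "Linf G H (Suc (length xs)) A B" and B: "ys @ [y] \<in> B" for A B
    using imp[OF Linf.Neg[OF L]] tup B by auto
  then show ?thesis using xy x y imp by (auto simp: Linf_same_def)
qed

text \<open>The conjunction of all formulas realised by the extended tuple is itself a formula.\<close>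

lemma Linf_same_forth:
  assumes xy: "Linf_same G H xs ys" and x: "x \<in> carrier G"
  obtains y where "y \<in> carrier H" "Linf_same G H (xs @ [x]) (ys @ [y])"
proof -
  define F where "F = {(A, B). Linf G H (Suc (length xs)) A B \<and> xs @ [x] \<in> A}"
  have L: "Linf G H (Suc (length xs)) {zs \<in> tuples G (Suc (length xs)). \<forall>(A, B) \<in> F. zs \<in> A}
     {zs \<in> tuples H (Suc (length xs)). \<forall>(A, B) \<in> F. zs \<in> B}"
    by (rule Linf.Conj) (auto simp: F_def)
  have "xs @ [x] \<in> {zs \<in> tuples G (Suc (length xs)). \<forall>(A, B) \<in> F. zs \<in> A}"
    using xy x by (auto simp: F_def Linf_same_def tuples_def)
  moreover have "xs \<in> tuples G (length xs)" using xy by (auto simp: Linf_same_def tuples_def)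
  ultimately have "ys \<in> {ys \<in> tuples H (length xs). \<exists>y\<in>carrier H. ys @ [y] \<in>
      {zs \<in> tuples H (Suc (length xs)). \<forall>(A, B) \<in> F. zs \<in> B}}"
    using xy Linf.Ex[OF L] x unfolding Linf_same_def by blast
  then obtain y where y: "y \<in> carrier H" "\<And>A B. (A, B) \<in> F \<Longrightarrow> ys @ [y] \<in> B" by auto
  show thesis
    by (rule that[OF y(1)], rule Linf_same_extendI[OF xy x y(1)]) (rule y(2), simp add: F_def)
qed

lemma Linf_same_back:
  assumes xy: "Linf_same G H xs ys" and y: "y \<in> carrier H"
  obtains x where "x \<in> carrier G" "Linf_same G H (xs @ [x]) (ys @ [y])"
proof -
  define F where "F = {(A, B). Linf G H (Suc (length xs)) A B \<and> ys @ [y] \<in> B}"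
  have L: "Linf G H (Suc (length xs)) {zs \<in> tuples G (Suc (length xs)). \<forall>(A, B) \<in> F. zs \<in> A}
     {zs \<in> tuples H (Suc (length xs)). \<forall>(A, B) \<in> F. zs \<in> B}"
    by (rule Linf.Conj) (auto simp: F_def)
  have tup: "ys @ [y] \<in> tuples H (Suc (length xs))"
    using xy y by (auto simp: Linf_same_def tuples_def)
  then have "ys @ [y] \<in> {zs \<in> tuples H (Suc (length xs)). \<forall>(A, B) \<in> F. zs \<in> B}"
    by (auto simp: F_def)
  moreover have "ys \<in> tuples H (length xs)" using xy by (auto simp: Linf_same_def tuples_def)
  ultimately have "xs \<in> {xs' \<in> tuples G (length xs). \<exists>x\<in>carrier G. xs' @ [x] \<in>
      {zs \<in> tuples G (Suc (length xs)). \<forall>(A, B) \<in> F. zs \<in> A}}"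
    using xy Linf.Ex[OF L] y unfolding Linf_same_def by blast
  then obtain x where x: "x \<in> carrier G" "\<And>A B. (A, B) \<in> F \<Longrightarrow> xs @ [x] \<in> A"
    "xs @ [x] \<in> tuples G (Suc (length xs))" by auto
  show thesis
  \<comment> \<open>Here \<open>F\<close> collects the formulas true of the tuple in
    \<open>H\<close>, so \<open>x(2)\<close> carries truth from \<open>H\<close> to
    \<open>G\<close>. The opposite direction, asked for by \<open>Linf_same_extendI\<close>, comes
    from applying it to the negated formula.\<close>
  proof (rule that[OF x(1)], rule Linf_same_extendI[OF xy x(1) y], rule ccontr)
    fix A B assume L: "Linf G H (Suc (length xs)) A B" and "xs @ [x] \<in> A" "ys @ [y] \<notin> B"
    then show False
      using x(2)[of "tuples G (Suc (length xs)) - A" "tuples H (Suc (length xs)) - B"] Linf.Neg[OF L] tup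
      by (auto simp: F_def)
  qed
qed

lemma Linf_same_tm_val:
  assumes "Linf_same G H xs ys" "tm_vars s \<union> tm_vars t \<subseteq> {..<length xs}"
  shows "tm_val G xs s = tm_val G xs t \<longleftrightarrow> tm_val H ys s = tm_val H ys t"
proof -
  have "xs \<in> {xs \<in> tuples G (length xs). tm_val G xs s = tm_val G xs t} \<longleftrightarrow>
    ys \<in> {ys \<in> tuples H (length xs). tm_val H ys s = tm_val H ys t}"
    using assms(1) Linf.Eq[OF assms(2), of G H] unfolding Linf_same_def by blast
  then show ?thesis using assms(1) by (auto simp: Linf_same_def tuples_def)
qed

text \<open>The forth step is iterated along the enumeration 0, 1, 2, ... of the universe of
  \<open>G\<close>, which gives an embedding into \<open>H\<close>. The back step enters once, to
  see that the image is closed under inverses. No group axioms are assumed for \<open>G\<close>;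
  they will be pulled back along \<open>\<theta>\<close>.\<close>

lemma Linf_equiv_embedding:
  fixes G :: "(nat, 'm) monoid_scheme"
  assumes G: "carrier G = UNIV" and eq: "Linf_equiv G H" and H: "group H"
  obtains \<theta> where "inj \<theta>" "\<And>a. \<theta> a \<in> carrier H" "\<And>a b. \<theta> (a \<otimes>\<^bsub>G\<^esub> b) = \<theta> a \<otimes>\<^bsub>H\<^esub> \<theta> b"
    "\<And>a. \<exists>b. \<theta> b = inv\<^bsub>H\<^esub> \<theta> a"
proof -
  interpret H: group H by fact
  \<comment> \<open>Dependent choice of a coherent chain: \<open>ys n\<close> has the type of (0,
    ..., n - 1), and each tuple extends the previous one by a single entry.\<close>
  have "\<exists>ys. \<forall>n. Linf_same G H [0..<n] (ys n) \<and> (\<exists>y. ys (Suc n) = ys n @ [y])"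
  proof (rule dependent_nat_choice)
    show "\<exists>ys. Linf_same G H [0..<0] ys"
      using eq by (auto simp: Linf_same_def Linf_equiv_def)
    show "\<exists>zs. Linf_same G H [0..<Suc n] zs \<and> (\<exists>y. zs = ys @ [y])"
      if same: "Linf_same G H [0..<n] ys" for ys n
    proof -
      obtain y where "Linf_same G H ([0..<n] @ [n]) (ys @ [y])"
        using Linf_same_forth[OF same, of n] G by auto
      then show ?thesis by auto
    qed
  qed
  then obtain ys where same: "\<And>n. Linf_same G H [0..<n] (ys n)"
    and Suc: "\<And>n. \<exists>y. ys (Suc n) = ys n @ [y]" by blast
  have len: "length (ys n) = n" for n using same[of n] by (simp add: Linf_same_def)
  define \<theta> where "\<theta> n = ys (Suc n) ! n" for n
  have nth: "n < m \<Longrightarrow> ys m ! n = \<theta> n" for n m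
  proof (induction m)
    case (Suc m)
    then show ?case using Suc.IH \<open>\<And>n. \<exists>y. ys (Suc n) = ys n @ [y]\<close>[of m]
      by (cases "n = m") (auto simp: \<theta>_def nth_append len)
  qed simp
  have car: "\<theta> a \<in> carrier H" for a
  proof -
    have "ys (Suc a) ! a \<in> set (ys (Suc a))" using len by simp
    then show ?thesis using same[of "Suc a"] by (auto simp: Linf_same_def \<theta>_def)
  qed
  have mult: "\<theta> (a \<otimes>\<^bsub>G\<^esub> b) = \<theta> a \<otimes>\<^bsub>H\<^esub> \<theta> b" for a b
  proof -
    define m where "m = Suc (max (max a b) (a \<otimes>\<^bsub>G\<^esub> b))"
    have *: "a < m" "b < m" "a \<otimes>\<^bsub>G\<^esub> b < m" by (auto simp: m_def)
    show ?thesis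
      using Linf_same_tm_val[OF same[of m], of "Times (Var a) (Var b)" "Var (a \<otimes>\<^bsub>G\<^esub> b)"] *
      by (simp add: nth)
  qed
  have inj: "inj \<theta>"
  proof (rule injI)
    fix a b assume "\<theta> a = \<theta> b"
    then show "a = b"
      using Linf_same_tm_val[OF same[of "Suc (max a b)"], of "Var a" "Var b"]
      by (simp add: nth less_Suc_eq_le del: upt_Suc)
  qed
  have inv: "\<exists>b. \<theta> b = inv\<^bsub>H\<^esub> \<theta> a" for a
  proof -
    obtain w where w: "Linf_same G H ([0..<Suc a] @ [w]) (ys (Suc a) @ [inv\<^bsub>H\<^esub> \<theta> a])"
      using Linf_same_back[OF same[of "Suc a"]] car by (metis H.inv_closed)
    \<comment> \<open>The element \<open>w\<close> corresponds to the inverse in the extended tuple,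
      but \<open>\<theta> w\<close> comes from the chain and could a priori be different. The
      identity \<open>a w a = a\<close>, written without a neutral element because the vocabulary
      has none, passes from \<open>H\<close> to \<open>G\<close> and back along
      \<open>\<theta>\<close>, where it determines \<open>\<theta> w\<close>.\<close>
    have "(a \<otimes>\<^bsub>G\<^esub> w) \<otimes>\<^bsub>G\<^esub> a = a"
      using Linf_same_tm_val[OF w, of "Times (Times (Var a) (Var (Suc a))) (Var a)" "Var a"] car
      by (simp add: nth_append len \<theta>_def[symmetric] del: upt_Suc)
    then have "\<theta> a \<otimes>\<^bsub>H\<^esub> \<theta> w \<otimes>\<^bsub>H\<^esub> \<theta> a = \<theta> a" using mult by metis
    then have "\<theta> a \<otimes>\<^bsub>H\<^esub> \<theta> w = \<one>\<^bsub>H\<^esub>" using car by (metis H.m_closed H.r_cancel_one)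
    then show ?thesis using car by (metis H.inv_unique' H.inv_comm)
  qed
  show thesis by (rule that[OF inj car mult inv])
qed

section \<open>Coding a family of lattices in a torsion-free group\<close>

text \<open>
  The tags stand for the primes \<open>p\<close>, \<open>q\<^sub>k\<close>, \<open>q'\<^sub>k\<close>, \<open>t\<^sub>k\<close>, \<open>u\<^sub>k\<close> of the introduction, and the coordinates for
  the summand \<open>L\<close> and the two copies of \<open>R\<^sub>k\<close>.
\<close>

datatype tag = Base | First nat | Second nat | Diag nat | Incl nat

datatype coord = Star | Fst nat | Snd nat

instance tag :: countable by countable_datatype

instance coord :: countable by countable_datatype

primrec tag_index :: "tag \<Rightarrow> nat" where
  "tag_index Base = 0"
| "tag_index (First k) = k"
| "tag_index (Second k) = k"
| "tag_index (Diag k) = k"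
| "tag_index (Incl k) = k"

primrec tag_coords :: "tag \<Rightarrow> coord set" where
  "tag_coords Base = {Star}"
| "tag_coords (First k) = {Fst k}"
| "tag_coords (Second k) = {Snd k}"
| "tag_coords (Diag k) = {Fst k, Snd k}"
| "tag_coords (Incl k) = {Snd k, Star}"

definition tag_prime :: "tag \<Rightarrow> nat" where
  "tag_prime = enumerate {p. prime p} \<circ> to_nat"

lemma prime_tag_prime [simp]: "prime (tag_prime t)"
  using enumerate_in_set[OF primes_infinite] by (simp add: tag_prime_def)

lemma tag_prime_pos [simp]: "tag_prime t > 0"
  by (simp add: prime_gt_0_nat)

lemma tag_prime_neq0 [simp]: "tag_prime t \<noteq> 0"
  using tag_prime_pos[of t] by simp

lemma tag_prime_inject [simp]: "tag_prime s = tag_prime t \<longleftrightarrow> s = t"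
  using injD[OF strict_mono_imp_inj_on[OF strict_mono_enumerate[OF primes_infinite]], of "to_nat s" "to_nat t"]
  by (auto simp: tag_prime_def)

lemma coprime_tag_prime [simp]: "s \<noteq> t \<Longrightarrow> coprime (tag_prime s) (tag_prime t)"
  by (simp add: primes_coprime)

text \<open>The pair of \<open>L\<close> and its subgroups \<open>R k\<close> in abstract form. The
  map \<open>emb\<close> realises \<open>L\<close> by integer vectors, which provides a rational
  span and excludes infinitely divisible elements. Only addition is an operation, as in the
  structures to be coded, so negatives appear as an existence statement. The axiom
  \<open>R_0\<close> makes \<open>L\<close> itself a member of the family.\<close>

locale lattice_family =
  fixes add :: "'c \<Rightarrow> 'c \<Rightarrow> 'c" and emb :: "'c \<Rightarrow> 'n \<Rightarrow> int" and R :: "nat \<Rightarrow> 'c set"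
  assumes emb_inj: "inj emb"
    and emb_add: "emb (add a b) i = emb a i + emb b i"
    and R_add: "a \<in> R k \<Longrightarrow> b \<in> R k \<Longrightarrow> add a b \<in> R k"
    and R_neg: "a \<in> R k \<Longrightarrow> \<exists>b\<in>R k. \<forall>i. emb b i = - emb a i"
    and R_nonempty: "R k \<noteq> {}"
    and R_0: "R 0 = UNIV"
begin

lemma emb_eq: "(\<And>i. emb a i = emb b i) \<Longrightarrow> a = b"
  using emb_inj by (simp add: inj_def fun_eq_iff)

lemma R_zero: "\<exists>z\<in>R k. \<forall>i. emb z i = 0"
proof -
  obtain a where "a \<in> R k" using R_nonempty by auto
  then obtain b where "b \<in> R k" "\<forall>i. emb b i = - emb a i" using R_neg by blast
  then show ?thesis using R_add[OF \<open>a \<in> R k\<close> \<open>b \<in> R k\<close>]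
    by (intro bexI[of _ "add a b"]) (simp_all add: emb_add)
qed

lemma R_scale_nat: "a \<in> R k \<Longrightarrow> \<exists>b\<in>R k. \<forall>i. emb b i = int m * emb a i"
proof (induction m)
  case 0
  then show ?case using R_zero by auto
next
  case (Suc m)
  then obtain b where "b \<in> R k" "\<forall>i. emb b i = int m * emb a i" by auto
  then show ?case using R_add[OF Suc.prems \<open>b \<in> R k\<close>]
    by (intro bexI[of _ "add a b"]) (auto simp: emb_add algebra_simps)
qed

lemma R_scale: "a \<in> R k \<Longrightarrow> \<exists>b\<in>R k. \<forall>i. emb b i = m * emb a i"
proof (cases m rule: int_cases2)
  case (nonneg n)
  then show "a \<in> R k \<Longrightarrow> ?thesis" using R_scale_nat by auto
next
  case (nonpos n)
  assume "a \<in> R k"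
  then obtain b where "b \<in> R k" "\<forall>i. emb b i = int n * emb a i" using R_scale_nat by blast
  then show ?thesis using R_neg[OF \<open>b \<in> R k\<close>] nonpos by auto
qed

definition lat :: "nat \<Rightarrow> ('n \<Rightarrow> rat) set" where
  "lat k = {y. \<exists>a\<in>R k. \<forall>i. y i = of_int (emb a i)}"

lemma lat_add: "x \<in> lat k \<Longrightarrow> y \<in> lat k \<Longrightarrow> (\<lambda>i. x i + y i) \<in> lat k"
proof -
  assume "x \<in> lat k" "y \<in> lat k"
  then obtain a b where "a \<in> R k" "\<forall>i. x i = of_int (emb a i)" "b \<in> R k" "\<forall>i. y i = of_int (emb b i)"
    by (auto simp: lat_def)
  then show ?thesis unfolding lat_def using R_add[of a k b]
    by (auto simp: emb_add intro!: bexI[of _ "add a b"])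
qed

lemma lat_scale: "x \<in> lat k \<Longrightarrow> (\<lambda>i. of_int m * x i) \<in> lat k"
proof -
  assume "x \<in> lat k"
  then obtain a where a: "a \<in> R k" "\<forall>i. x i = of_int (emb a i)" by (auto simp: lat_def)
  then obtain b where "b \<in> R k" "\<forall>i. emb b i = m * emb a i" using R_scale by blast
  then show ?thesis unfolding lat_def using a(2) by (auto intro!: bexI[of _ b])
qed

lemma lat_scale_nat: "x \<in> lat k \<Longrightarrow> (\<lambda>i. of_nat m * x i) \<in> lat k"
  using lat_scale[of x k "int m"] by simp

text \<open>By Bezout, \<open>y\<close> is an integer combination of its multiples by
  \<open>m\<close> and \<open>n\<close>.\<close>

lemma lat_coprime:
  assumes "coprime m n" "(\<lambda>i. of_nat m * y i) \<in> lat k" "(\<lambda>i. of_nat n * y i) \<in> lat k"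
  shows "y \<in> lat k"
proof -
  have "coprime (int m) (int n)" using assms(1) by simp
  then obtain u v where uv: "u * int m + v * int n = 1"
    using bezout_int[of "int m" "int n"] by (auto simp: coprime_iff_gcd_eq_1)
  have "(\<lambda>i. of_int u * (of_nat m * y i) + of_int v * (of_nat n * y i)) \<in> lat k"
    by (intro lat_add lat_scale assms)
  moreover have "of_int u * (of_nat m * y i) + of_int v * (of_nat n * y i) = y i" for i
  proof -
    have "of_int u * (of_nat m * y i) + of_int v * (of_nat n * y i) = of_int (u * int m + v * int n) * y i"
      by (simp add: algebra_simps)
    then show ?thesis by (simp add: uv)
  qed
  ultimately show ?thesis by simp
qed

text \<open>The localisation of \<open>R k\<close> at the powers of \<open>p\<close>, written
  R_k[1/p] in the introduction.\<close>

definition loc :: "nat \<Rightarrow> nat \<Rightarrow> ('n \<Rightarrow> rat) set" where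
  "loc k p = {y. \<exists>n. (\<lambda>i. of_nat (p ^ n) * y i) \<in> lat k}"

lemma loc_add:
  assumes "x \<in> loc k p" "y \<in> loc k p"
  shows "(\<lambda>i. x i + y i) \<in> loc k p"
proof -
  obtain m n where m: "(\<lambda>i. of_nat (p ^ m) * x i) \<in> lat k" and n: "(\<lambda>i. of_nat (p ^ n) * y i) \<in> lat k"
    using assms by (auto simp: loc_def)
  have "(\<lambda>i. of_nat (p ^ n) * (of_nat (p ^ m) * x i) + of_nat (p ^ m) * (of_nat (p ^ n) * y i)) \<in> lat k"
    by (intro lat_add lat_scale_nat m n)
  then have "(\<lambda>i. of_nat (p ^ (m + n)) * (x i + y i)) \<in> lat k"
    by (simp add: algebra_simps power_add)
  then show ?thesis unfolding loc_def by blast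
qed

lemma loc_neg: "x \<in> loc k p \<Longrightarrow> (\<lambda>i. - x i) \<in> loc k p"
proof -
  assume "x \<in> loc k p"
  then obtain n where "(\<lambda>i. of_nat (p ^ n) * x i) \<in> lat k" by (auto simp: loc_def)
  from lat_scale[OF this, of "-1"] show ?thesis by (auto simp: loc_def)
qed

lemma loc_zero: "(\<lambda>i. 0) \<in> loc k p"
  unfolding loc_def lat_def using R_zero[of k] by auto

text \<open>The powers of \<open>p\<close> and \<open>q\<close> that clear the denominators of
  \<open>y\<close> are coprime, so Bezout applies to them.\<close>

lemma loc_coprime:
  assumes y: "y \<in> loc k p" "y \<in> loc k q" and "coprime p q"
  shows "y \<in> lat k"
proof -
  obtain m n where "(\<lambda>i. of_nat (p ^ m) * y i) \<in> lat k" "(\<lambda>i. of_nat (q ^ n) * y i) \<in> lat k"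
    using y by (auto simp: loc_def)
  then show ?thesis using lat_coprime[of "p ^ m" "q ^ n" y k] assms(3) by simp
qed

text \<open>The denominators of \<open>c\<close> and \<open>d\<close> are cleared together by a
  product of powers of \<open>q\<close> and \<open>r\<close>, which is coprime to the power of
  \<open>p\<close> clearing \<open>y\<close>.\<close>

lemma loc_coprime_sum:
  assumes y: "y \<in> loc k p" "y = (\<lambda>i. c i + d i)" "c \<in> loc k q" "d \<in> loc k r"
    and "coprime p q" "coprime p r"
  shows "y \<in> lat k"
proof -
  obtain m n l where m: "(\<lambda>i. of_nat (p ^ m) * y i) \<in> lat k" and n: "(\<lambda>i. of_nat (q ^ n) * c i) \<in> lat k"
    and l: "(\<lambda>i. of_nat (r ^ l) * d i) \<in> lat k"
    using y by (auto simp: loc_def)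
  have "(\<lambda>i. of_nat (r ^ l) * (of_nat (q ^ n) * c i) + of_nat (q ^ n) * (of_nat (r ^ l) * d i)) \<in> lat k"
    by (intro lat_add lat_scale_nat l n)
  then have "(\<lambda>i. of_nat (q ^ n * r ^ l) * y i) \<in> lat k"
    by (simp add: y(2) algebra_simps)
  then show ?thesis using lat_coprime[OF _ m, of "q ^ n * r ^ l"] assms(5,6) by simp
qed

lemma lat_loc: "y \<in> lat k \<Longrightarrow> y \<in> loc k p"
  unfolding loc_def by (auto intro!: exI[of _ 0])

text \<open>The triple stands for the element \<open>a\<close> divided by the \<open>n\<close>-th
  power of the prime of \<open>t\<close>, placed in every coordinate of \<open>t\<close>. Triples
  with \<open>a\<close> outside the relevant subgroup denote zero, so that the type of codes does
  not depend on the family.\<close>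

definition gen :: "tag \<times> nat \<times> 'c \<Rightarrow> coord \<Rightarrow> 'n \<Rightarrow> rat" where
  "gen = (\<lambda>(t, n, a) c i. if a \<in> R (tag_index t) \<and> c \<in> tag_coords t
     then of_int (emb a i) / of_nat (tag_prime t ^ n) else 0)"

text \<open>The range of \<open>val\<close> is the group \<open>H\<close> of the introduction; lists
  of triples are its codes.\<close>

primrec val :: "(tag \<times> nat \<times> 'c) list \<Rightarrow> coord \<Rightarrow> 'n \<Rightarrow> rat" where
  "val [] = (\<lambda>c i. 0)"
| "val (e # l) = (\<lambda>c i. gen e c i + val l c i)"

lemma val_append: "val (l @ l') c i = val l c i + val l' c i"
  by (induction l) auto

lemma val_neg: "\<exists>l'. val l' = (\<lambda>c i. - val l c i)"
proof (induction l)
  case Nil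
  show ?case by (rule exI[of _ "[]"]) simp
next
  case (Cons e l)
  then obtain l' where l': "val l' = (\<lambda>c i. - val l c i)" by blast
  obtain t n a where e: "e = (t, n, a)" by (cases e)
  have "\<exists>e'. gen e' = (\<lambda>c i. - gen e c i)"
  proof (cases "a \<in> R (tag_index t)")
    case True
    then obtain b where "b \<in> R (tag_index t)" "\<forall>i. emb b i = - emb a i" using R_neg by blast
    then show ?thesis by (intro exI[of _ "(t, n, b)"]) (auto simp: gen_def e True fun_eq_iff)
  next
    case False
    then show ?thesis by (intro exI[of _ e]) (auto simp: gen_def e fun_eq_iff)
  qed
  then obtain e' where e': "gen e' = (\<lambda>c i. - gen e c i)" by blast
  show ?case by (rule exI[of _ "e' # l'"]) (simp add: l' e')
qed

lemma gen_loc: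
  assumes "c \<in> tag_coords t" "tag_index t = k"
  shows "gen (t, n, a) c \<in> loc k (tag_prime t)"
proof (cases "a \<in> R k")
  case True
  have "(\<lambda>i. of_nat (tag_prime t ^ n) * gen (t, n, a) c i) \<in> lat k"
    unfolding lat_def using assms True by (auto simp: gen_def intro!: bexI[of _ a])
  then show ?thesis by (auto simp: loc_def)
next
  case False
  then have "gen (t, n, a) c = (\<lambda>i. 0)" using assms by (auto simp: gen_def)
  then show ?thesis using loc_zero by simp
qed

lemma gen_outside: "c \<notin> tag_coords t \<Longrightarrow> gen (t, n, a) c = (\<lambda>i. 0)"
  by (auto simp: gen_def)

lemma gen_same: "c \<in> tag_coords t \<Longrightarrow> d \<in> tag_coords t \<Longrightarrow> gen (t, n, a) c = gen (t, n, a) d"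
  by (auto simp: gen_def)

text \<open>Sorts the generators meeting the two copies of \<open>R k\<close> by their tags. The
  point is that one and the same \<open>b\<close> occurs in both coordinates, since a
  \<open>Diag\<close> generator has equal entries there.\<close>

lemma val_decomposition:
  obtains a b c d where "a \<in> loc k (tag_prime (First k))" "b \<in> loc k (tag_prime (Diag k))"
    "c \<in> loc k (tag_prime (Second k))" "d \<in> loc k (tag_prime (Incl k))"
    "val l (Fst k) = (\<lambda>i. a i + b i)" "val l (Snd k) = (\<lambda>i. b i + (c i + d i))"
proof -
  have "\<exists>a b c d. a \<in> loc k (tag_prime (First k)) \<and> b \<in> loc k (tag_prime (Diag k)) \<and>
    c \<in> loc k (tag_prime (Second k)) \<and> d \<in> loc k (tag_prime (Incl k)) \<and>
    val l (Fst k) = (\<lambda>i. a i + b i) \<and> val l (Snd k) = (\<lambda>i. b i + (c i + d i))"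
  proof (induction l)
    case Nil
    show ?case by (intro exI[of _ "\<lambda>i. 0"]) (simp add: loc_zero)
  next
    case (Cons e l)
    then obtain a b c d where IH: "a \<in> loc k (tag_prime (First k))" "b \<in> loc k (tag_prime (Diag k))"
      "c \<in> loc k (tag_prime (Second k))" "d \<in> loc k (tag_prime (Incl k))"
      "val l (Fst k) = (\<lambda>i. a i + b i)" "val l (Snd k) = (\<lambda>i. b i + (c i + d i))" by blast
    obtain t n x where e: "e = (t, n, x)" by (cases e)
    consider "t = First k" | "t = Diag k" | "t = Second k" | "t = Incl k" | "Fst k \<notin> tag_coords t" "Snd k \<notin> tag_coords t"
      by (cases t) auto
    then show ?case
    proof cases
      case 1
      then show ?thesis using IH gen_loc[of "Fst k" t k n x] loc_add[of a k _ "gen e (Fst k)"]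
        by (intro exI[of _ "\<lambda>i. a i + gen e (Fst k) i"] exI[of _ b] exI[of _ c] exI[of _ d])
          (auto simp: e gen_outside)
    next
      case 2
      then show ?thesis using IH gen_loc[of "Fst k" t k n x] loc_add[of b k _ "gen e (Fst k)"]
          gen_same[of "Fst k" t "Snd k" n x]
        by (intro exI[of _ a] exI[of _ "\<lambda>i. b i + gen e (Fst k) i"] exI[of _ c] exI[of _ d])
          (auto simp: e)
    next
      case 3
      then show ?thesis using IH gen_loc[of "Snd k" t k n x] loc_add[of c k _ "gen e (Snd k)"]
        by (intro exI[of _ a] exI[of _ b] exI[of _ "\<lambda>i. c i + gen e (Snd k) i"] exI[of _ d])
          (auto simp: e gen_outside)
    next
      case 4
      then show ?thesis using IH gen_loc[of "Snd k" t k n x] loc_add[of d k _ "gen e (Snd k)"]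
        by (intro exI[of _ a] exI[of _ b] exI[of _ c] exI[of _ "\<lambda>i. d i + gen e (Snd k) i"])
          (auto simp: e gen_outside)
    next
      case 5
      then show ?thesis using IH
        by (intro exI[of _ a] exI[of _ b] exI[of _ c] exI[of _ d]) (auto simp: e gen_outside)
    qed
  qed
  then show thesis using that by blast
qed

text \<open>Elements of \<open>H\<close> that stay in \<open>H\<close> after division by any power
  of the prime of \<open>t\<close>, that is, its infinitely divisible part at this prime.\<close>

definition divisible :: "tag \<Rightarrow> (coord \<Rightarrow> 'n \<Rightarrow> rat) \<Rightarrow> bool" where
  "divisible t x \<longleftrightarrow> (\<forall>n. \<exists>y\<in>range val. \<forall>c i. x c i = of_nat (tag_prime t ^ n) * y c i)"

text \<open>The hypothesis says that the functional with weights \<open>u\<close> at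
  \<open>c\<close> and \<open>v\<close> at \<open>d\<close> vanishes on all generators with tag
  \<open>t\<close>. The remaining generators contribute only denominators prime to the prime of
  \<open>t\<close>.\<close>

lemma val_denominator:
  fixes u v :: int
  assumes "(if c \<in> tag_coords t then u else 0) + (if d \<in> tag_coords t then v else 0) = 0"
  shows "\<exists>m. coprime m (tag_prime t) \<and>
    of_nat m * (of_int u * val l c i + of_int v * val l d i) \<in> \<int>"
proof (induction l)
  case Nil
  show ?case by (intro exI[of _ 1]) simp
next
  case (Cons e l)
  then obtain m where m: "coprime m (tag_prime t)"
    "of_nat m * (of_int u * val l c i + of_int v * val l d i) \<in> \<int>" by blast
  obtain s n a where e: "e = (s, n, a)" by (cases e)
  show ?case
  proof (cases "s = t")
    case True
    have "of_int u * gen e c i + of_int v * gen e d i =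
      of_int ((if c \<in> tag_coords t then u else 0) + (if d \<in> tag_coords t then v else 0)) *
        (if a \<in> R (tag_index t) then of_int (emb a i) / of_nat (tag_prime t ^ n) else 0)"
      by (simp add: e True gen_def algebra_simps add_divide_distrib)
    then have *: "of_int u * gen e c i + of_int v * gen e d i = 0" by (simp add: assms)
    have "of_int u * val (e # l) c i + of_int v * val (e # l) d i =
      (of_int u * gen e c i + of_int v * gen e d i) + (of_int u * val l c i + of_int v * val l d i)"
      by (simp add: algebra_simps)
    then show ?thesis using m by (intro exI[of _ m]) (simp add: *)
  next
    case False
    define p where "p = tag_prime s ^ n"
    have p: "coprime p (tag_prime t)" "p > 0" using False by (auto simp: p_def)
    have int: "of_nat p * gen e b i \<in> \<int>" for b
      using p by (auto simp: e gen_def p_def)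
    have "of_nat (m * p) * (of_int u * val (e # l) c i + of_int v * val (e # l) d i) =
      of_nat m * (of_int u * (of_nat p * gen e c i) + of_int v * (of_nat p * gen e d i)) +
      of_nat p * (of_nat m * (of_int u * val l c i + of_int v * val l d i))"
      by (simp add: algebra_simps)
    moreover have "\<dots> \<in> \<int>" by (intro Ints_add Ints_mult int m(2)) auto
    ultimately show ?thesis using m(1) p(1) by (intro exI[of _ "m * p"]) auto
  qed
qed

text \<open>Write the value of the functional as \<open>a / b\<close>. Divisibility of
  \<open>x\<close> by the \<open>n\<close>-th power of the prime, together with
  \<open>val_denominator\<close>, shows that this power divides \<open>a\<close>. As
  \<open>n\<close> is arbitrary, \<open>a\<close> is zero.\<close>

lemma divisible_functional:
  fixes u v :: int
  assumes x: "divisible t x"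
    and uv: "(if c \<in> tag_coords t then u else 0) + (if d \<in> tag_coords t then v else 0) = 0"
  shows "of_int u * x c i + of_int v * x d i = 0"
proof -
  define X where "X = of_int u * x c i + of_int v * x d i"
  obtain a b where ab: "X = of_int a / of_int b" "b > 0"     using quotient_of_div[of X] quotient_of_denom_pos[of X] by (cases "quotient_of X") auto
  let ?p = "tag_prime t"
  have "int ?p ^ n dvd a" for n
  proof -
    obtain l where l: "\<And>c i. x c i = of_nat (?p ^ n) * val l c i"
      using x unfolding divisible_def by blast
    obtain m where m: "coprime m ?p" "of_nat m * (of_int u * val l c i + of_int v * val l d i) \<in> \<int>"
      using val_denominator[OF uv] by blast
    then obtain z where z: "of_nat m * (of_int u * val l c i + of_int v * val l d i) = of_int z"
      by (auto elim: Ints_cases)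
    have "of_nat m * X = of_nat (?p ^ n) * (of_nat m * (of_int u * val l c i + of_int v * val l d i))"
      unfolding X_def l by (simp add: algebra_simps)
    then have "of_int (int m * a) = (of_int (int (?p ^ n) * z * b) :: rat)"
      unfolding z ab(1) using ab(2) by (simp add: field_simps)
    then have "int m * a = int (?p ^ n) * z * b" by (rule of_int_eq_iff[THEN iffD1])
    then have "int ?p ^ n dvd int m * a" by simp
    moreover have "coprime (int ?p ^ n) (int m)"
      using m(1) by (simp add: coprime_commute)
    ultimately show ?thesis by (simp add: coprime_dvd_mult_right_iff)
  qed
  \<comment> \<open>A nonzero \<open>a\<close> is smaller in absolute value than 2 to the power of
    its absolute value, so this exponent is already too large.\<close>
  moreover have "\<not> int ?p ^ nat \<bar>a\<bar> dvd a" if "a \<noteq> 0"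
  proof
    assume "int ?p ^ nat \<bar>a\<bar> dvd a"
    then have "\<bar>int ?p ^ nat \<bar>a\<bar>\<bar> \<le> \<bar>a\<bar>" using that by (intro dvd_imp_le_int)
    then have "int (?p ^ nat \<bar>a\<bar>) \<le> \<bar>a\<bar>" by simp
    then have "?p ^ nat \<bar>a\<bar> \<le> nat \<bar>a\<bar>" by linarith
    moreover have "nat \<bar>a\<bar> < 2 ^ nat \<bar>a\<bar>" by (rule less_exp)
    moreover have "2 ^ nat \<bar>a\<bar> \<le> ?p ^ nat \<bar>a\<bar>" by (rule power_mono) (auto simp: prime_ge_2_nat)
    ultimately show False by linarith
  qed
  ultimately have "a = 0" by blast
  then show ?thesis using ab by (simp add: X_def)
qed

text \<open>The functional is a single coordinate, obtained with weights 1 and 0. The next lemma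
  takes weights 1 and -1 and compares two coordinates of the same tag.\<close>

lemma divisible_outside: "divisible t x \<Longrightarrow> c \<notin> tag_coords t \<Longrightarrow> x c i = 0"
  using divisible_functional[of t x c 1 c 0 i] by simp

lemma divisible_diagonal: "divisible t x \<Longrightarrow> c \<in> tag_coords t \<Longrightarrow> d \<in> tag_coords t \<Longrightarrow> x c i = x d i"
  using divisible_functional[of t x c 1 d "-1" i] by simp

lemma divisible_gen:
  assumes "a \<in> R (tag_index t)"
  shows "divisible t (val [(t, 0, a)])"
  unfolding divisible_def
proof (intro allI bexI[OF _ rangeI])
  fix n c i
  show "val [(t, 0, a)] c i = of_nat (tag_prime t ^ n) * val [(t, n, a)] c i"
    by (simp add: gen_def)
qed

end

section \<open>Additive maps between coded groups respect the coded lattices\<close>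

context
  fixes add :: "'c \<Rightarrow> 'c \<Rightarrow> 'c" and emb :: "'c \<Rightarrow> 'n \<Rightarrow> int" and R :: "nat \<Rightarrow> 'c set"
    and add' :: "'d \<Rightarrow> 'd \<Rightarrow> 'd" and emb' :: "'d \<Rightarrow> 'm \<Rightarrow> int" and R' :: "nat \<Rightarrow> 'd set"
  assumes A: "lattice_family add emb R" and B: "lattice_family add' emb' R'"
begin

interpretation A: lattice_family add emb R by (rule A)
interpretation B: lattice_family add' emb' R' by (rule B)

context
  fixes h :: "(coord \<Rightarrow> 'n \<Rightarrow> rat) \<Rightarrow> (coord \<Rightarrow> 'm \<Rightarrow> rat)"
  assumes h_range: "x \<in> range A.val \<Longrightarrow> h x \<in> range B.val"
    and h_add: "x \<in> range A.val \<Longrightarrow> y \<in> range A.val \<Longrightarrow>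
      h (\<lambda>c i. x c i + y c i) = (\<lambda>c i. h x c i + h y c i)"
begin

lemma h_zero: "h (\<lambda>c i. 0) = (\<lambda>c i. 0)"
proof -
  have "(\<lambda>c i. 0) \<in> range A.val" using rangeI[of A.val "[]"] by simp
  from h_add[OF this this] have "h (\<lambda>c i. 0) = (\<lambda>c i. h (\<lambda>c i. 0) c i + h (\<lambda>c i. 0) c i)"
    by simp
  from fun_cong[OF fun_cong[OF this]] have "h (\<lambda>c i. 0) c i = 0" for c i
    by (metis add_cancel_right_right)
  then show ?thesis by (simp add: fun_eq_iff)
qed

lemma scale_in_range:
  "x \<in> range A.val \<Longrightarrow> (\<lambda>c i. of_nat m * x c i) \<in> range A.val \<and>
    h (\<lambda>c i. of_nat m * x c i) = (\<lambda>c i. of_nat m * h x c i)"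
proof (induction m)
  case 0
  then show ?case using rangeI[of A.val "[]"] by (simp add: h_zero)
next
  case (Suc m)
  let ?y = "\<lambda>c i. of_nat m * x c i"
  have IH: "?y \<in> range A.val" "h ?y = (\<lambda>c i. of_nat m * h x c i)" using Suc by auto
  have eq: "(\<lambda>c i. of_nat (Suc m) * x c i) = (\<lambda>c i. x c i + ?y c i)"
    by (simp add: fun_eq_iff algebra_simps)
  obtain l l' where "x = A.val l" "?y = A.val l'" using Suc.prems IH(1) by auto
  then have "(\<lambda>c i. x c i + ?y c i) = A.val (l @ l')"
    by (simp add: A.val_append fun_eq_iff)
  moreover have "h (\<lambda>c i. x c i + ?y c i) = (\<lambda>c i. of_nat (Suc m) * h x c i)"
    using h_add[OF Suc.prems IH(1)] IH(2) by (simp add: fun_eq_iff algebra_simps)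
  ultimately show ?case unfolding eq by simp
qed

lemma divisible_transfer:
  assumes "A.divisible t x"
  shows "B.divisible t (h x)"
  unfolding B.divisible_def
proof
  fix n
  obtain y where y: "y \<in> range A.val" "\<And>c i. x c i = of_nat (tag_prime t ^ n) * y c i"
    using assms unfolding A.divisible_def by blast
  have "x = (\<lambda>c i. of_nat (tag_prime t ^ n) * y c i)" using y(2) by (simp add: fun_eq_iff)
  then have "h x = (\<lambda>c i. of_nat (tag_prime t ^ n) * h y c i)" using scale_in_range[OF y(1)] by metis
  then show "\<exists>y\<in>range B.val. \<forall>c i. h x c i = of_nat (tag_prime t ^ n) * y c i"
    using h_range[OF y(1)] by (intro bexI[of _ "h y"]) simp_all
qed

text \<open>Let \<open>x\<close>, \<open>x'\<close>, \<open>s\<close> be \<open>a\<close> placed in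
  the first copy, the second copy and \<open>L\<close>. Each is divisible at its own prime,
  \<open>x + x'\<close> at the prime of \<open>Diag k\<close>, and \<open>x' + s\<close> at that of
  \<open>Incl k\<close>. An additive map preserves all five facts, so the images carry one common
  vector \<open>y\<close> in the three places. The vector \<open>y\<close> is then shown to lie in
  \<open>R' k\<close> with two different primes inverted, hence in \<open>R' k\<close>.\<close>

lemma star_transfer:
  assumes a: "a \<in> R k"
  shows "\<exists>b\<in>R' k. h (A.val [(Base, 0, a)]) = B.val [(Base, 0, b)]"
proof -
  define x where "x = A.val [(First k, 0, a)]"
  define x' where "x' = A.val [(Second k, 0, a)]"
  define s where "s = A.val [(Base, 0, a)]"
  have r: "x \<in> range A.val" "x' \<in> range A.val" "s \<in> range A.val"
    unfolding x_def x'_def s_def by (rule rangeI)+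
  have t: "A.val [(Diag k, 0, a)] = (\<lambda>c i. x c i + x' c i)"
    unfolding x_def x'_def using a by (auto simp: fun_eq_iff A.gen_def)
  have u: "A.val [(Incl k, 0, a)] = (\<lambda>c i. x' c i + s c i)"
    unfolding s_def x'_def using a A.R_0 by (auto simp: fun_eq_iff A.gen_def)
  have "A.divisible (First k) x" "A.divisible (Second k) x'" "A.divisible Base s"
    "A.divisible (Diag k) (\<lambda>c i. x c i + x' c i)" "A.divisible (Incl k) (\<lambda>c i. x' c i + s c i)"
    unfolding t[symmetric] u[symmetric] unfolding x_def x'_def s_def using a A.R_0
    by (intro A.divisible_gen; simp)+
  then have dx: "B.divisible (First k) (h x)" and dx': "B.divisible (Second k) (h x')" and ds: "B.divisible Base (h s)"
    and dt: "B.divisible (Diag k) (\<lambda>c i. h x c i + h x' c i)"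
    and du: "B.divisible (Incl k) (\<lambda>c i. h x' c i + h s c i)"
    using divisible_transfer h_add[OF r(1,2), symmetric] h_add[OF r(2,3), symmetric] by simp_all
  define y where "y = h x (Fst k)"
  have out: "h x (Snd k) i = 0" "h x' (Fst k) i = 0" "h x' Star i = 0" "h s (Snd k) i = 0" for i
    using B.divisible_outside[OF dx, of "Snd k" i] B.divisible_outside[OF dx', of "Fst k" i]
      B.divisible_outside[OF dx', of Star i] B.divisible_outside[OF ds, of "Snd k" i] by auto
  have x'y: "h x' (Snd k) = y"
    using B.divisible_diagonal[OF dt, of "Fst k" "Snd k"] out by (simp add: y_def fun_eq_iff)
  have sy: "h s Star = y"
    using B.divisible_diagonal[OF du, of "Snd k" Star] out x'y by (simp add: fun_eq_iff)
  \<comment> \<open>The second coordinate of \<open>h x\<close> vanishes, so its diagonal part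
    \<open>b\<close> is also a sum of elements localised at the primes of \<open>Second k\<close>
    and \<open>Incl k\<close>. Coprimality makes \<open>b\<close> integral, leaving only the
    denominators of the \<open>First k\<close> part.\<close>
  have "y \<in> B.loc k (tag_prime (First k))"
  proof -
    obtain l where l: "h x = B.val l" using h_range[OF r(1)] by (rule rangeE)
    obtain a b c d where abcd: "a \<in> B.loc k (tag_prime (First k))" "b \<in> B.loc k (tag_prime (Diag k))"
      "c \<in> B.loc k (tag_prime (Second k))" "d \<in> B.loc k (tag_prime (Incl k))"
      "y = (\<lambda>i. a i + b i)" "h x (Snd k) = (\<lambda>i. b i + (c i + d i))"
      unfolding y_def l by (rule B.val_decomposition)
    have "b = (\<lambda>i. - c i + - d i)"
    proof
      fix i have "b i + (c i + d i) = 0" using out(1)[of i] abcd(6) by simp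
      then show "b i = - c i + - d i" by linarith
    qed
    then have "b \<in> B.lat k"
      by (rule B.loc_coprime_sum[OF abcd(2) _ B.loc_neg[OF abcd(3)] B.loc_neg[OF abcd(4)]]) simp_all
    then show ?thesis unfolding abcd(5) by (intro B.loc_add abcd(1) B.lat_loc)
  qed
  \<comment> \<open>Both copies of \<open>h x + h x'\<close> equal \<open>y\<close>. Cancelling the
    shared diagonal part gives \<open>a = c + d\<close>, so now the \<open>First k\<close> part is
    integral.\<close>
  moreover have "y \<in> B.loc k (tag_prime (Diag k))"
  proof -
    have "h (A.val [(Diag k, 0, a)]) \<in> range B.val" by (rule h_range[OF rangeI])
    then have "(\<lambda>c i. h x c i + h x' c i) \<in> range B.val" unfolding t h_add[OF r(1,2)] .
    then obtain l where l: "(\<lambda>c i. h x c i + h x' c i) = B.val l" by (rule rangeE)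
    obtain a b c d where abcd: "a \<in> B.loc k (tag_prime (First k))" "b \<in> B.loc k (tag_prime (Diag k))"
      "c \<in> B.loc k (tag_prime (Second k))" "d \<in> B.loc k (tag_prime (Incl k))"
      "B.val l (Fst k) = (\<lambda>i. a i + b i)" "B.val l (Snd k) = (\<lambda>i. b i + (c i + d i))"
      by (rule B.val_decomposition)
    have y1: "y i = a i + b i" and y2: "y i = b i + (c i + d i)" for i
      using abcd(5,6) out x'y by (simp_all add: l[symmetric] y_def fun_eq_iff)
    have "a = (\<lambda>i. c i + d i)"
    proof
      fix i show "a i = c i + d i" using y1[of i] y2[of i] by linarith
    qed
    then have "a \<in> B.lat k"
      by (rule B.loc_coprime_sum[OF abcd(1) _ abcd(3,4)]) simp_all
    moreover have "y = (\<lambda>i. a i + b i)" using y1 by auto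
    ultimately show ?thesis using B.loc_add[OF B.lat_loc abcd(2)] by simp
  qed
  ultimately have "y \<in> B.lat k" by (rule B.loc_coprime) simp
  then obtain b where b: "b \<in> R' k" "\<And>i. y i = of_int (emb' b i)" by (auto simp: B.lat_def)
  have "h s c i = B.val [(Base, 0, b)] c i" for c i
    using sy b(2)[of i] B.divisible_outside[OF ds, of c i] B.R_0 by (auto simp: B.gen_def)
  then show ?thesis using b(1) by (auto simp: s_def fun_eq_iff)
qed

end

end

context lattice_family
begin

lemma val_star: "val [(Base, 0, a)] Star i = of_int (emb a i)"
  by (simp add: gen_def R_0)

lemma val_star_inject: "val [(Base, 0, a)] = val [(Base, 0, b)] \<longleftrightarrow> a = b"
proof
  assume "val [(Base, 0, a)] = val [(Base, 0, b)]"
  then have "(of_int (emb a i) :: rat) = of_int (emb b i)" for i by (metis val_star)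
  then show "a = b" by (intro emb_eq) simp
qed simp

lemma val_star_add: "val [(Base, 0, add a b)] = (\<lambda>c i. val [(Base, 0, a)] c i + val [(Base, 0, b)] c i)"
  by (auto simp: gen_def R_0 emb_add fun_eq_iff)

end

text \<open>\<open>star_transfer\<close> is applied to \<open>h\<close> and to its inverse. The case
  \<open>k = 0\<close>, where the subgroup is everything, yields mutually inverse maps on all of
  \<open>L\<close>; the other \<open>k\<close> show that they match the subgroups.\<close>

lemma lattice_family_iso:
  fixes h :: "(coord \<Rightarrow> 'n \<Rightarrow> rat) \<Rightarrow> (coord \<Rightarrow> 'm \<Rightarrow> rat)"
  assumes A: "lattice_family add emb R" and B: "lattice_family add' emb' R'"
    and bij: "bij_betw h (range (lattice_family.val emb R)) (range (lattice_family.val emb' R'))"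
    and h_add: "\<And>x y. x \<in> range (lattice_family.val emb R) \<Longrightarrow> y \<in> range (lattice_family.val emb R) \<Longrightarrow>
      h (\<lambda>c i. x c i + y c i) = (\<lambda>c i. h x c i + h y c i)"
  obtains f where "bij f" "\<And>a b. f (add a b) = add' (f a) (f b)" "\<And>k a. a \<in> R k \<longleftrightarrow> f a \<in> R' k"
proof -
  interpret A: lattice_family add emb R by (rule A)
  interpret B: lattice_family add' emb' R' by (rule B)
  define g where "g = the_inv_into (range A.val) h"
  have h_range: "h x \<in> range B.val" if "x \<in> range A.val" for x
    using that bij unfolding bij_betw_def by blast
  have g_range: "g x \<in> range A.val" if "x \<in> range B.val" for x
    using bij_betw_apply[OF bij_betw_the_inv_into[OF bij] that] unfolding g_def .
  have hg: "h (g x) = x" if "x \<in> range B.val" for x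
    unfolding g_def using f_the_inv_into_f_bij_betw[OF bij] that by blast
  have gh: "g (h x) = x" if "x \<in> range A.val" for x
    unfolding g_def using the_inv_into_f_f[OF bij_betw_imp_inj_on[OF bij] that] .
  have g_add: "g (\<lambda>c i. x c i + y c i) = (\<lambda>c i. g x c i + g y c i)"
    if xy: "x \<in> range B.val" "y \<in> range B.val" for x y
  proof -
    have "h (\<lambda>c i. g x c i + g y c i) = (\<lambda>c i. x c i + y c i)"
      using h_add g_range hg that by simp
    moreover have "(\<lambda>c i. g x c i + g y c i) \<in> range A.val"
    proof -
      obtain l where "g x = A.val l" using g_range[OF xy(1)] by (rule rangeE)
      moreover obtain l' where "g y = A.val l'" using g_range[OF xy(2)] by (rule rangeE)
      ultimately have "(\<lambda>c i. g x c i + g y c i) = A.val (l @ l')"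
        by (simp add: A.val_append fun_eq_iff)
      then show ?thesis by (metis rangeI)
    qed
    ultimately show ?thesis using gh[of "\<lambda>c i. g x c i + g y c i"] by simp
  qed
  have h_star: "\<exists>b\<in>R' k. h (A.val [(Base, 0, a)]) = B.val [(Base, 0, b)]" if "a \<in> R k" for a k
    by (rule star_transfer[OF A B, where h = h, OF _ _ that]) (fact h_range h_add)+
  have g_star: "\<exists>b\<in>R k. g (B.val [(Base, 0, a)]) = A.val [(Base, 0, b)]" if "a \<in> R' k" for a k
    by (rule star_transfer[OF B A, where h = g, OF _ _ that]) (fact g_range g_add)+
  obtain f where f: "\<And>a. h (A.val [(Base, 0, a)]) = B.val [(Base, 0, f a)]"
    using h_star[of _ 0] A.R_0 by (metis UNIV_I)
  obtain f' where f': "\<And>a. g (B.val [(Base, 0, a)]) = A.val [(Base, 0, f' a)]"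
    using g_star[of _ 0] B.R_0 by (metis UNIV_I)
  have f'f: "f' (f a) = a" for a
    using gh[OF rangeI[of A.val "[(Base, 0, a)]"]] f f' A.val_star_inject by metis
  have ff': "f (f' a) = a" for a
    using hg[OF rangeI[of B.val "[(Base, 0, a)]"]] f f' B.val_star_inject by metis
  show thesis
  proof (rule that)
    show "bij f" by (rule o_bij[of f']) (auto simp: f'f ff')
    show "f (add a b) = add' (f a) (f b)" for a b
    proof -
      have "B.val [(Base, 0, f (add a b))] = B.val [(Base, 0, add' (f a) (f b))]"
        unfolding f[symmetric] A.val_star_add B.val_star_add
        by (rule h_add) (rule rangeI)+
      then show ?thesis using B.val_star_inject by blast
    qed
    show "a \<in> R k \<longleftrightarrow> f a \<in> R' k" for k a
      using h_star[of a k] g_star[of "f a" k] f f' f'f A.val_star_inject B.val_star_inject by metis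
  qed
qed

section \<open>Deciding equality in the coded group by integral words\<close>

fun den :: "(tag \<times> nat \<times> 'c) list \<Rightarrow> nat" where
  "den [] = 1"
| "den ((t, n, a) # l) = tag_prime t ^ n * den l"

text \<open>Coordinate \<open>c\<close> of \<open>N\<close> times the value of a list, shifted by
  \<open>b\<close> and computed with \<open>add\<close> alone. The exponents
  \<open>N div tag_prime t ^ n\<close> are exact once \<open>den l\<close> divides
  \<open>N\<close>.\<close>

fun word :: "('c \<Rightarrow> 'c \<Rightarrow> 'c) \<Rightarrow> (nat \<Rightarrow> 'c set) \<Rightarrow> nat \<Rightarrow> coord \<Rightarrow> 'c \<Rightarrow> (tag \<times> nat \<times> 'c) list \<Rightarrow> 'c" where
  "word add R N c b [] = b"
| "word add R N c b ((t, n, a) # l) = (if a \<in> R (tag_index t) \<and> c \<in> tag_coords t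
     then (add a ^^ (N div tag_prime t ^ n)) (word add R N c b l) else word add R N c b l)"

lemma den_pos: "den l > 0"
  by (induction l rule: den.induct) auto

context lattice_family
begin

lemma emb_iterate: "emb ((add a ^^ m) b) i = int m * emb a i + emb b i"
  by (induction m) (auto simp: emb_add algebra_simps)

lemma emb_word:
  "den l dvd N \<Longrightarrow> of_int (emb (word add R N c b l) i) = of_int (emb b i) + of_nat N * val l c i"
proof (induction l rule: den.induct)
  case (2 t n a l)
  have "den l dvd N" "tag_prime t ^ n dvd N" using "2.prems" by (auto elim: dvd_mult_left dvd_mult_right)
  then show ?case using 2 by (auto simp: gen_def emb_iterate of_nat_div algebra_simps)
qed simp

text \<open>Clearing denominators. The base point \<open>b\<close> stands in for the neutral element,
  which is not available as a term in a structure.\<close>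

lemma val_eq_iff_word:
  "val l = val l' \<longleftrightarrow> (\<forall>c. word add R (den l * den l') c b l = word add R (den l * den l') c b l')"
proof -
  have "word add R (den l * den l') c b l = word add R (den l * den l') c b l' \<longleftrightarrow> val l c = val l' c" for c
  proof -
    have "word add R (den l * den l') c b l = word add R (den l * den l') c b l' \<longleftrightarrow>
      (\<forall>i. (of_int (emb (word add R (den l * den l') c b l) i) :: rat) =
        of_int (emb (word add R (den l * den l') c b l') i))"
      using emb_eq by (metis of_int_eq_iff)
    also have "\<dots> \<longleftrightarrow> (\<forall>i. val l c i = val l' c i)"
      using den_pos[of l] den_pos[of l'] by (simp add: emb_word)
    finally show ?thesis by (simp add: fun_eq_iff)
  qed
  then show ?thesis by (simp add: fun_eq_iff)
qed

end

definition map_word :: "('c \<Rightarrow> 'd) \<Rightarrow> (tag \<times> nat \<times> 'c) list \<Rightarrow> (tag \<times> nat \<times> 'd) list" where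
  "map_word f = map (map_prod id (map_prod id f))"

lemma den_map_word: "den (map_word f l) = den l"
  by (induction l rule: den.induct) (auto simp: map_word_def)

lemma word_map_word:
  assumes "\<And>a b. f (add a b) = add' (f a) (f b)" "\<And>k a. a \<in> R k \<longleftrightarrow> f a \<in> R' k"
  shows "word add' R' N c (f b) (map_word f l) = f (word add R N c b l)"
proof (induction l rule: den.induct)
  case (2 t n a l)
  have "f ((add a ^^ m) x) = (add' (f a) ^^ m) (f x)" for m x
    by (induction m) (auto simp: assms)
  then show ?case using 2 assms(2) by (auto simp: map_word_def)
qed (simp add: map_word_def)

text \<open>Equality of values is a statement about words, and \<open>f\<close> carries words to
  words. Thus the relations between codes depend on the lattices and not on the chosen
  embeddings.\<close>

lemma val_map_word_eq_iff:
  assumes A: "lattice_family add emb R" and B: "lattice_family add' emb' R'"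
    and f: "inj f" "\<And>a b. f (add a b) = add' (f a) (f b)" "\<And>k a. a \<in> R k \<longleftrightarrow> f a \<in> R' k"
  shows "lattice_family.val emb' R' (map_word f l) = lattice_family.val emb' R' (map_word f l') \<longleftrightarrow>
    lattice_family.val emb R l = lattice_family.val emb R l'"
proof -
  fix b
  show ?thesis
    unfolding lattice_family.val_eq_iff_word[OF A, of _ _ b]
      lattice_family.val_eq_iff_word[OF B, of _ _ "f b"] den_map_word
      word_map_word[of f add add' R R', OF f(2,3)] inj_eq[OF f(1)] ..
qed

text \<open>The map \<open>h\<close> picks any code of its argument and applies \<open>f\<close>
  inside it. By \<open>val_map_word_eq_iff\<close> the choice does not matter and \<open>h\<close>
  is injective; concatenation of codes gives additivity.\<close>

lemma lattice_family_iso_conv: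
  assumes A: "lattice_family add emb R" and B: "lattice_family add' emb' R'"
    and f: "bij f" "\<And>a b. f (add a b) = add' (f a) (f b)" "\<And>k a. a \<in> R k \<longleftrightarrow> f a \<in> R' k"
  obtains h where "bij_betw h (range (lattice_family.val emb R)) (range (lattice_family.val emb' R'))"
    "\<And>x y. x \<in> range (lattice_family.val emb R) \<Longrightarrow> y \<in> range (lattice_family.val emb R) \<Longrightarrow>
      h (\<lambda>c i. x c i + y c i) = (\<lambda>c i. h x c i + h y c i)"
proof -
  interpret A: lattice_family add emb R by (rule A)
  interpret B: lattice_family add' emb' R' by (rule B)
  have inj: "inj f" using f(1) by (rule bij_is_inj)
  note eq = val_map_word_eq_iff[OF A B inj f(2,3)]
  define h where "h x = B.val (map_word f (SOME l. A.val l = x))" for x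
  have h: "h (A.val l) = B.val (map_word f l)" for l
    unfolding h_def eq by (rule someI[of _ l]) simp
  have "\<exists>l'. map_word f l' = l" for l
  proof (rule exI)
    show "map_word f (map_word (inv_into UNIV f) l) = l"
      using bij_is_surj[OF f(1)]
      by (simp add: map_word_def comp_def map_prod_def case_prod_beta surj_f_inv_f)
  qed
  then have "surj (map_word f)" unfolding surj_def by metis
  then have "range (\<lambda>l. B.val (map_word f l)) = range B.val" by (metis image_image)
  then have surj: "h ` range A.val = range B.val" unfolding image_image h .
  show thesis
  proof (rule that)
    show "bij_betw h (range A.val) (range B.val)"
      unfolding bij_betw_def using surj by (auto simp: inj_on_def h eq)
    fix x y assume "x \<in> range A.val" "y \<in> range A.val"
    then obtain l l' where l: "x = A.val l" "y = A.val l'" by (elim rangeE) blast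
    have *: "(\<lambda>c i. x c i + y c i) = A.val (l @ l')" by (simp add: l A.val_append fun_eq_iff)
    show "h (\<lambda>c i. x c i + y c i) = (\<lambda>c i. h x c i + h y c i)"
      unfolding * h unfolding l h by (simp add: map_word_def B.val_append fun_eq_iff)
  qed
qed

lemma measurable_word:
  fixes add :: "'s \<Rightarrow> 'c::countable \<Rightarrow> 'c \<Rightarrow> 'c"
  assumes [measurable]: "\<And>a b. (\<lambda>S. add S a b) \<in> M \<rightarrow>\<^sub>M count_space UNIV"
    and [measurable]: "\<And>k a. Measurable.pred M (\<lambda>S. a \<in> R S k)"
  shows "(\<lambda>S. word (add S) (R S) N c b l) \<in> M \<rightarrow>\<^sub>M count_space UNIV"
proof (induction l rule: den.induct)
  case (2 t n a l)
  have "(\<lambda>S. (add S a ^^ m) (word (add S) (R S) N c b l)) \<in> M \<rightarrow>\<^sub>M count_space UNIV" for m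
  proof (induction m)
    case (Suc m)
    show ?case
      using measurable_compose_countable[OF assms(1) Suc] by simp
  qed (use 2 in simp)
  note [measurable] = this "2.IH"
  show ?case by simp
qed simp

section \<open>Group structures on the natural numbers\<close>

lemma carrier_grp [simp]: "carrier (grp S) = UNIV"
  by (simp add: grp_def)

lemma mult_grp [simp]: "x \<otimes>\<^bsub>grp S\<^esub> y = fst S (x, y)"
  by (simp add: grp_def)

text \<open>The condition under \<open>THE\<close> in \<open>grp\<close>, isolated because it is a
  countable conjunction of conditions on the table of \<open>S\<close>.\<close>

definition neutral :: "('i, 'j) str \<Rightarrow> nat \<Rightarrow> bool" where
  "neutral S e \<longleftrightarrow> (\<forall>x. fst S (e, x) = x)"

text \<open>Commutativity makes a left neutral element unique, which resolves the \<open>THE\<close>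
  in \<open>grp\<close>.\<close>

lemma comm_group_grpI:
  assumes assoc: "\<And>x y z. fst S (fst S (x, y), z) = fst S (x, fst S (y, z))"
    and comm: "\<And>x y. fst S (x, y) = fst S (y, x)"
    and e: "neutral S e" and inv: "\<And>x. \<exists>y. fst S (y, x) = e"
  shows "comm_group (grp S) \<and> \<one>\<^bsub>grp S\<^esub> = e"
proof -
  have "e' = e" if "\<forall>x. fst S (e', x) = x" for e'
  proof -
    have "fst S (e', e) = e" "fst S (e, e') = e'" using that e by (auto simp: neutral_def)
    then show ?thesis using comm[of e e'] by simp
  qed
  moreover have "\<forall>x. fst S (e, x) = x" using e by (simp add: neutral_def)
  ultimately have "(THE e. \<forall>x. fst S (e, x) = x) = e" by (intro the_equality)
  then have one: "\<one>\<^bsub>grp S\<^esub> = e" by (simp add: grp_def)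
  have "comm_group (grp S)"
  proof (rule comm_groupI)
    show "\<exists>y\<in>carrier (grp S). y \<otimes>\<^bsub>grp S\<^esub> x = \<one>\<^bsub>grp S\<^esub>" for x
      using inv by (simp add: one)
  qed (use assoc comm e in \<open>auto simp: one neutral_def\<close>)
  then show ?thesis using one by blast
qed

lemma neutral_iff:
  assumes "group (grp S)"
  shows "neutral S e \<longleftrightarrow> e = \<one>\<^bsub>grp S\<^esub>"
proof -
  interpret group "grp S" by fact
  show ?thesis
  proof
    assume "neutral S e"
    then have "e \<otimes>\<^bsub>grp S\<^esub> \<one>\<^bsub>grp S\<^esub> = \<one>\<^bsub>grp S\<^esub>" by (simp add: neutral_def)
    then show "e = \<one>\<^bsub>grp S\<^esub>" by (metis r_one carrier_grp UNIV_I)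
  next
    assume "e = \<one>\<^bsub>grp S\<^esub>"
    then show "neutral S e" unfolding neutral_def using l_one by simp
  qed
qed

lemma iso_grp_iff:
  "h \<in> Group.iso (grp S) (grp T) \<longleftrightarrow> bij h \<and> (\<forall>x y. h (fst S (x, y)) = fst T (h x, h y))"
  by (auto simp: Group.iso_def hom_def)

text \<open>Together with its counterpart below, this moves isomorphisms between presented groups
  and their copies on the natural numbers.\<close>

lemma bij_betw_pullback:
  assumes \<beta>: "bij_betw \<beta> UNIV X" and \<gamma>: "bij_betw \<gamma> UNIV Y" and k: "bij_betw k X Y"
  obtains h where "bij h" "\<And>x. \<gamma> (h x) = k (\<beta> x)"
proof (rule that)
  show "bij (the_inv_into UNIV \<gamma> \<circ> (k \<circ> \<beta>))"
    by (rule bij_betw_trans[OF bij_betw_trans[OF \<beta> k] bij_betw_the_inv_into[OF \<gamma>]])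
  show "\<gamma> ((the_inv_into UNIV \<gamma> \<circ> (k \<circ> \<beta>)) x) = k (\<beta> x)" for x
    using f_the_inv_into_f_bij_betw[OF \<gamma>] bij_betw_apply[OF k] bij_betw_apply[OF \<beta>] by simp
qed

lemma bij_betw_pushforward:
  assumes \<beta>: "bij_betw \<beta> UNIV X" and \<gamma>: "bij_betw \<gamma> UNIV Y" and h: "bij h"
  obtains k where "bij_betw k X Y" "\<And>x. k (\<beta> x) = \<gamma> (h x)"
proof (rule that)
  show "bij_betw (\<gamma> \<circ> h \<circ> the_inv_into UNIV \<beta>) X Y"
    by (rule bij_betw_trans[OF bij_betw_the_inv_into[OF \<beta>] bij_betw_trans[OF h \<gamma>]])
  show "(\<gamma> \<circ> h \<circ> the_inv_into UNIV \<beta>) (\<beta> x) = \<gamma> (h x)" for x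
    using the_inv_into_f_f[OF bij_betw_imp_inj_on[OF \<beta>]] by simp
qed

text \<open>The embeddings \<open>emb S\<close> may depend on \<open>S\<close> in any way: equality
  of codes is decided by words, which involve only the measurable data \<open>add\<close> and
  \<open>R\<close>. Torsion-freeness comes from the rational coordinates.\<close>

theorem lattice_family_reducible_TFAG:
  fixes \<Phi> :: "('i, 'j) sentence" and add :: "('i, 'j) str \<Rightarrow> 'c::countable \<Rightarrow> 'c \<Rightarrow> 'c"
    and R :: "('i, 'j) str \<Rightarrow> nat \<Rightarrow> 'c set" and emb :: "('i, 'j) str \<Rightarrow> 'c \<Rightarrow> 'n \<Rightarrow> int"
  assumes inf: "infinite (UNIV :: 'c set)"
    and add_meas: "\<And>a b. (\<lambda>S. add S a b) \<in> Models \<Phi> \<rightarrow>\<^sub>M count_space UNIV"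
    and R_meas: "\<And>k a. Measurable.pred (Models \<Phi>) (\<lambda>S. a \<in> R S k)"
    and fam: "\<And>S. S \<in> space (Models \<Phi>) \<Longrightarrow> lattice_family (add S) (emb S) (R S)"
    and iso: "\<And>S T. S \<in> space (Models \<Phi>) \<Longrightarrow> T \<in> space (Models \<Phi>) \<Longrightarrow> model_iso \<Phi> S T \<longleftrightarrow>
      (\<exists>f. bij f \<and> (\<forall>a b. f (add S a b) = add T (f a) (f b)) \<and> (\<forall>k a. a \<in> R S k \<longleftrightarrow> f a \<in> R T k))"
  shows "\<Phi> \<le>\<^sub>B TFAG"
proof -
  define \<nu> where "\<nu> S = lattice_family.val (emb S) (R S)" for S
  define mul where "mul x y = (\<lambda>c i. x c i + y c i)" for x y :: "coord \<Rightarrow> 'n \<Rightarrow> rat"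
  have mul: "mul (\<nu> S l) (\<nu> S l') = \<nu> S (l @ l')" if "S \<in> space (Models \<Phi>)" for S l l'
    unfolding \<nu>_def mul_def by (simp add: lattice_family.val_append[OF fam[OF that]] fun_eq_iff)
  have eq_meas: "Measurable.pred (Models \<Phi>) (\<lambda>S. \<nu> S l = \<nu> S l')" for l l'
  proof -
    fix b :: 'c
    note [measurable] = measurable_word[OF add_meas R_meas]
    have "Measurable.pred (Models \<Phi>) (\<lambda>S. \<forall>c. word (add S) (R S) (den l * den l') c b l =
      word (add S) (R S) (den l * den l') c b l')" by measurable
    then show ?thesis
      by (subst measurable_cong[OF lattice_family.val_eq_iff_word[OF fam, folded \<nu>_def]])
  qed
  have mul_meas: "Measurable.pred (Models \<Phi>) (\<lambda>S. mul (\<nu> S a) (\<nu> S b) = \<nu> S c)" for a b c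
    using eq_meas[of "a @ b" c] by (subst measurable_cong[where g = "\<lambda>S. \<nu> S (a @ b) = \<nu> S c"]) (simp_all add: mul)
  have inf_range: "infinite (range (\<nu> S))" if S: "S \<in> space (Models \<Phi>)" for S
  proof -
    have "inj (\<lambda>a. \<nu> S [(Base, 0, a)])"
      unfolding \<nu>_def using lattice_family.val_star_inject[OF fam[OF S]] by (simp only: inj_def) blast
    then have "infinite (range (\<lambda>a. \<nu> S [(Base, 0, a)]))" using inf finite_imageD by blast
    then show ?thesis by (rule infinite_super[rotated]) blast
  qed
  obtain f \<beta> where f: "f \<in> Models \<Phi> \<rightarrow>\<^sub>M str_space ({} :: unit set) ({} :: unit set)"
    and \<beta>: "\<And>S. S \<in> space (Models \<Phi>) \<Longrightarrow> bij_betw (\<beta> S) UNIV (range (\<nu> S))"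
    and \<beta>_mul: "\<And>S x y. S \<in> space (Models \<Phi>) \<Longrightarrow> \<beta> S (fst (f S) (x, y)) = mul (\<beta> S x) (\<beta> S y)"
  proof (rule measurable_presentation[of "Models \<Phi>" \<nu> "\<lambda>_. mul" "{} :: unit set" "\<lambda>_ _ _. None" "{} :: unit set" "\<lambda>_ _ _. True"])
    show "mul (\<nu> S a) (\<nu> S b) \<in> range (\<nu> S)" if "S \<in> space (Models \<Phi>)" for S a b
      unfolding mul[OF that] by (rule rangeI)
    fix f \<beta>
    assume "f \<in> Models \<Phi> \<rightarrow>\<^sub>M str_space ({} :: unit set) ({} :: unit set)"
      "\<And>S. S \<in> space (Models \<Phi>) \<Longrightarrow> bij_betw (\<beta> S) UNIV (range (\<nu> S))"
      "\<And>S x y. S \<in> space (Models \<Phi>) \<Longrightarrow> \<beta> S (fst (f S) (x, y)) = mul (\<beta> S x) (\<beta> S y)"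
    then show thesis by (rule that)
  qed (simp_all add: inf_range eq_meas mul_meas)
  show ?thesis
  proof (rule borel_reducibleI[where f = f])
    show "f \<in> Models \<Phi> \<rightarrow>\<^sub>M str_space (preds TFAG) (funs TFAG)"
      using f by (simp add: TFAG_def)
  next
    fix S assume S: "S \<in> space (Models \<Phi>)"
    interpret lattice_family "add S" "emb S" "R S" by (rule fam[OF S])
    have inj: "\<beta> S x = \<beta> S y \<longleftrightarrow> x = y" for x y
      using \<beta>[OF S] by (auto simp: bij_betw_def inj_on_def)
    have surj: "\<exists>x. \<beta> S x = \<nu> S l" for l
      using bij_betw_imp_surj_on[OF \<beta>[OF S]] by (metis rangeE rangeI)
    have in_range: "\<exists>l. \<beta> S x = \<nu> S l" for x
      using bij_betw_apply[OF \<beta>[OF S]] by (metis UNIV_I rangeE)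
    have m: "\<beta> S (fst (f S) (x, y)) c i = \<beta> S x c i + \<beta> S y c i" for x y c i
      by (simp add: \<beta>_mul[OF S] mul_def)
    have eqI: "x = y" if "\<And>c i. \<beta> S x c i = \<beta> S y c i" for x y
      using that inj by (metis ext)
    obtain e where e: "\<beta> S e = (\<lambda>c i. 0)" using surj[of "[]"] by (auto simp: \<nu>_def)
    have cg: "comm_group (grp (f S)) \<and> \<one>\<^bsub>grp (f S)\<^esub> = e"
    proof (rule comm_group_grpI)
      show "neutral (f S) e" unfolding neutral_def by (auto intro!: eqI simp: m e)
      show "\<exists>y. fst (f S) (y, x) = e" for x
      proof -
        obtain l where l: "\<beta> S x = \<nu> S l" using in_range by blast
        obtain l' where "\<nu> S l' = (\<lambda>c i. - \<nu> S l c i)" unfolding \<nu>_def using val_neg by blast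
        then obtain y where y: "\<beta> S y = (\<lambda>c i. - \<nu> S l c i)" using surj by metis
        show ?thesis by (rule exI[of _ y], rule eqI) (simp add: m e y l)
      qed
    qed (auto intro!: eqI simp: m)
    interpret G: comm_group "grp (f S)" using cg by blast
    have pow: "\<beta> S (x [^]\<^bsub>grp (f S)\<^esub> n) c i = of_nat n * \<beta> S x c i" for x c i and n :: nat
      by (induction n) (use cg e in \<open>auto simp: m algebra_simps\<close>)
    have "torsion_free (grp (f S))"
      unfolding torsion_free_def
    proof (intro ballI allI impI, elim conjE)
      fix x and n :: nat assume n: "n > 0" and x: "x [^]\<^bsub>grp (f S)\<^esub> n = \<one>\<^bsub>grp (f S)\<^esub>"
      have "of_nat n * \<beta> S x c i = 0" for c i
        using pow[of x n c i] x cg e by simp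
      then show "x = \<one>\<^bsub>grp (f S)\<^esub>" using n cg e by (intro eqI) simp
    qed
    then show "holds TFAG (f S)" using cg by (simp add: TFAG_def)
  next
    fix S T assume S: "S \<in> space (Models \<Phi>)" and T: "T \<in> space (Models \<Phi>)"
    have eqT: "x = y \<longleftrightarrow> \<beta> T x = \<beta> T y" for x y
      using \<beta>[OF T] by (auto simp: bij_betw_def inj_on_def)
    have in_range: "\<exists>a. x = \<beta> S a" if "x \<in> range (\<nu> S)" for x
      using that bij_betw_imp_surj_on[OF \<beta>[OF S]] by (metis imageE)
    \<comment> \<open>The intermediate notion is an additive bijection of the coded groups. The two
      lattice lemmas link it to the given structures, transport along \<open>\<beta>\<close> to
      their images.\<close>
    have "model_iso \<Phi> S T \<longleftrightarrow> (\<exists>h. bij_betw h (range (\<nu> S)) (range (\<nu> T)) \<and>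
      (\<forall>x\<in>range (\<nu> S). \<forall>y\<in>range (\<nu> S). h (mul x y) = mul (h x) (h y)))"
    proof
      assume "model_iso \<Phi> S T"
      then obtain g where g: "bij g" "\<And>a b. g (add S a b) = add T (g a) (g b)" "\<And>k a. a \<in> R S k \<longleftrightarrow> g a \<in> R T k"
        using iso[OF S T] by blast
      show "\<exists>h. bij_betw h (range (\<nu> S)) (range (\<nu> T)) \<and>
        (\<forall>x\<in>range (\<nu> S). \<forall>y\<in>range (\<nu> S). h (mul x y) = mul (h x) (h y))"
        by (rule lattice_family_iso_conv[OF fam[OF S] fam[OF T], of g, folded \<nu>_def, OF g])
          (auto simp: mul_def)
    next
      assume "\<exists>h. bij_betw h (range (\<nu> S)) (range (\<nu> T)) \<and>
        (\<forall>x\<in>range (\<nu> S). \<forall>y\<in>range (\<nu> S). h (mul x y) = mul (h x) (h y))"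
      then obtain h where h: "bij_betw h (range (\<nu> S)) (range (\<nu> T))"
        and h': "\<And>x y. x\<in>range (\<nu> S) \<Longrightarrow> y\<in>range (\<nu> S) \<Longrightarrow> h (\<lambda>c i. x c i + y c i) = (\<lambda>c i. h x c i + h y c i)"
        unfolding mul_def by blast
      show "model_iso \<Phi> S T"
        by (rule lattice_family_iso[OF fam[OF S] fam[OF T], of h, folded \<nu>_def, OF h h'])
          (auto simp: iso[OF S T])
    qed
    also have "\<dots> \<longleftrightarrow> (\<exists>h. bij h \<and> (\<forall>x y. h (fst (f S) (x, y)) = fst (f T) (h x, h y)))"
    proof
      assume "\<exists>h. bij_betw h (range (\<nu> S)) (range (\<nu> T)) \<and>
        (\<forall>x\<in>range (\<nu> S). \<forall>y\<in>range (\<nu> S). h (mul x y) = mul (h x) (h y))"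
      then obtain k where k: "bij_betw k (range (\<nu> S)) (range (\<nu> T))"
        and k': "\<And>x y. x\<in>range (\<nu> S) \<Longrightarrow> y\<in>range (\<nu> S) \<Longrightarrow> k (mul x y) = mul (k x) (k y)"
        by blast
      obtain h where h: "bij h" "\<And>x. \<beta> T (h x) = k (\<beta> S x)"
        using bij_betw_pullback[OF \<beta>[OF S] \<beta>[OF T] k] by blast
      have "h (fst (f S) (x, y)) = fst (f T) (h x, h y)" for x y
        unfolding eqT h(2) \<beta>_mul[OF S] \<beta>_mul[OF T]
        by (rule k') (use bij_betw_apply[OF \<beta>[OF S]] in auto)
      then show "\<exists>h. bij h \<and> (\<forall>x y. h (fst (f S) (x, y)) = fst (f T) (h x, h y))" using h by blast
    next
      assume "\<exists>h. bij h \<and> (\<forall>x y. h (fst (f S) (x, y)) = fst (f T) (h x, h y))"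
      then obtain h where h: "bij h" "\<And>x y. h (fst (f S) (x, y)) = fst (f T) (h x, h y)" by blast
      obtain k where k: "bij_betw k (range (\<nu> S)) (range (\<nu> T))" "\<And>x. k (\<beta> S x) = \<beta> T (h x)"
        using bij_betw_pushforward[OF \<beta>[OF S] \<beta>[OF T] h(1)] by blast
      have "k (mul x y) = mul (k x) (k y)" if xy: "x \<in> range (\<nu> S)" "y \<in> range (\<nu> S)" for x y
      proof -
        obtain a b where ab: "x = \<beta> S a" "y = \<beta> S b" using in_range[OF xy(1)] in_range[OF xy(2)] by blast
        show ?thesis unfolding ab \<beta>_mul[OF S, symmetric] k(2) h(2) \<beta>_mul[OF T] ..
      qed
      then show "\<exists>h. bij_betw h (range (\<nu> S)) (range (\<nu> T)) \<and>
        (\<forall>x\<in>range (\<nu> S). \<forall>y\<in>range (\<nu> S). h (mul x y) = mul (h x) (h y))" using k(1) by blast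
    qed
    also have "\<dots> \<longleftrightarrow> model_iso TFAG (f S) (f T)"
      unfolding model_iso_def str_iso_def by (auto simp: iso_grp_iff Bex_def TFAG_def)
    finally show "model_iso \<Phi> S T \<longleftrightarrow> model_iso TFAG (f S) (f T)" .
  qed
qed

section \<open>Reduction of \<open>\<Omega>\<close> to torsion-free groups\<close>

text \<open>From index 4 on, even positions list the \<open>G_i\<close> and odd positions the graphs
  of the \<open>\<phi>_j\<close>, by way of \<open>from_nat_into\<close>. If \<open>I\<close> or
  \<open>J\<close> is empty its positions are filled with the whole group. Repetitions for finite
  index sets are harmless.\<close>

fun omega_rel :: "'i set \<Rightarrow> 'j set \<Rightarrow> ('i, 'j) str \<Rightarrow> nat \<Rightarrow> (nat \<times> nat) set" where
  "omega_rel I J S 0 = UNIV"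
| "omega_rel I J S (Suc 0) = {(a, b). neutral S b}"
| "omega_rel I J S (Suc (Suc 0)) = {(a, b). neutral S a}"
| "omega_rel I J S (Suc (Suc (Suc 0))) = {(a, b). a = b}"
| "omega_rel I J S (Suc (Suc (Suc (Suc k)))) =
    (if even k then if I = {} then UNIV else {(a, b). a = b \<and> a \<in> pred S (from_nat_into I (k div 2))}
     else if J = {} then UNIV else {(a, b). pfun S (from_nat_into J (k div 2)) a = Some b})"

definition pair_add :: "('i, 'j) str \<Rightarrow> nat \<times> nat \<Rightarrow> nat \<times> nat \<Rightarrow> nat \<times> nat" where
  "pair_add S p q = (fst S (fst p, fst q), fst S (snd p, snd q))"

definition pair_emb :: "(nat \<Rightarrow> nat \<Rightarrow> int) \<Rightarrow> nat \<times> nat \<Rightarrow> bool \<times> nat \<Rightarrow> int" where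
  "pair_emb \<theta> p z = \<theta> (if fst z then fst p else snd p) (snd z)"

text \<open>All that is extracted from the infinitary equivalence is an embedding into integer
  vectors with image closed under negation. The group axioms of \<open>S\<close> are read off from
  the coordinates.\<close>

lemma omega_embedding:
  assumes "holds (Omega I J) S"
  obtains \<theta> :: "nat \<Rightarrow> nat \<Rightarrow> int" where "inj \<theta>" "\<And>a b i. \<theta> (fst S (a, b)) i = \<theta> a i + \<theta> b i"
    "comm_group (grp S)" "\<And>i. \<theta> \<one>\<^bsub>grp S\<^esub> i = 0"
proof -
  let ?Z = "sum_group (UNIV :: nat set) (\<lambda>_. integer_group)"
  obtain \<theta> where \<theta>: "inj \<theta>" "\<And>a. \<theta> a \<in> carrier ?Z" "\<And>a b. \<theta> (a \<otimes>\<^bsub>grp S\<^esub> b) = \<theta> a \<otimes>\<^bsub>?Z\<^esub> \<theta> b"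
    "\<And>a. \<exists>b. \<theta> b = inv\<^bsub>?Z\<^esub> \<theta> a"
    using Linf_equiv_embedding[of "grp S" ?Z] assms by (auto simp: Omega_def)
  have add: "\<theta> (fst S (a, b)) i = \<theta> a i + \<theta> b i" for a b i
    using \<theta>(3)[of a b] by (simp add: mult_sum_group)
  have neg: "\<exists>b. \<forall>i. \<theta> b i = - \<theta> a i" for a
  proof -
    obtain b where "\<theta> b = inv\<^bsub>?Z\<^esub> \<theta> a" using \<theta>(4) by blast
    then show ?thesis using \<theta>(2)[of a] by (intro exI[of _ b]) (simp add: inv_sum_group)
  qed
  have eqI: "a = b" if "\<And>i. \<theta> a i = \<theta> b i" for a b
    using that \<theta>(1) by (simp add: inj_def fun_eq_iff)
  \<comment> \<open>The number 0 is here just some element of the universe; adding its negative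
    produces the neutral element.\<close>
  obtain b where b: "\<forall>i. \<theta> b i = - \<theta> 0 i" using neg by blast
  define e where "e = fst S (0, b)"
  have e: "\<theta> e i = 0" for i unfolding e_def by (simp add: add b)
  have "comm_group (grp S) \<and> \<one>\<^bsub>grp S\<^esub> = e"
  proof (rule comm_group_grpI)
    show "neutral S e" unfolding neutral_def by (auto intro!: eqI simp: add e)
    show "\<exists>y. fst S (y, x) = e" for x
    proof -
      obtain y where "\<forall>i. \<theta> y i = - \<theta> x i" using neg by blast
      then show ?thesis by (intro exI[of _ y] eqI) (simp add: add e)
    qed
  qed (auto intro!: eqI simp: add)
  then show thesis using that \<theta>(1) add e by blast
qed

text \<open>The relations are subgroups of the square of \<open>S\<close>, because each
  \<open>G_i\<close> is a subgroup and each \<open>\<phi>_j\<close> is a homomorphism whose domain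
  is a subgroup.\<close>

lemma omega_lattice_family:
  assumes I: "countable I" and J: "countable J" and S: "holds (Omega I J) S"
  obtains \<theta> where "lattice_family (pair_add S) (pair_emb \<theta>) (omega_rel I J S)"
proof -
  obtain \<theta> :: "nat \<Rightarrow> nat \<Rightarrow> int" where \<theta>: "inj \<theta>" "\<And>a b i. \<theta> (fst S (a, b)) i = \<theta> a i + \<theta> b i"
    and cg: "comm_group (grp S)" and \<theta>_one: "\<And>i. \<theta> \<one>\<^bsub>grp S\<^esub> i = 0"
  proof (rule omega_embedding[OF S])
    fix \<theta> :: "nat \<Rightarrow> nat \<Rightarrow> int"
    assume "inj \<theta>" "\<And>a b i. \<theta> (fst S (a, b)) i = \<theta> a i + \<theta> b i" "comm_group (grp S)"
      "\<And>i. \<theta> \<one>\<^bsub>grp S\<^esub> i = 0"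
    then show thesis by (rule that)
  qed
  interpret G: comm_group "grp S" by (rule cg)
  let ?e = "\<one>\<^bsub>grp S\<^esub>" and ?i = "\<lambda>a. inv\<^bsub>grp S\<^esub> a"
  have ntr: "neutral S a \<longleftrightarrow> a = ?e" for a by (rule neutral_iff) (rule G.group_axioms)
  have \<theta>_inv: "\<theta> (?i a) i = - \<theta> a i" for a i
  proof -
    have "fst S (?i a, a) = ?e" using G.l_inv[of a] by simp
    then show ?thesis using \<theta>(2)[of "?i a" a i] \<theta>_one by simp
  qed
  have sub: "subgroup (pred S i) (grp S)" if "i \<in> I" for i using S that by (simp add: Omega_def)
  have dom_sub: "subgroup (dom (pfun S j)) (grp S)" if "j \<in> J" for j
    using S that sub G.subgroup_self by (auto simp: Omega_def)
  have hom: "(\<lambda>x. the (pfun S j x)) \<in> hom ((grp S)\<lparr>carrier := dom (pfun S j)\<rparr>) (grp S)" if "j \<in> J" for j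
    using S that by (simp add: Omega_def)
  have closed: "pair_add S p q \<in> omega_rel I J S k" (is ?A)
    and neg: "(?i (fst p), ?i (snd p)) \<in> omega_rel I J S k" (is ?B)
    and one: "(?e, ?e) \<in> omega_rel I J S k" (is ?C)
    if pq: "p \<in> omega_rel I J S k" "q \<in> omega_rel I J S k" for p q k
  proof -
    obtain a b c d where p: "p = (a, b)" and q: "q = (c, d)" by (cases p, cases q)
    have ee: "fst S (?e, ?e) = ?e" using G.l_one[of ?e] by simp
    have "?A \<and> ?B \<and> ?C"
    proof (cases "(I, J, S, k)" rule: omega_rel.cases)
      case (5 I' J' S' l)
      then have k: "k = Suc (Suc (Suc (Suc l)))" by simp
      consider "even l" "I = {}" | "even l" "I \<noteq> {}" | "odd l" "J = {}" | "odd l" "J \<noteq> {}" by blast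
      then show ?thesis
      proof cases
        case 2
        define i where "i = from_nat_into I (l div 2)"
        have "i \<in> I" unfolding i_def using 2 by (simp add: from_nat_into)
        then have P: "subgroup (pred S i) (grp S)" by (rule sub)
        have "a = b" "c = d" "a \<in> pred S i" "c \<in> pred S i"
          using pq 2 by (auto simp: k p q i_def)
        then show ?thesis
          using 2 subgroup.m_closed[OF P, of a c] subgroup.m_inv_closed[OF P, of a] subgroup.one_closed[OF P]
          by (simp add: k p q i_def pair_add_def)
      next
        case 4
        define j where "j = from_nat_into J (l div 2)"
        have j: "j \<in> J" unfolding j_def using 4 by (simp add: from_nat_into)
        define \<phi> where "\<phi> x = the (pfun S j x)" for x
        have D: "subgroup (dom (pfun S j)) (grp S)" by (rule dom_sub[OF j])
        have ev: "pfun S j x = Some y \<longleftrightarrow> x \<in> dom (pfun S j) \<and> \<phi> x = y" for x y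
          unfolding \<phi>_def by force
        have h: "\<phi> (fst S (x, y)) = fst S (\<phi> x, \<phi> y)" if "x \<in> dom (pfun S j)" "y \<in> dom (pfun S j)" for x y
          using hom[OF j] that unfolding hom_def \<phi>_def by simp
        have h1: "\<phi> ?e = ?e"
          using h[OF subgroup.one_closed[OF D] subgroup.one_closed[OF D]] G.r_cancel_one[of "\<phi> ?e" "\<phi> ?e"]
          by (simp add: ee)
        have hi: "\<phi> (?i x) = ?i (\<phi> x)" if x: "x \<in> dom (pfun S j)" for x
        proof -
          have "fst S (\<phi> (?i x), \<phi> x) = ?e"
            using h[OF subgroup.m_inv_closed[OF D x] x] G.l_inv[of x] h1 by simp
          then show ?thesis using G.inv_equality[of "\<phi> (?i x)" "\<phi> x"] by simp
        qed
        have ab: "a \<in> dom (pfun S j)" "\<phi> a = b" "c \<in> dom (pfun S j)" "\<phi> c = d"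
          using pq 4 ev[of a b] ev[of c d] by (simp_all add: k p q j_def)
        then show ?thesis
          using 4 subgroup.m_closed[OF D ab(1,3)] subgroup.m_inv_closed[OF D ab(1)] subgroup.one_closed[OF D] h h1 hi
          by (simp add: k p q j_def[symmetric] pair_add_def ev)
      qed (simp_all add: k)
    qed (use pq in \<open>auto simp: pair_add_def ntr ee p q\<close>)
    then show ?A ?B ?C by blast+
  qed
  \<comment> \<open>The fact \<open>one\<close> presupposes a member of the relation, so emptiness
    is excluded here by a separate case distinction.\<close>
  have ne: "(?e, ?e) \<in> omega_rel I J S k" for k
  proof (cases "omega_rel I J S k = {}")
    case False
    then show ?thesis using one by blast
  next
    case True
    then show ?thesis
    proof (cases "(I, J, S, k)" rule: omega_rel.cases)
      case (5 I' J' S' l)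
      then have k: "k = Suc (Suc (Suc (Suc l)))" by simp
      show ?thesis
      proof (cases "even l")
        case True
        then show ?thesis
          using subgroup.one_closed[OF sub[OF from_nat_into], of "l div 2"] by (simp add: k)
      next
        case False
        define j where "j = from_nat_into J (l div 2)"
        show ?thesis
        proof (cases "J = {}")
          case J: False
          then have "j \<in> J" unfolding j_def by (simp add: from_nat_into)
          then have "?e \<in> dom (pfun S j)" using subgroup.one_closed[OF dom_sub] by blast
          then obtain b where "pfun S j ?e = Some b" by blast
          then have "(?e, b) \<in> omega_rel I J S k" using False J by (simp add: k j_def)
          then show ?thesis using \<open>omega_rel I J S k = {}\<close> by blast
        qed (simp add: k False)
      qed
    qed (auto simp: ntr)
  qed
  have "lattice_family (pair_add S) (pair_emb \<theta>) (omega_rel I J S)"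
  proof
    show "inj (pair_emb \<theta>)"
    proof (rule injI)
      fix p q assume eq: "pair_emb \<theta> p = pair_emb \<theta> q"
      have "\<theta> (fst p) = \<theta> (fst q)"
      proof
        fix i show "\<theta> (fst p) i = \<theta> (fst q) i" using fun_cong[OF eq, of "(True, i)"] by (simp add: pair_emb_def)
      qed
      moreover have "\<theta> (snd p) = \<theta> (snd q)"
      proof
        fix i show "\<theta> (snd p) i = \<theta> (snd q) i" using fun_cong[OF eq, of "(False, i)"] by (simp add: pair_emb_def)
      qed
      ultimately show "p = q" using \<theta>(1) by (simp add: inj_eq prod_eq_iff)
    qed
    show "pair_emb \<theta> (pair_add S a b) i = pair_emb \<theta> a i + pair_emb \<theta> b i" for a b i
      by (simp add: pair_emb_def pair_add_def \<theta>(2))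
    show "\<exists>b\<in>omega_rel I J S k. \<forall>i. pair_emb \<theta> b i = - pair_emb \<theta> a i" if a: "a \<in> omega_rel I J S k" for a k
      by (intro bexI[OF _ neg[OF a a]]) (simp add: pair_emb_def \<theta>_inv)
    show "omega_rel I J S k \<noteq> {}" for k using ne[of k] by auto
  qed (use closed in auto)
  then show thesis by (rule that)
qed

lemma neutral_bij:
  assumes "bij h" "\<And>x y. h (fst S (x, y)) = fst T (h x, h y)"
  shows "neutral T (h e) \<longleftrightarrow> neutral S e"
proof -
  have "neutral T (h e) \<longleftrightarrow> (\<forall>x. fst T (h e, h x) = h x)"
    unfolding neutral_def using bij_pointE[OF assms(1)] by metis
  also have "\<dots> \<longleftrightarrow> neutral S e"
    unfolding neutral_def assms(2)[symmetric] using bij_is_inj[OF assms(1)] by (simp add: inj_eq)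
  finally show ?thesis .
qed

lemma omega_rel_iso:
  assumes h: "bij h" "\<And>x y. h (fst S (x, y)) = fst T (h x, h y)"
    and P: "\<And>i x. i \<in> I \<Longrightarrow> x \<in> pred S i \<longleftrightarrow> h x \<in> pred T i"
    and F: "\<And>j x. j \<in> J \<Longrightarrow> pfun T j (h x) = map_option h (pfun S j x)"
  shows "p \<in> omega_rel I J S k \<longleftrightarrow> map_prod h h p \<in> omega_rel I J T k"
proof -
  obtain a b where p: "p = (a, b)" by (cases p)
  have inj: "h x = h y \<longleftrightarrow> x = y" for x y using bij_is_inj[OF h(1)] by (simp add: inj_eq)
  show ?thesis
  proof (cases "(I, J, S, k)" rule: omega_rel.cases)
    case (5 I' J' S' l)
    have i: "from_nat_into I (l div 2) \<in> I" if "I \<noteq> {}" using that by (simp add: from_nat_into)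
    have j: "from_nat_into J (l div 2) \<in> J" if "J \<noteq> {}" using that by (simp add: from_nat_into)
    show ?thesis using 5 P[OF i, of a] F[OF j, of a] inj by (auto simp: p)
  qed (auto simp: neutral_bij[OF h] p inj)
qed

text \<open>Preserving the two axes forces \<open>f\<close> to act coordinatewise, and preserving
  the diagonal makes both coordinate maps equal to one \<open>g\<close>. The remaining relations
  then say that \<open>g\<close> respects the predicates and the graphs.\<close>

lemma omega_rel_iso_conv:
  assumes I: "countable I" and J: "countable J"
    and S: "comm_group (grp S)" and T: "comm_group (grp T)"
    and f: "bij f" "\<And>p q. f (pair_add S p q) = pair_add T (f p) (f q)"
      "\<And>k p. p \<in> omega_rel I J S k \<longleftrightarrow> f p \<in> omega_rel I J T k"
  shows "str_iso I J S T"
proof -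
  interpret S: comm_group "grp S" by (rule S)
  interpret T: comm_group "grp T" by (rule T)
  let ?e = "\<one>\<^bsub>grp S\<^esub>" and ?e' = "\<one>\<^bsub>grp T\<^esub>"
  have nS: "neutral S a \<longleftrightarrow> a = ?e" for a by (rule neutral_iff) (rule S.group_axioms)
  have nT: "neutral T a \<longleftrightarrow> a = ?e'" for a by (rule neutral_iff) (rule T.group_axioms)
  define g where "g a = fst (f (a, ?e))" for a
  define g' where "g' a = snd (f (?e, a))" for a
  have fg: "f (a, ?e) = (g a, ?e')" for a
    using f(3)[of "(a, ?e)" "Suc 0"] by (cases "f (a, ?e)") (simp add: nS nT g_def)
  have fg': "f (?e, a) = (?e', g' a)" for a
    using f(3)[of "(?e, a)" "Suc (Suc 0)"] by (cases "f (?e, a)") (simp add: nS nT g'_def)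
  have fgg': "f (a, b) = (g a, g' b)" for a b
  proof -
    have "(a, b) = pair_add S (a, ?e) (?e, b)"
      using S.l_one[of b] S.r_one[of a] by (simp add: pair_add_def)
    then have "f (a, b) = pair_add T (g a, ?e') (?e', g' b)" by (simp add: f(2) fg fg')
    then show ?thesis using T.l_one[of "g' b"] T.r_one[of "g a"] by (simp add: pair_add_def)
  qed
  have "g' a = g a" for a
    using f(3)[of "(a, a)" "Suc (Suc (Suc 0))"] by (simp add: fgg')
  then have fgg: "f (a, b) = (g a, g b)" for a b by (simp add: fgg')
  have "inj g"
  proof (rule injI)
    fix a b assume "g a = g b"
    then have "f (a, a) = f (b, b)" by (simp add: fgg)
    then show "a = b" using bij_is_inj[OF f(1)] by (simp add: inj_eq)
  qed
  moreover have "surj g"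
  proof -
    have "\<exists>a. y = g a" for y
    proof -
      obtain p where "f p = (y, y)" using bij_is_surj[OF f(1)] by (metis surjD)
      then show ?thesis using fgg[of "fst p" "snd p"] by auto
    qed
    then show ?thesis by auto
  qed
  ultimately have g: "bij g" by (simp add: bij_def)
  have hom: "g (fst S (x, y)) = fst T (g x, g y)" for x y
    using f(2)[of "(x, x)" "(y, y)"] by (simp add: pair_add_def fgg)
  have P: "x \<in> pred S i \<longleftrightarrow> g x \<in> pred T i" if i: "i \<in> I" for i x
  proof -
    have ne: "I \<noteq> {}" using i by auto
    \<comment> \<open>The symbol \<open>i\<close> is found at position 4 plus twice its index;
      below, \<open>j\<close> is found one place after the corresponding even position. Integer
      halving recovers the index in both cases.\<close>
    have "from_nat_into I (2 * to_nat_on I i div 2) = i" using I i by simp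
    then show ?thesis
      using f(3)[of "(x, x)" "Suc (Suc (Suc (Suc (2 * to_nat_on I i))))"] ne by (simp add: fgg)
  qed
  have F: "pfun S j x = Some y \<longleftrightarrow> pfun T j (g x) = Some (g y)" if j: "j \<in> J" for j x y
  proof -
    have ne: "J \<noteq> {}" using j by auto
    have "from_nat_into J (Suc (2 * to_nat_on J j) div 2) = j" using J j by simp
    then show ?thesis
      using f(3)[of "(x, y)" "Suc (Suc (Suc (Suc (Suc (2 * to_nat_on J j)))))"] ne by (simp add: fgg)
  qed
  have F': "pfun T j (g x) = map_option g (pfun S j x)" if j: "j \<in> J" for j x
  proof (cases "pfun S j x")
    case (Some y)
    then show ?thesis using F[OF j, of x y] by simp
  next
    case None
    have "pfun T j (g x) \<noteq> Some z" for z
      using F[OF j, of x] None bij_pointE[OF g, of z] by (metis option.distinct(1))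
    then show ?thesis using None by (cases "pfun T j (g x)") auto
  qed
  show ?thesis unfolding str_iso_def
    by (rule bexI[of _ g]) (use g hom P F' in \<open>auto simp: iso_grp_iff\<close>)
qed

theorem Omega_reducible_TFAG:
  fixes I :: "'i set" and J :: "'j set"
  assumes I: "countable I" and J: "countable J"
  shows "Omega I J \<le>\<^sub>B TFAG"
proof -
  have sp: "holds (Omega I J) S" if "S \<in> space (Models (Omega I J))" for S
    using that by (simp add: space_Models)
  \<comment> \<open>The embeddings are chosen pointwise, with no measurability in
    \<open>S\<close>.\<close>
  have "\<exists>emb :: ('i, 'j) str \<Rightarrow> nat \<times> nat \<Rightarrow> bool \<times> nat \<Rightarrow> int. \<forall>S. S \<in> space (Models (Omega I J)) \<longrightarrow>
    lattice_family (pair_add S) (emb S) (omega_rel I J S)"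
  proof (rule choice, rule allI)
    fix S
    show "\<exists>emb :: nat \<times> nat \<Rightarrow> bool \<times> nat \<Rightarrow> int. S \<in> space (Models (Omega I J)) \<longrightarrow>
      lattice_family (pair_add S) emb (omega_rel I J S)"
    proof (cases "S \<in> space (Models (Omega I J))")
      case True
      obtain \<theta> where "lattice_family (pair_add S) (pair_emb \<theta>) (omega_rel I J S)"
        by (rule omega_lattice_family[OF I J sp[OF True]])
      then show ?thesis by (intro exI impI)
    qed simp
  qed
  then obtain emb :: "('i, 'j) str \<Rightarrow> nat \<times> nat \<Rightarrow> bool \<times> nat \<Rightarrow> int" where emb: "\<And>S. S \<in> space (Models (Omega I J)) \<Longrightarrow>
    lattice_family (pair_add S) (emb S) (omega_rel I J S)" by blast
  show ?thesis
  proof (rule lattice_family_reducible_TFAG[where add = pair_add and R = "omega_rel I J" and emb = emb])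
    show "infinite (UNIV :: (nat \<times> nat) set)" by (simp add: finite_prod)
    show "(\<lambda>S. pair_add S a b) \<in> Models (Omega I J) \<rightarrow>\<^sub>M count_space UNIV" for a b
    proof -
      have "(\<lambda>S. (\<lambda>x S. (\<lambda>y. (x, y)) (fst S (snd a, snd b))) (fst S (fst a, fst b)) S)
        \<in> Models (Omega I J) \<rightarrow>\<^sub>M count_space UNIV"
        by (rule measurable_compose_countable) measurable
      then show ?thesis by (simp add: pair_add_def)
    qed
    show "Measurable.pred (Models (Omega I J)) (\<lambda>S. p \<in> omega_rel I J S k)" for k p
    proof -
      obtain a b where p: "p = (a, b)" by (cases p)
      have [measurable]: "Measurable.pred (Models (Omega I J)) (\<lambda>S. neutral S a)" for a
        unfolding neutral_def by measurable
      have P: "Measurable.pred (Models (Omega I J)) (\<lambda>S. x \<in> pred S i)" if "i \<in> I" for i x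
        by (rule measurable_pred) (simp add: Omega_def that)
      have F: "(\<lambda>S. pfun S j x) \<in> Models (Omega I J) \<rightarrow>\<^sub>M count_space UNIV" if "j \<in> J" for j x
        by (rule measurable_pfun) (simp add: Omega_def that)
      show ?thesis
      proof (cases "(I, J, undefined :: ('i, 'j) str, k)" rule: omega_rel.cases)
        case (5 I' J' S' l)
        then have k: "k = Suc (Suc (Suc (Suc l)))" by simp
        consider "even l" "I = {}" | "even l" "I \<noteq> {}" | "odd l" "J = {}" | "odd l" "J \<noteq> {}" by blast
        then show ?thesis
        proof cases
          case 2
          note [measurable] = P[OF from_nat_into[OF 2(2)]]
          have "Measurable.pred (Models (Omega I J)) (\<lambda>S. a = b \<and> a \<in> pred S (from_nat_into I (l div 2)))"
            by measurable
          then show ?thesis using 2 by (simp add: k p)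
        next
          case 4
          note [measurable] = F[OF from_nat_into[OF 4(2)]]
          have "Measurable.pred (Models (Omega I J)) (\<lambda>S. pfun S (from_nat_into J (l div 2)) a = Some b)"
            by measurable
          then show ?thesis using 4 by (simp add: k p)
        qed (simp_all add: k)
      qed (simp_all add: p)
    qed
    show "lattice_family (pair_add S) (emb S) (omega_rel I J S)" if "S \<in> space (Models (Omega I J))" for S
      using emb that .
    fix S T assume S: "S \<in> space (Models (Omega I J))" and T: "T \<in> space (Models (Omega I J))"
    have iso: "model_iso (Omega I J) S T \<longleftrightarrow> str_iso I J S T"
      by (simp add: model_iso_def Omega_def)
    show "model_iso (Omega I J) S T \<longleftrightarrow> (\<exists>f. bij f \<and> (\<forall>a b. f (pair_add S a b) = pair_add T (f a) (f b)) \<and>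
      (\<forall>k a. a \<in> omega_rel I J S k \<longleftrightarrow> f a \<in> omega_rel I J T k))"
      unfolding iso
    proof
      assume "str_iso I J S T"
      then obtain h where h: "bij h" "\<And>x y. h (fst S (x, y)) = fst T (h x, h y)"
        and P: "\<And>i x. i \<in> I \<Longrightarrow> x \<in> pred S i \<longleftrightarrow> h x \<in> pred T i"
        and F: "\<And>j x. j \<in> J \<Longrightarrow> pfun T j (h x) = map_option h (pfun S j x)"
        by (auto simp: str_iso_def iso_grp_iff)
      have "bij (map_prod h h)" using bij_betw_map_prod[OF h(1) h(1)] by simp
      moreover have "map_prod h h (pair_add S a b) = pair_add T (map_prod h h a) (map_prod h h b)" for a b
        by (simp add: pair_add_def h(2))
      moreover have "a \<in> omega_rel I J S k \<longleftrightarrow> map_prod h h a \<in> omega_rel I J T k" for a k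
        by (rule omega_rel_iso[OF h P F])
      ultimately show "\<exists>f. bij f \<and> (\<forall>a b. f (pair_add S a b) = pair_add T (f a) (f b)) \<and>
        (\<forall>k a. a \<in> omega_rel I J S k \<longleftrightarrow> f a \<in> omega_rel I J T k)" by blast
    next
      assume "\<exists>f. bij f \<and> (\<forall>a b. f (pair_add S a b) = pair_add T (f a) (f b)) \<and>
        (\<forall>k a. a \<in> omega_rel I J S k \<longleftrightarrow> f a \<in> omega_rel I J T k)"
      then obtain f where "bij f" "\<And>a b. f (pair_add S a b) = pair_add T (f a) (f b)"
        "\<And>k a. a \<in> omega_rel I J S k \<longleftrightarrow> f a \<in> omega_rel I J T k" by blast
      moreover have "comm_group (grp S)" "comm_group (grp T)"
        using omega_embedding[OF sp[OF S]] omega_embedding[OF sp[OF T]] by blast+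
      ultimately show "str_iso I J S T" using omega_rel_iso_conv[OF I J] by blast
    qed
  qed
qed

section \<open>Subgroups of a free abelian group of countable rank\<close>

definition fin_supp :: "(nat \<Rightarrow> int) set" where
  "fin_supp = {x. finite {i. x i \<noteq> 0}}"

lemma carrier_sum_integer_group: "carrier (sum_group UNIV (\<lambda>_. integer_group)) = fin_supp"
  by (simp add: carrier_sum_group fin_supp_def)

lemma fin_supp_zero: "(\<lambda>i. 0) \<in> fin_supp"
  by (simp add: fin_supp_def)

lemma fin_supp_add: "x \<in> fin_supp \<Longrightarrow> y \<in> fin_supp \<Longrightarrow> (\<lambda>i. x i + y i) \<in> fin_supp"
  unfolding fin_supp_def mem_Collect_eq
  by (rule finite_subset[of _ "{i. x i \<noteq> 0} \<union> {i. y i \<noteq> 0}"]) auto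

lemma fin_supp_scale: "x \<in> fin_supp \<Longrightarrow> (\<lambda>i. c * x i) \<in> fin_supp"
  unfolding fin_supp_def mem_Collect_eq
  by (rule finite_subset[of _ "{i. x i \<noteq> 0}"]) auto

lemma fin_supp_neg: "x \<in> fin_supp \<Longrightarrow> (\<lambda>i. - x i) \<in> fin_supp"
  by (simp add: fin_supp_def)

lemma fin_supp_single: "(\<lambda>i. if i = a then c else 0) \<in> fin_supp"
  unfolding fin_supp_def mem_Collect_eq by (rule finite_subset[of _ "{a}"]) auto

lemma fin_supp_bounded:
  assumes "x \<in> fin_supp"
  shows "\<exists>m. \<forall>i\<ge>m. x i = 0"
proof -
  obtain m where "\<forall>i\<in>{i. x i \<noteq> 0}. i < m"
    using assms finite_nat_set_iff_bounded unfolding fin_supp_def by blast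
  then show ?thesis by (intro exI[of _ m]) force
qed

text \<open>The degree of a vector is its last nonzero position. Choosing for every degree that
  occurs an element of least positive leading coefficient gives a triangular basis. Infinitely many
  degrees occur, so their enumeration identifies the coefficient sequences with
  \<open>fin_supp\<close>.\<close>

theorem subgroup_of_free_is_free:
  fixes X :: "(nat \<Rightarrow> int) set"
  assumes fin: "X \<subseteq> fin_supp" and zero: "(\<lambda>i. 0) \<in> X"
    and add: "\<And>x y. x \<in> X \<Longrightarrow> y \<in> X \<Longrightarrow> (\<lambda>i. x i + y i) \<in> X"
    and neg: "\<And>x. x \<in> X \<Longrightarrow> (\<lambda>i. - x i) \<in> X"
    and inf: "infinite {n. \<exists>x\<in>X. x n \<noteq> 0 \<and> (\<forall>i>n. x i = 0)}"
  obtains r where "bij_betw r fin_supp X"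
    "\<And>c d. c \<in> fin_supp \<Longrightarrow> d \<in> fin_supp \<Longrightarrow> r (\<lambda>i. c i + d i) = (\<lambda>i. r c i + r d i)"
proof -
  define D where "D = {n. \<exists>x\<in>X. x n \<noteq> 0 \<and> (\<forall>i>n. x i = 0)}"
  have scale: "(\<lambda>i. z * x i) \<in> X" if x: "x \<in> X" for z x
  proof -
    have nat: "(\<lambda>i. int n * x i) \<in> X" for n
    proof (induction n)
      case (Suc n)
      show ?case using add[OF x Suc] by (simp add: algebra_simps)
    qed (use zero in simp)
    show ?thesis
    proof (cases z rule: int_cases2)
      case (nonneg n)
      then show ?thesis using nat by simp
    next
      case (nonpos n)
      then show ?thesis using neg[OF nat[of n]] by simp
    qed
  qed
  text \<open>A basis element for each possible degree, with least positive leading coefficient.\<close>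
  define lead where "lead n b \<longleftrightarrow> b \<in> X \<and> b n > 0 \<and> (\<forall>i>n. b i = 0) \<and>
    (\<forall>x\<in>X. (\<forall>i>n. x i = 0) \<longrightarrow> b n dvd x n)" for n b
  have "\<exists>b. lead n b" if n: "n \<in> D" for n
  proof -
    define Q where "Q g \<longleftrightarrow> g > 0 \<and> (\<exists>x\<in>X. x n = int g \<and> (\<forall>i>n. x i = 0))" for g
    obtain x where x: "x \<in> X" "x n \<noteq> 0" "\<forall>i>n. x i = 0" using n by (auto simp: D_def)
    have "Q (nat \<bar>x n\<bar>)"
    proof (cases "x n > 0")
      case True
      then show ?thesis using x by (auto simp: Q_def)
    next
      case False
      then show ?thesis using x neg[OF x(1)] by (auto simp: Q_def intro!: bexI[of _ "\<lambda>i. - x i"])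
    qed
    then have "Q (LEAST g. Q g)" by (rule LeastI)
    then obtain b where b: "b \<in> X" "b n = int (LEAST g. Q g)" "b n > 0" "\<forall>i>n. b i = 0" by (auto simp: Q_def)
    have "b n dvd y n" if y: "y \<in> X" "\<forall>i>n. y i = 0" for y
    proof (rule ccontr)
      assume "\<not> b n dvd y n"
      then have "y n mod b n \<noteq> 0" by (simp add: dvd_eq_mod_eq_0)
      then have m: "y n mod b n > 0" "y n mod b n < b n"
        using pos_mod_sign[OF b(3), of "y n"] pos_mod_bound[OF b(3), of "y n"] by linarith+
      \<comment> \<open>Division with remainder: \<open>w\<close> lies in \<open>X\<close>, has
        degree \<open>n\<close>, and its leading coefficient is positive and smaller than the
        minimal one.\<close>
      define w where "w = (\<lambda>i. y i + - (y n div b n) * b i)"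
      have "w \<in> X" unfolding w_def by (rule add[OF y(1) scale[OF b(1)]])
      moreover have "w n = y n mod b n" unfolding w_def by (simp add: minus_div_mult_eq_mod)
      moreover have "\<forall>i>n. w i = 0" using y(2) b(4) by (simp add: w_def)
      ultimately have "Q (nat (y n mod b n))"
        using m unfolding Q_def by (intro conjI bexI[of _ w]) simp_all
      then have "(LEAST g. Q g) \<le> nat (y n mod b n)" by (rule Least_le)
      then show False using m b(2) by linarith
    qed
    then show ?thesis using b unfolding lead_def by blast
  qed
  then have "\<forall>n\<in>D. \<exists>b. lead n b" by blast
  then obtain b where "\<forall>n\<in>D. lead n (b n)" by (rule bchoice[THEN exE])
  then have b: "\<And>n. n \<in> D \<Longrightarrow> b n \<in> X" "\<And>n. n \<in> D \<Longrightarrow> b n n > 0"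
    "\<And>n i. n \<in> D \<Longrightarrow> i > n \<Longrightarrow> b n i = 0"
    "\<And>n x. n \<in> D \<Longrightarrow> x \<in> X \<Longrightarrow> (\<forall>i>n. x i = 0) \<Longrightarrow> b n n dvd x n"
    unfolding lead_def by blast+
  define d where "d = enumerate D"
  have infD: "infinite D" using inf by (simp add: D_def)
  have d: "d n \<in> D" for n unfolding d_def using enumerate_in_set[OF infD] .
  have d_mono: "m < n \<Longrightarrow> d m < d n" for m n unfolding d_def using enumerate_mono[OF _ infD] .
  have d_ex: "\<exists>n. d n = m" if "m \<in> D" for m unfolding d_def using enumerate_Ex[OF infD that] .
  \<comment> \<open>The linear combination of basis elements with coefficients \<open>c\<close>.
    Summing over the support matters for finiteness; the next fact allows any larger finite
    set.\<close>
  define r where "r c i = (\<Sum>n | c n \<noteq> 0. c n * b (d n) i)" for c i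
  have r: "r c i = (\<Sum>n\<in>A. c n * b (d n) i)" if "finite A" "{n. c n \<noteq> 0} \<subseteq> A" for A c i
    unfolding r_def using that by (intro sum.mono_neutral_left) auto
  have r_add: "r (\<lambda>i. c i + e i) = (\<lambda>i. r c i + r e i)" if ce: "c \<in> fin_supp" "e \<in> fin_supp" for c e
  proof
    fix i
    let ?A = "{n. c n \<noteq> 0} \<union> {n. e n \<noteq> 0}"
    have A: "finite ?A" using ce by (simp add: fin_supp_def)
    have "r (\<lambda>i. c i + e i) i = (\<Sum>n\<in>?A. (c n + e n) * b (d n) i)" by (rule r[OF A]) auto
    also have "\<dots> = r c i + r e i"
      using r[OF A, of c i] r[OF A, of e i] by (simp add: algebra_simps sum.distrib)
    finally show "r (\<lambda>i. c i + e i) i = r c i + r e i" .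
  qed
  have r_single: "r (\<lambda>i. if i = n then z else 0) = (\<lambda>i. z * b (d n) i)" for n z
    by (rule ext, subst r[of "{n}"]) auto
  have r_in: "r c \<in> X" if c: "c \<in> fin_supp" for c
  proof -
    have "finite A \<Longrightarrow> (\<lambda>i. \<Sum>n\<in>A. c n * b (d n) i) \<in> X" for A
    proof (induction A rule: finite_induct)
      case (insert n A)
      show ?case using add[OF scale[OF b(1)[OF d], of "c n" n] insert.IH] insert.hyps by simp
    qed (use zero in simp)
    from this[of "{n. c n \<noteq> 0}"] show ?thesis using c by (simp add: fin_supp_def r_def[abs_def])
  qed
  \<comment> \<open>At the degree belonging to the largest index in the support of \<open>c\<close>
    all other terms vanish, since \<open>d\<close> is increasing.\<close>
  have ker: "c = (\<lambda>i. 0)" if c: "c \<in> fin_supp" and rc: "r c = (\<lambda>i. 0)" for c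
  proof (rule ccontr)
    assume "c \<noteq> (\<lambda>i. 0)"
    let ?A = "{n. c n \<noteq> 0}"
    have A: "finite ?A" "?A \<noteq> {}" using c \<open>c \<noteq> (\<lambda>i. 0)\<close> by (auto simp: fin_supp_def)
    define N where "N = Max ?A"
    have N: "N \<in> ?A" unfolding N_def using A by (rule Max_in)
    have "(\<Sum>n\<in>?A. c n * b (d n) (d N)) = (\<Sum>n\<in>{N}. c n * b (d n) (d N))"
    proof (rule sum.mono_neutral_right[OF A(1)])
      show "\<forall>n\<in>?A - {N}. c n * b (d n) (d N) = 0"
      proof
        fix n assume "n \<in> ?A - {N}"
        then have "n < N" unfolding N_def using Max_ge[OF A(1), of n] by fastforce
        then show "c n * b (d n) (d N) = 0" using b(3)[OF d d_mono] by simp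
      qed
    qed (use N in auto)
    then have "r c (d N) = c N * b (d N) (d N)" by (simp add: r_def)
    then show False using N b(2)[OF d, of N] rc by simp
  qed
  \<comment> \<open>Elimination from the top: a multiple of the basis element of degree
    \<open>m\<close> cancels the entry there, lowering the bound on the support.\<close>
  have surj: "\<exists>c\<in>fin_supp. r c = x" if "x \<in> X" "\<And>i. i \<ge> m \<Longrightarrow> x i = 0" for x m
    using that
  proof (induction m arbitrary: x)
    case 0
    then have "r (\<lambda>i. 0) = x" by (auto simp: r_def)
    then show ?case using fin_supp_zero by blast
  next
    case (Suc m)
    have top: "\<forall>i>m. x i = 0" using Suc.prems(2) by auto
    show ?case
    proof (cases "x m = 0")
      case True
      have "x i = 0" if "i \<ge> m" for i using that True top by (cases "i = m") auto
      then show ?thesis by (rule Suc.IH[OF Suc.prems(1)])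
    next
      case False
      then have m: "m \<in> D" using Suc.prems(1) top unfolding D_def by blast
      then obtain n where n: "d n = m" using d_ex by blast
      obtain z where z: "x m = b m m * z" using b(4)[OF m Suc.prems(1) top] by (auto simp: dvd_def)
      define y where "y = (\<lambda>i. x i + (- z) * b m i)"
      have "y \<in> X" unfolding y_def by (rule add[OF Suc.prems(1) scale[OF b(1)[OF m]]])
      moreover have "y i = 0" if "i \<ge> m" for i
        using that z top b(3)[OF m, of i] by (cases "i = m") (auto simp: y_def)
      ultimately obtain c where c: "c \<in> fin_supp" "r c = y" using Suc.IH by blast
      have "r (\<lambda>i. c i + (if i = n then z else 0)) = x"
        unfolding r_add[OF c(1) fin_supp_single] r_single c(2) n by (simp add: y_def)
      then show ?thesis using fin_supp_add[OF c(1) fin_supp_single] by blast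
    qed
  qed
  show thesis
  proof (rule that)
    show "bij_betw r fin_supp X"
      unfolding bij_betw_def
    proof
      show "inj_on r fin_supp"
      proof (rule inj_onI)
        fix c e assume ce: "c \<in> fin_supp" "e \<in> fin_supp" and eq: "r c = r e"
        have "r (\<lambda>i. - e i) = (\<lambda>i. - r e i)" by (simp add: r_def sum_negf fun_eq_iff)
        then have "r (\<lambda>i. c i + - e i) = (\<lambda>i. 0)"
          using r_add[OF ce(1) fin_supp_neg[OF ce(2)]] eq by simp
        from ker[OF fin_supp_add[OF ce(1) fin_supp_neg[OF ce(2)]] this]
        show "c = e" by (simp add: fun_eq_iff)
      qed
      show "r ` fin_supp = X"
      proof
        show "r ` fin_supp \<subseteq> X" using r_in by auto
        show "X \<subseteq> r ` fin_supp"
        proof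
          fix x assume x: "x \<in> X"
          then have "x \<in> fin_supp" using fin by blast
          then obtain m where "\<And>i. i \<ge> m \<Longrightarrow> x i = 0" using fin_supp_bounded by blast
          then obtain c where "c \<in> fin_supp" "r c = x" using surj[OF x] by blast
          then show "x \<in> r ` fin_supp" by blast
        qed
      qed
    qed
  qed (rule r_add)
qed

section \<open>Reduction of abelian groups to \<open>\<Omega>\<close>\<close>

text \<open>The surjection of the free group on the elements of \<open>S\<close> onto
  \<open>S\<close>, sending the basis vector at \<open>i\<close> to \<open>i\<close>. It is
  meaningful on \<open>fin_supp\<close>.\<close>

definition ev :: "('i, 'j) str \<Rightarrow> (nat \<Rightarrow> int) \<Rightarrow> nat" where
  "ev S x = finprod (grp S) (\<lambda>i. i [^]\<^bsub>grp S\<^esub> x i) {i. x i \<noteq> 0}"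

context
  fixes S :: "('i, 'j) str"
  assumes S: "comm_group (grp S)"
begin

interpretation comm_group "grp S" by (rule S)

lemma ev_superset:
  assumes "finite A" "{i. x i \<noteq> 0} \<subseteq> A"
  shows "ev S x = finprod (grp S) (\<lambda>i. i [^]\<^bsub>grp S\<^esub> x i) A"
  unfolding ev_def by (rule finprod_mono_neutral_cong_left) (use assms in auto)

lemma ev_add:
  assumes "x \<in> fin_supp" "y \<in> fin_supp"
  shows "ev S (\<lambda>i. x i + y i) = fst S (ev S x, ev S y)"
proof -
  let ?A = "{n. x n \<noteq> 0} \<union> {n. y n \<noteq> 0}"
  have A: "finite ?A" using assms by (simp add: fin_supp_def)
  have "ev S (\<lambda>i. x i + y i) = finprod (grp S) (\<lambda>i. i [^]\<^bsub>grp S\<^esub> (x i + y i)) ?A"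
    by (rule ev_superset[OF A]) auto
  also have "\<dots> = finprod (grp S) (\<lambda>i. i [^]\<^bsub>grp S\<^esub> x i \<otimes>\<^bsub>grp S\<^esub> i [^]\<^bsub>grp S\<^esub> y i) ?A"
    using int_pow_mult[of _ "x _" "y _"] by (simp del: mult_grp)
  also have "\<dots> = ev S x \<otimes>\<^bsub>grp S\<^esub> ev S y"
    using ev_superset[OF A, of x] ev_superset[OF A, of y] finprod_multf[of "\<lambda>i. i [^]\<^bsub>grp S\<^esub> x i" ?A "\<lambda>i. i [^]\<^bsub>grp S\<^esub> y i"]
    by (simp del: mult_grp)
  finally show ?thesis by simp
qed

lemma ev_single: "ev S (\<lambda>i. if i = a then 1 else 0) = a"
proof -
  have "ev S (\<lambda>i. if i = a then 1 else 0) = a \<otimes>\<^bsub>grp S\<^esub> \<one>\<^bsub>grp S\<^esub>"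
    by (subst ev_superset[of "{a}"]) (auto simp del: mult_grp)
  then show ?thesis using r_one[of a] by simp
qed

lemma ev_zero: "ev S (\<lambda>i. 0) = \<one>\<^bsub>grp S\<^esub>"
  by (simp add: ev_def)

lemma ev_scale: "x \<in> fin_supp \<Longrightarrow> ev S (\<lambda>i. int n * x i) = ev S x [^]\<^bsub>grp S\<^esub> n"
proof (induction n)
  case 0
  then show ?case by (simp add: ev_zero)
next
  case (Suc n)
  have "ev S (\<lambda>i. int (Suc n) * x i) = fst S (ev S (\<lambda>i. int n * x i), ev S x)"
    using ev_add[OF fin_supp_scale[OF Suc.prems, of "int n"] Suc.prems] by (simp add: algebra_simps)
  then show ?case using Suc by simp
qed

lemma ev_neg:
  assumes "x \<in> fin_supp" "ev S x = \<one>\<^bsub>grp S\<^esub>"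
  shows "ev S (\<lambda>i. - x i) = \<one>\<^bsub>grp S\<^esub>"
  using ev_add[OF assms(1) fin_supp_neg[OF assms(1)]] assms(2) ev_zero l_one[of "ev S (\<lambda>i. - x i)"] by simp

end

text \<open>The map of free groups induced by a bijection \<open>h\<close> of the bases.\<close>

definition transport :: "(nat \<Rightarrow> nat) \<Rightarrow> (nat \<Rightarrow> int) \<Rightarrow> nat \<Rightarrow> int" where
  "transport h x = (\<lambda>i. x (inv_into UNIV h i))"

text \<open>Naturality of \<open>ev\<close>: on finite products, \<open>h\<close> may be applied to
  each factor, and it carries the support of \<open>x\<close> onto that of the transported
  vector.\<close>

lemma ev_transport:
  assumes S: "comm_group (grp S)" and T: "comm_group (grp T)" and h: "h \<in> Group.iso (grp S) (grp T)"
    and x: "x \<in> fin_supp"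
  shows "ev T (transport h x) = h (ev S x)" and "transport h x \<in> fin_supp"
proof -
  interpret S: comm_group "grp S" by (rule S)
  interpret T: comm_group "grp T" by (rule T)
  interpret h: group_hom "grp S" "grp T" h
    using h by unfold_locales (auto simp: Group.iso_def)
  have bij: "bij h" using h by (simp add: iso_grp_iff)
  then have inv: "inv_into UNIV h (h i) = i" for i by (simp add: bij_is_inj)
  have supp: "{i. transport h x i \<noteq> 0} = h ` {i. x i \<noteq> 0}"
  proof
    show "{i. transport h x i \<noteq> 0} \<subseteq> h ` {i. x i \<noteq> 0}"
    proof
      fix i assume "i \<in> {i. transport h x i \<noteq> 0}"
      moreover have "i = h (inv_into UNIV h i)" using bij by (simp add: bij_is_surj surj_f_inv_f)
      ultimately show "i \<in> h ` {i. x i \<noteq> 0}" unfolding transport_def by blast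
    qed
  qed (auto simp: transport_def inv)
  show "transport h x \<in> fin_supp" using x unfolding fin_supp_def mem_Collect_eq supp by simp
  have "finite A \<Longrightarrow> finprod (grp T) (\<lambda>i. i [^]\<^bsub>grp T\<^esub> transport h x i) (h ` A) =
    h (finprod (grp S) (\<lambda>i. i [^]\<^bsub>grp S\<^esub> x i) A)" for A
  proof (induction A rule: finite_induct)
    case (insert a A)
    have "h a \<notin> h ` A" using insert.hyps bij by (auto simp: bij_def inj_def)
    moreover have "h a [^]\<^bsub>grp T\<^esub> transport h x (h a) = h (a [^]\<^bsub>grp S\<^esub> x a)"
      by (simp add: transport_def inv h.hom_int_pow)
    ultimately show ?case using insert by (simp del: mult_grp)
  qed (use h.hom_one in simp)
  from this[of "{i. x i \<noteq> 0}"] show "ev T (transport h x) = h (ev S x)"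
    using x by (simp add: ev_def supp fin_supp_def)
qed

section \<open>Measurability of group operations and of evaluation\<close>

lemma pred_eq_count_space:
  fixes f g :: "'s \<Rightarrow> 'c::countable"
  assumes [measurable]: "f \<in> M \<rightarrow>\<^sub>M count_space UNIV" and g: "g \<in> M \<rightarrow>\<^sub>M count_space UNIV"
  shows "Measurable.pred M (\<lambda>S. f S = g S)"
  by (rule measurable_compose_countable[OF _ g, of "\<lambda>c S. f S = c"]) measurable

lemma measurable_mult_compose:
  assumes [measurable]: "f \<in> Models \<Phi> \<rightarrow>\<^sub>M count_space UNIV" "g \<in> Models \<Phi> \<rightarrow>\<^sub>M count_space UNIV"
  shows "(\<lambda>S. fst S (f S, g S)) \<in> Models \<Phi> \<rightarrow>\<^sub>M count_space UNIV"
proof -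
  have "(\<lambda>S. fst S (a, g S)) \<in> Models \<Phi> \<rightarrow>\<^sub>M count_space UNIV" for a
    by (rule measurable_compose_countable[of "\<lambda>b S. fst S (a, b)"]) measurable
  then show ?thesis
    by (rule measurable_compose_countable[of "\<lambda>a S. fst S (a, g S)"]) measurable
qed

context
  fixes \<Phi> :: "('i, 'j) sentence"
  assumes cg: "\<And>S. S \<in> space (Models \<Phi>) \<Longrightarrow> comm_group (grp S)"
begin

text \<open>On groups the neutral element is unique, so \<open>LEAST\<close> gives the same element
  as \<open>THE\<close>, and \<open>LEAST\<close> preserves measurability.\<close>

lemma measurable_one: "(\<lambda>S. \<one>\<^bsub>grp S\<^esub>) \<in> Models \<Phi> \<rightarrow>\<^sub>M count_space UNIV"
proof -
  have "(\<lambda>S. LEAST e. neutral S e) \<in> Models \<Phi> \<rightarrow>\<^sub>M count_space UNIV"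
    unfolding neutral_def by measurable
  moreover have "\<one>\<^bsub>grp S\<^esub> = (LEAST e. neutral S e)" if "S \<in> space (Models \<Phi>)" for S
    using neutral_iff[OF comm_group.axioms(2)[OF cg[OF that]]] by (auto intro!: Least_equality[symmetric])
  ultimately show ?thesis by (subst measurable_cong) auto
qed

lemma measurable_inv: "(\<lambda>S. inv\<^bsub>grp S\<^esub> a) \<in> Models \<Phi> \<rightarrow>\<^sub>M count_space UNIV"
proof -
  note [measurable] = pred_eq_count_space[OF measurable_mult measurable_one]
  have "(\<lambda>S. LEAST b. fst S (b, a) = \<one>\<^bsub>grp S\<^esub>) \<in> Models \<Phi> \<rightarrow>\<^sub>M count_space UNIV"
    by measurable
  moreover have "inv\<^bsub>grp S\<^esub> a = (LEAST b. fst S (b, a) = \<one>\<^bsub>grp S\<^esub>)" if "S \<in> space (Models \<Phi>)" for S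
  proof -
    interpret comm_group "grp S" by (rule cg[OF that])
    have "fst S (b, a) = \<one>\<^bsub>grp S\<^esub> \<longleftrightarrow> b = inv\<^bsub>grp S\<^esub> a" for b
      using inv_equality[of b a] l_inv[of a] by auto
    then show ?thesis by (auto intro!: Least_equality[symmetric])
  qed
  ultimately show ?thesis by (subst measurable_cong) auto
qed

lemma measurable_nat_pow: "(\<lambda>S. a [^]\<^bsub>grp S\<^esub> (n :: nat)) \<in> Models \<Phi> \<rightarrow>\<^sub>M count_space UNIV"
proof (induction n)
  case 0
  show ?case using measurable_one by simp
next
  case (Suc n)
  show ?case using measurable_mult_compose[OF Suc measurable_count_space_const[of a]] by simp
qed

lemma measurable_int_pow: "(\<lambda>S. a [^]\<^bsub>grp S\<^esub> (z :: int)) \<in> Models \<Phi> \<rightarrow>\<^sub>M count_space UNIV"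
proof (cases "z < 0")
  case True
  have "(\<lambda>S. inv\<^bsub>grp S\<^esub> (a [^]\<^bsub>grp S\<^esub> nat (- z))) \<in> Models \<Phi> \<rightarrow>\<^sub>M count_space UNIV"
    by (rule measurable_compose_countable[of "\<lambda>b S. inv\<^bsub>grp S\<^esub> b", OF measurable_inv measurable_nat_pow])
  then show ?thesis using True by (simp only: int_pow_def2 if_True)
next
  case False
  then show ?thesis using measurable_nat_pow[of a "nat z"] by (simp only: int_pow_def2 if_False)
qed

lemma measurable_ev: "(\<lambda>S. ev S x) \<in> Models \<Phi> \<rightarrow>\<^sub>M count_space UNIV"
proof -
  have "finite A \<Longrightarrow> (\<lambda>S. finprod (grp S) (\<lambda>i. i [^]\<^bsub>grp S\<^esub> x i) A) \<in> Models \<Phi> \<rightarrow>\<^sub>M count_space UNIV" for A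
  proof (induction A rule: finite_induct)
    case empty
    have "finprod (grp S) (\<lambda>i. i [^]\<^bsub>grp S\<^esub> x i) {} = \<one>\<^bsub>grp S\<^esub>" if "S \<in> space (Models \<Phi>)" for S
      using comm_monoid.finprod_empty[OF comm_group.axioms(1)[OF cg[OF that]]] .
    then show ?case using measurable_one by (subst measurable_cong) auto
  next
    case (insert a A)
    have "finprod (grp S) (\<lambda>i. i [^]\<^bsub>grp S\<^esub> x i) (insert a A) =
      fst S (a [^]\<^bsub>grp S\<^esub> x a, finprod (grp S) (\<lambda>i. i [^]\<^bsub>grp S\<^esub> x i) A)"
      if "S \<in> space (Models \<Phi>)" for S
    proof -
      interpret comm_group "grp S" by (rule cg[OF that])
      show ?thesis using insert.hyps by simp
    qed
    then show ?case
      using measurable_mult_compose[OF measurable_int_pow insert.IH] by (subst measurable_cong) auto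
  qed
  moreover have "ev S x = \<one>\<^bsub>grp S\<^esub>" if "infinite {i. x i \<noteq> 0}" "S \<in> space (Models \<Phi>)" for S
    unfolding ev_def using comm_monoid.finprod_infinite[OF comm_group.axioms(1)[OF cg[OF that(2)]] that(1)] .
  ultimately show ?thesis
    using measurable_one measurable_cong[of "Models \<Phi>" "\<lambda>S. ev S x" "\<lambda>S. \<one>\<^bsub>grp S\<^esub>"]
    by (cases "finite {i. x i \<noteq> 0}") (simp_all add: ev_def)
qed

end

text \<open>A bijection compatible with the operations and with the kernels of two surjections
  induces an isomorphism of the quotients.\<close>

lemma quotient_iso:
  assumes S: "group (grp S)" and T: "group (grp T)"
    and k: "bij_betw k U V"
    and mul: "\<And>u v. u \<in> U \<Longrightarrow> v \<in> U \<Longrightarrow> mul u v \<in> U"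
    and k_mul: "\<And>u v. u \<in> U \<Longrightarrow> v \<in> U \<Longrightarrow> k (mul u v) = mul (k u) (k v)"
    and e: "\<And>u v. u \<in> U \<Longrightarrow> v \<in> U \<Longrightarrow> e (mul u v) = fst S (e u, e v)" "\<And>a. \<exists>u\<in>U. e u = a"
    and e': "\<And>u v. u \<in> V \<Longrightarrow> v \<in> V \<Longrightarrow> e' (mul u v) = fst T (e' u, e' v)" "\<And>a. \<exists>u\<in>V. e' u = a"
    and ker: "\<And>u. u \<in> U \<Longrightarrow> e u = \<one>\<^bsub>grp S\<^esub> \<longleftrightarrow> e' (k u) = \<one>\<^bsub>grp T\<^esub>"
  obtains g where "bij g" "\<And>x y. g (fst S (x, y)) = fst T (g x, g y)"
proof -
  interpret S: group "grp S" by (rule S)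
  interpret T: group "grp T" by (rule T)
  have kV: "k u \<in> V" if "u \<in> U" for u using bij_betw_apply[OF k that] .
  have e'k: "e' (k (mul u v)) = fst T (e' (k u), e' (k v))" if "u \<in> U" "v \<in> U" for u v
    using that by (simp add: k_mul e'(1) kV)
  have e'_ex: "\<exists>u\<in>U. e' (k u) = a" for a
    using e'(2)[of a] bij_betw_imp_surj_on[OF k] by blast
  have wd: "e u = e v \<longleftrightarrow> e' (k u) = e' (k v)" if u: "u \<in> U" and v: "v \<in> U" for u v
  proof
    assume eq: "e u = e v"
    \<comment> \<open>Only closure of \<open>U\<close> under \<open>mul\<close> is available. An
      element mapping to the inverse replaces a negative of \<open>u\<close>, so that equality of
      values becomes membership in the kernel.\<close>
    obtain w where w: "w \<in> U" "e w = inv\<^bsub>grp S\<^esub> e u" using e(2) by blast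
    have "e (mul u w) = \<one>\<^bsub>grp S\<^esub>" "e (mul v w) = \<one>\<^bsub>grp S\<^esub>"
      using S.r_inv[of "e u"] eq w u v by (simp_all add: e(1))
    then have "e' (k u) \<otimes>\<^bsub>grp T\<^esub> e' (k w) = e' (k v) \<otimes>\<^bsub>grp T\<^esub> e' (k w)"
      using ker mul u v w(1) e'k by simp
    then show "e' (k u) = e' (k v)" using T.right_cancel[of "e' (k w)" "e' (k u)" "e' (k v)"] by simp
  next
    assume eq: "e' (k u) = e' (k v)"
    obtain w where w: "w \<in> U" "e' (k w) = inv\<^bsub>grp T\<^esub> e' (k u)" using e'_ex by blast
    have "e' (k (mul u w)) = \<one>\<^bsub>grp T\<^esub>" "e' (k (mul v w)) = \<one>\<^bsub>grp T\<^esub>"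
      using T.r_inv[of "e' (k u)"] eq w u v by (simp_all add: e'k)
    then have "e u \<otimes>\<^bsub>grp S\<^esub> e w = e v \<otimes>\<^bsub>grp S\<^esub> e w"
      using ker[OF mul[OF u w(1)]] ker[OF mul[OF v w(1)]] e(1)[OF u w(1)] e(1)[OF v w(1)] by simp
    then show "e u = e v" using S.right_cancel[of "e w" "e u" "e v"] by simp
  qed
  obtain s where s: "\<And>a. s a \<in> U" "\<And>a. e (s a) = a" using e(2) by metis
  define g where "g a = e' (k (s a))" for a
  have g: "g (e u) = e' (k u)" if "u \<in> U" for u
    unfolding g_def using wd[of "s (e u)" u] s that by simp
  show thesis
  proof (rule that)
    show "bij g"
      unfolding bij_def
    proof
      show "inj g" unfolding g_def by (rule injI) (metis wd s)
      have "\<exists>x. y = g x" for y using e'_ex[of y] g by metis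
      then show "surj g" by (simp add: surj_def)
    qed
    show "g (fst S (x, y)) = fst T (g x, g y)" for x y
    proof -
      have "g (e (mul (s x) (s y))) = e' (k (mul (s x) (s y)))" by (rule g) (simp add: mul s)
      then show ?thesis using e'k[of "s x" "s y"] by (simp add: e(1) s g_def)
    qed
  qed
qed

section \<open>The group \<open>F\<close> + \<open>K\<close> of a free presentation\<close>

type_synonym vec2 = "(nat \<Rightarrow> int) \<times> (nat \<Rightarrow> int)"

definition vadd :: "vec2 \<Rightarrow> vec2 \<Rightarrow> vec2" where
  "vadd u v = ((\<lambda>i. fst u i + fst v i), (\<lambda>i. snd u i + snd v i))"

text \<open>The direct sum \<open>F\<close> + \<open>K\<close> of the introduction, with
  \<open>K\<close> the kernel of \<open>ev\<close>.\<close>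

definition relations :: "('i, 'j) str \<Rightarrow> vec2 set" where
  "relations S = {(x, y). x \<in> fin_supp \<and> y \<in> fin_supp \<and> ev S y = \<one>\<^bsub>grp S\<^esub>}"

text \<open>Lists provide a countable type of codes for \<open>fin_supp\<close>. Trailing zeros give
  several codes for one vector, which \<open>measurable_presentation\<close> permits.\<close>

definition list_fun :: "int list \<Rightarrow> nat \<Rightarrow> int" where
  "list_fun xs i = (if i < length xs then xs ! i else 0)"

lemma range_list_fun: "range list_fun = fin_supp"
proof
  show "range list_fun \<subseteq> fin_supp"
  proof
    fix x assume "x \<in> range list_fun"
    then obtain xs where x: "x = list_fun xs" by blast
    show "x \<in> fin_supp" unfolding x fin_supp_def mem_Collect_eq
      by (rule finite_subset[of _ "{..<length xs}"]) (auto simp: list_fun_def split: if_splits)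
  qed
  show "fin_supp \<subseteq> range list_fun"
  proof
    fix x assume "x \<in> fin_supp"
    then obtain m where m: "\<And>i. i \<ge> m \<Longrightarrow> x i = 0" using fin_supp_bounded by blast
    have "x = list_fun (map x [0..<m])" using m by (auto simp: list_fun_def fun_eq_iff)
    then show "x \<in> range list_fun" by blast
  qed
qed

context
  fixes S :: "('i, 'j) str"
  assumes S: "comm_group (grp S)"
begin

interpretation comm_group "grp S" by (rule S)

lemma relations_zero: "((\<lambda>i. 0), (\<lambda>i. 0)) \<in> relations S"
  by (simp add: relations_def fin_supp_zero ev_zero[OF S])

lemma relations_vadd: "u \<in> relations S \<Longrightarrow> v \<in> relations S \<Longrightarrow> vadd u v \<in> relations S"
  using l_one[of "\<one>\<^bsub>grp S\<^esub>"]
  by (auto simp: relations_def vadd_def fin_supp_add ev_add[OF S])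

lemma relations_neg: "u \<in> relations S \<Longrightarrow> ((\<lambda>i. - fst u i), (\<lambda>i. - snd u i)) \<in> relations S"
  by (auto simp: relations_def fin_supp_neg ev_neg[OF S])

text \<open>Interleaving the two vectors embeds \<open>F\<close> + \<open>K\<close> into a single
  \<open>fin_supp\<close>, where \<open>subgroup_of_free_is_free\<close> applies.\<close>

lemma relations_free:
  obtains r where "bij_betw r fin_supp (relations S)"
    "\<And>c d. c \<in> fin_supp \<Longrightarrow> d \<in> fin_supp \<Longrightarrow> r (\<lambda>i. c i + d i) = vadd (r c) (r d)"
proof -
  define il where "il u n = (if even n then fst u (n div 2) else snd u (n div 2))" for u :: vec2 and n :: nat
  have il_inj: "u = v" if "il u = il v" for u v
  proof -
    have "fst u i = fst v i" "snd u i = snd v i" for i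
      using fun_cong[OF that, of "2 * i"] fun_cong[OF that, of "Suc (2 * i)"] by (simp_all add: il_def)
    then show ?thesis by (simp add: prod_eq_iff fun_eq_iff)
  qed
  have il_add: "il (vadd u v) = (\<lambda>i. il u i + il v i)" for u v
    by (auto simp: il_def vadd_def)
  let ?X = "il ` relations S"
  obtain q where q: "bij_betw q fin_supp ?X"
    "\<And>c d. c \<in> fin_supp \<Longrightarrow> d \<in> fin_supp \<Longrightarrow> q (\<lambda>i. c i + d i) = (\<lambda>i. q c i + q d i)"
  proof (rule subgroup_of_free_is_free[of ?X])
    show "?X \<subseteq> fin_supp"
    proof
      fix z assume "z \<in> ?X"
      then obtain u where u: "u \<in> relations S" "z = il u" by blast
      have "{n. z n \<noteq> 0} \<subseteq> (\<lambda>i. 2 * i) ` {i. fst u i \<noteq> 0} \<union> (\<lambda>i. Suc (2 * i)) ` {i. snd u i \<noteq> 0}"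
      proof
        fix n assume n: "n \<in> {n. z n \<noteq> 0}"
        show "n \<in> (\<lambda>i. 2 * i) ` {i. fst u i \<noteq> 0} \<union> (\<lambda>i. Suc (2 * i)) ` {i. snd u i \<noteq> 0}"
        proof (cases "even n")
          case True
          then have "n = 2 * (n div 2)" "fst u (n div 2) \<noteq> 0" using n by (auto simp: u il_def)
          then show ?thesis by blast
        next
          case False
          then have "n = Suc (2 * (n div 2))" "snd u (n div 2) \<noteq> 0" using n by (auto simp: u il_def)
          then show ?thesis by blast
        qed
      qed
      then show "z \<in> fin_supp"
        unfolding fin_supp_def mem_Collect_eq using u(1)
        by (elim finite_subset) (auto simp: relations_def fin_supp_def)
    qed
    show "(\<lambda>i. 0) \<in> ?X"
    proof -
      have "il ((\<lambda>i. 0), (\<lambda>i. 0)) = (\<lambda>i. 0)" by (simp add: il_def fun_eq_iff)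
      then show ?thesis using imageI[OF relations_zero, of il] by simp
    qed
    show "(\<lambda>i. x i + y i) \<in> ?X" if "x \<in> ?X" "y \<in> ?X" for x y
      using that relations_vadd by (auto simp: il_add[symmetric])
    show "(\<lambda>i. - x i) \<in> ?X" if x: "x \<in> ?X" for x
    proof -
      obtain u where u: "u \<in> relations S" "x = il u" using x by blast
      have "(\<lambda>i. - x i) = il ((\<lambda>i. - fst u i), (\<lambda>i. - snd u i))" by (auto simp: u il_def)
      then show ?thesis using relations_neg[OF u(1)] by blast
    qed
    \<comment> \<open>The basis vectors of \<open>F\<close> land at even positions, so every even
      number occurs as a degree. The summand \<open>F\<close> thus guarantees infinite rank.\<close>
    have "(\<lambda>i. 2 * i) n \<in> {n. \<exists>x\<in>?X. x n \<noteq> 0 \<and> (\<forall>i>n. x i = 0)}" for n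
    proof -
      have "((\<lambda>i. if i = n then 1 else 0), (\<lambda>i. 0)) \<in> relations S"
        by (simp add: relations_def fin_supp_single fin_supp_zero ev_zero[OF S])
      then show ?thesis
        by (auto simp: il_def intro!: bexI[of _ "((\<lambda>i. if i = n then 1 else 0), (\<lambda>i. 0))"])
    qed
    then have "range (\<lambda>i. 2 * i :: nat) \<subseteq> {n. \<exists>x\<in>?X. x n \<noteq> 0 \<and> (\<forall>i>n. x i = 0)}" by blast
    moreover have "infinite (range (\<lambda>i. 2 * i :: nat))" by (simp add: finite_image_iff inj_on_def)
    ultimately show "infinite {n. \<exists>x\<in>?X. x n \<noteq> 0 \<and> (\<forall>i>n. x i = 0)}" by (rule infinite_super)
    fix q
    assume "bij_betw q fin_supp ?X"
      "\<And>c d. c \<in> fin_supp \<Longrightarrow> d \<in> fin_supp \<Longrightarrow> q (\<lambda>i. c i + d i) = (\<lambda>i. q c i + q d i)"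
    then show thesis by (rule that)
  qed
  have il_bij: "bij_betw il (relations S) ?X"
    using il_inj by (auto simp: bij_betw_def inj_on_def)
  define r where "r = the_inv_into (relations S) il \<circ> q"
  have r: "bij_betw r fin_supp (relations S)"
    unfolding r_def by (rule bij_betw_trans[OF q(1) bij_betw_the_inv_into[OF il_bij]])
  have il_r: "il (r c) = q c" if "c \<in> fin_supp" for c
    unfolding r_def comp_def using f_the_inv_into_f_bij_betw[OF il_bij] bij_betw_apply[OF q(1) that] by blast
  show thesis
  proof (rule that[OF r])
    fix c d assume "c \<in> fin_supp" "d \<in> fin_supp"
    then have "il (r (\<lambda>i. c i + d i)) = il (vadd (r c) (r d))"
      by (simp add: il_r il_add fin_supp_add q(2))
    then show "r (\<lambda>i. c i + d i) = vadd (r c) (r d)" by (rule il_inj)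
  qed
qed

end

abbreviation vzero :: vec2 where
  "vzero \<equiv> ((\<lambda>i. 0), (\<lambda>i. 0))"

text \<open>Inside \<open>F\<close> + \<open>K\<close> the symbol \<open>i0\<close> names
  \<open>K\<close> + \<open>K\<close>, with quotient the original group. All other predicates name
  the trivial subgroup.\<close>

definition ker_pred :: "'i \<Rightarrow> ('a, 'b) str \<Rightarrow> 'i \<Rightarrow> vec2 \<Rightarrow> bool" where
  "ker_pred i0 S i u \<longleftrightarrow> (if i = i0 then ev S (fst u) = \<one>\<^bsub>grp S\<^esub> else u = vzero)"

text \<open>The symbol \<open>j0\<close> names the endomorphism whose kernel modulo image is the
  original group; the others name the zero map. All are total.\<close>

definition shift_fun :: "'j \<Rightarrow> 'j \<Rightarrow> vec2 \<Rightarrow> vec2" where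
  "shift_fun j0 j u = (if j = j0 then (snd u, (\<lambda>i. 0)) else vzero)"

lemma shift_fun_vadd: "shift_fun j0 j (vadd u v) = vadd (shift_fun j0 j u) (shift_fun j0 j v)"
  by (simp add: shift_fun_def vadd_def)

lemma shift_fun_relations:
  assumes "comm_group (grp S)" "u \<in> relations S"
  shows "shift_fun j0 j u \<in> relations S"
  using assms relations_zero[OF assms(1)] by (auto simp: shift_fun_def relations_def)

lemma measurable_pred_bool3:
  assumes [measurable]: "Measurable.pred M p" "Measurable.pred M q" "Measurable.pred M r"
  shows "Measurable.pred M (\<lambda>S. H (p S) (q S) (r S))"
proof -
  have "Measurable.pred M (\<lambda>S. H a b (r S))" for a b
    by (rule measurable_compose_countable[of "\<lambda>c S. H a b c"]) auto
  then have "Measurable.pred M (\<lambda>S. H a (q S) (r S))" for a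
    by (rule measurable_compose_countable[of "\<lambda>b S. H a b (r S)"]) auto
  then show ?thesis
    by (rule measurable_compose_countable[of "\<lambda>a S. H a (q S) (r S)"]) auto
qed

text \<open>The element named by a code depends on \<open>S\<close> only through one truth value,
  whether the second list lies in \<open>K\<close>. Hence the equality, addition and function
  conditions are Boolean functions of at most three measurable conditions.\<close>

lemma relations_presentation:
  fixes \<Phi> :: "('a, 'b) sentence" and I :: "'i set" and J :: "'j set"
  assumes cg: "\<And>S. S \<in> space (Models \<Phi>) \<Longrightarrow> comm_group (grp S)"
  obtains f \<beta> where "f \<in> Models \<Phi> \<rightarrow>\<^sub>M str_space I J"
    and "\<And>S. S \<in> space (Models \<Phi>) \<Longrightarrow> bij_betw (\<beta> S) UNIV (relations S)"
    and "\<And>S x y. S \<in> space (Models \<Phi>) \<Longrightarrow> \<beta> S (fst (f S) (x, y)) = vadd (\<beta> S x) (\<beta> S y)"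
    and "\<And>S i x. S \<in> space (Models \<Phi>) \<Longrightarrow> i \<in> I \<Longrightarrow> x \<in> pred (f S) i \<longleftrightarrow> ker_pred i0 S i (\<beta> S x)"
    and "\<And>S j x. S \<in> space (Models \<Phi>) \<Longrightarrow> j \<in> J \<Longrightarrow>
      map_option (\<beta> S) (pfun (f S) j x) = Some (shift_fun j0 j (\<beta> S x))"
proof -
  define q where "q ys S \<longleftrightarrow> ev S (list_fun ys) = \<one>\<^bsub>grp S\<^esub>" for ys and S :: "('a, 'b) str"
  \<comment> \<open>A second list outside \<open>K\<close> is replaced by zero, so every pair of
    lists names an element of \<open>relations S\<close>.\<close>
  define w where "w p b = (list_fun (fst p), if b then list_fun (snd p) else (\<lambda>i. 0))"
    for p :: "int list \<times> int list" and b
  define \<nu> where "\<nu> S p = w p (q (snd p) S)" for S p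
  have q_meas: "Measurable.pred (Models \<Phi>) (q ys)" for ys
    unfolding q_def by (rule pred_eq_count_space[OF measurable_ev[OF cg] measurable_one[OF cg]])
  note bool3 = measurable_pred_bool3[OF q_meas q_meas q_meas]
  have range: "range (\<nu> S) = relations S" if "S \<in> space (Models \<Phi>)" for S
  proof
    have fs: "list_fun xs \<in> fin_supp" for xs using range_list_fun by blast
    show "range (\<nu> S) \<subseteq> relations S"
      using fs fin_supp_zero ev_zero[OF cg[OF that]] by (auto simp: \<nu>_def w_def q_def relations_def)
    show "relations S \<subseteq> range (\<nu> S)"
    proof
      fix u assume u: "u \<in> relations S"
      then have "fst u \<in> range list_fun" "snd u \<in> range list_fun"
        unfolding range_list_fun relations_def by auto
      then obtain xs ys where "fst u = list_fun xs" "snd u = list_fun ys" by blast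
      then have "u = \<nu> S (xs, ys)" using u by (auto simp: \<nu>_def w_def q_def relations_def)
      then show "u \<in> range (\<nu> S)" by blast
    qed
  qed
  have in_rel: "\<nu> S p \<in> relations S" if "S \<in> space (Models \<Phi>)" for S p
    using range[OF that] by blast
  show thesis
  proof (rule measurable_presentation[of "Models \<Phi>" \<nu> "\<lambda>_. vadd" J "\<lambda>_ j u. Some (shift_fun j0 j u)" I "ker_pred i0"])
    fix S assume S: "S \<in> space (Models \<Phi>)"
    define u where "u a = ((\<lambda>i. if i = a then 1 else 0) :: nat \<Rightarrow> int, (\<lambda>i. 0) :: nat \<Rightarrow> int)" for a
    have "inj u"
    proof (rule injI)
      fix a b assume "u a = u b"
      then have "(\<lambda>i. if i = a then 1 else 0 :: int) = (\<lambda>i. if i = b then 1 else 0)" by (simp add: u_def)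
      from fun_cong[OF this, of a] show "a = b" by (simp split: if_splits)
    qed
    then have "infinite (range u)" by (simp add: finite_image_iff)
    moreover have "range u \<subseteq> relations S"
      using fin_supp_single fin_supp_zero ev_zero[OF cg[OF S]] by (auto simp: relations_def u_def)
    ultimately show "infinite (range (\<nu> S))" unfolding range[OF S] using infinite_super by blast
  next
    fix S a b assume S: "S \<in> space (Models \<Phi>)"
    show "vadd (\<nu> S a) (\<nu> S b) \<in> range (\<nu> S)"
      unfolding range[OF S] by (rule relations_vadd[OF cg[OF S]]) (rule in_rel[OF S])+
  next
    fix S j a v assume S: "S \<in> space (Models \<Phi>)" and v: "Some (shift_fun j0 j (\<nu> S a)) = Some v"
    show "v \<in> range (\<nu> S)"
      using v shift_fun_relations[OF cg[OF S] in_rel[OF S, of a], of j0 j] unfolding range[OF S] by simp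
  next
    fix a b c
    show "Measurable.pred (Models \<Phi>) (\<lambda>S. \<nu> S a = \<nu> S b)"
      unfolding \<nu>_def by (rule bool3[of "\<lambda>x y z. w a x = w b y"])
    show "Measurable.pred (Models \<Phi>) (\<lambda>S. vadd (\<nu> S a) (\<nu> S b) = \<nu> S c)"
      unfolding \<nu>_def by (rule bool3[of "\<lambda>x y z. vadd (w a x) (w b y) = w c z"])
  next
    fix i a
    show "Measurable.pred (Models \<Phi>) (\<lambda>S. ker_pred i0 S i (\<nu> S a))"
    proof (cases "i = i0")
      case True
      then show ?thesis using q_meas[of "fst a"] by (simp add: ker_pred_def \<nu>_def w_def q_def[abs_def])
    next
      case False
      have "Measurable.pred (Models \<Phi>) (\<lambda>S. w a (q (snd a) S) = vzero)"
        by (rule bool3[of "\<lambda>x y z. w a x = vzero"])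
      then show ?thesis using False by (simp add: ker_pred_def \<nu>_def)
    qed
  next
    fix j a b
    show "Measurable.pred (Models \<Phi>) (\<lambda>S. Some (shift_fun j0 j (\<nu> S a)) = Some (\<nu> S b))"
      unfolding \<nu>_def by (rule bool3[of "\<lambda>x y z. Some (shift_fun j0 j (w a x)) = Some (w b y)"])
  next
    fix f \<beta>
    assume "f \<in> Models \<Phi> \<rightarrow>\<^sub>M str_space I J"
      and "\<And>S. S \<in> space (Models \<Phi>) \<Longrightarrow> bij_betw (\<beta> S) UNIV (range (\<nu> S))"
      and "\<And>S x y. S \<in> space (Models \<Phi>) \<Longrightarrow> \<beta> S (fst (f S) (x, y)) = vadd (\<beta> S x) (\<beta> S y)"
      and "\<And>S i x. S \<in> space (Models \<Phi>) \<Longrightarrow> i \<in> I \<Longrightarrow> x \<in> pred (f S) i \<longleftrightarrow> ker_pred i0 S i (\<beta> S x)"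
      and "\<And>S j x. S \<in> space (Models \<Phi>) \<Longrightarrow> j \<in> J \<Longrightarrow>
        map_option (\<beta> S) (pfun (f S) j x) = Some (shift_fun j0 j (\<beta> S x))"
    then show thesis using range by (intro that[of f \<beta>]) auto
  qed
qed

text \<open>The infinitary clause follows from an actual isomorphism, given by
  \<open>relations_free\<close>. For purity, the quotient by \<open>K\<close> + \<open>K\<close> is
  the original group, so it is torsion-free exactly when that group is; the trivial subgroup is pure
  because integer vectors have no torsion.\<close>

lemma relations_structure:
  fixes V :: "('i, 'j) str" and S :: "('a, 'b) str"
  assumes cg: "comm_group (grp S)"
    and \<beta>: "bij_betw \<beta> UNIV (relations S)"
    and \<beta>_add: "\<And>x y. \<beta> (fst V (x, y)) = vadd (\<beta> x) (\<beta> y)"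
    and V_pred: "\<And>i x. i \<in> I \<Longrightarrow> x \<in> pred V i \<longleftrightarrow> ker_pred i0 S i (\<beta> x)"
    and V_fun: "\<And>j x. j \<in> J \<Longrightarrow> map_option \<beta> (pfun V j x) = Some (shift_fun j0 j (\<beta> x))"
  shows "holds (Omega I J) V" and "torsion_free (grp S) \<Longrightarrow> holds (Omega_pure I J) V"
proof -
  interpret S: comm_group "grp S" by (rule cg)
  have inj: "\<beta> x = \<beta> y \<longleftrightarrow> x = y" for x y
    using \<beta> by (auto simp: bij_betw_def inj_on_def)
  have surj: "\<exists>x. \<beta> x = u" if "u \<in> relations S" for u
    using that bij_betw_imp_surj_on[OF \<beta>] by (metis imageE)
  have rel: "\<beta> x \<in> relations S" for x using bij_betw_apply[OF \<beta>] by blast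
  have fs: "fst (\<beta> x) \<in> fin_supp" for x using rel[of x] by (auto simp: relations_def)
  obtain e where e: "\<beta> e = vzero" using surj[OF relations_zero[OF cg]] by blast
  have "comm_group (grp V) \<and> \<one>\<^bsub>grp V\<^esub> = e"
  proof (rule comm_group_grpI)
    show "neutral V e"
      unfolding neutral_def by (simp add: inj[symmetric] \<beta>_add e vadd_def)
    show "\<exists>y. fst V (y, x) = e" for x
    proof -
      obtain y where "\<beta> y = ((\<lambda>i. - fst (\<beta> x) i), (\<lambda>i. - snd (\<beta> x) i))"
        using surj[OF relations_neg[OF cg rel]] by blast
      then show ?thesis by (intro exI[of _ y]) (simp add: inj[symmetric] \<beta>_add e vadd_def)
    qed
  qed (simp_all add: inj[symmetric] \<beta>_add vadd_def algebra_simps)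
  then have cgV: "comm_group (grp V)" and one: "\<one>\<^bsub>grp V\<^esub> = e" by blast+
  interpret V: comm_group "grp V" by (rule cgV)
  have Linf: "Linf_equiv (grp V) (sum_group (UNIV :: nat set) (\<lambda>_. integer_group))"
  proof -
    obtain r where r: "bij_betw r fin_supp (relations S)"
      "\<And>c d. c \<in> fin_supp \<Longrightarrow> d \<in> fin_supp \<Longrightarrow> r (\<lambda>i. c i + d i) = vadd (r c) (r d)"
      by (rule relations_free[OF cg]) blast
    define h where "h = the_inv_into fin_supp r \<circ> \<beta>"
    have bij: "bij_betw h UNIV fin_supp"
      unfolding h_def by (rule bij_betw_trans[OF \<beta> bij_betw_the_inv_into[OF r(1)]])
    have hf: "h x \<in> fin_supp" for x using bij_betw_apply[OF bij] by blast
    have rh: "r (h x) = \<beta> x" for x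
      unfolding h_def comp_def using f_the_inv_into_f_bij_betw[OF r(1)] rel by blast
    have "h (fst V (x, y)) = (\<lambda>i. h x i + h y i)" for x y
    proof -
      have "r (h (fst V (x, y))) = r (\<lambda>i. h x i + h y i)"
        by (simp add: rh r(2) hf \<beta>_add)
      then show ?thesis
        using inj_onD[OF bij_betw_imp_inj_on[OF r(1)] _ hf fin_supp_add[OF hf hf]] by blast
    qed
    then have "h \<in> Group.iso (grp V) (sum_group UNIV (\<lambda>_. integer_group))"
      using bij hf by (auto simp: Group.iso_def hom_def carrier_sum_integer_group mult_sum_group)
    then show ?thesis by (rule iso_imp_Linf_equiv[OF V.group_axioms])
  qed
  have pred_add: "ker_pred i0 S i (vadd (\<beta> x) (\<beta> y))" if "ker_pred i0 S i (\<beta> x)" "ker_pred i0 S i (\<beta> y)" for i x y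
    using that S.l_one[of "\<one>\<^bsub>grp S\<^esub>"]
    by (auto simp: ker_pred_def vadd_def ev_add[OF cg fs fs] split: if_splits)
  have inv: "\<beta> (inv\<^bsub>grp V\<^esub> x) = ((\<lambda>i. - fst (\<beta> x) i), (\<lambda>i. - snd (\<beta> x) i))" for x
  proof -
    have "fst V (inv\<^bsub>grp V\<^esub> x, x) = e" using V.l_inv[of x] one by simp
    then have "vadd (\<beta> (inv\<^bsub>grp V\<^esub> x)) (\<beta> x) = vzero" using \<beta>_add e by metis
    then show ?thesis by (simp add: vadd_def prod_eq_iff fun_eq_iff add_eq_0_iff2)
  qed
  have sub: "subgroup (pred V i) (grp V)" if i: "i \<in> I" for i
  proof (rule V.subgroupI)
    have "e \<in> pred V i" using V_pred[OF i, of e] by (simp add: ker_pred_def e ev_zero[OF cg])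
    then show "pred V i \<noteq> {}" by blast
    show "inv\<^bsub>grp V\<^esub> x \<in> pred V i" if "x \<in> pred V i" for x
      using that ev_neg[OF cg fs[of x]] unfolding V_pred[OF i] ker_pred_def inv
      by (auto split: if_splits)
    show "x \<otimes>\<^bsub>grp V\<^esub> y \<in> pred V i" if "x \<in> pred V i" "y \<in> pred V i" for x y
      using that pred_add V_pred[OF i] by (simp add: \<beta>_add)
  qed simp
  have funE: "\<exists>y. pfun V j x = Some y \<and> \<beta> y = shift_fun j0 j (\<beta> x)" if "j \<in> J" for j x
    using V_fun[OF that, of x] by auto
  have dom: "dom (pfun V j) = UNIV" if "j \<in> J" for j
    using funE[OF that] by (auto simp: dom_def)
  have hom: "(\<lambda>x. the (pfun V j x)) \<in> hom ((grp V)\<lparr>carrier := dom (pfun V j)\<rparr>) (grp V)" if j: "j \<in> J" for j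
  proof -
    have \<beta>_the: "\<beta> (the (pfun V j x)) = shift_fun j0 j (\<beta> x)" for x
      using funE[OF j, of x] by auto
    have "the (pfun V j (fst V (x, y))) = fst V (the (pfun V j x), the (pfun V j y))" for x y
      by (simp add: inj[symmetric] \<beta>_the \<beta>_add shift_fun_vadd)
    then show ?thesis by (simp add: hom_def dom[OF j])
  qed
  show Om: "holds (Omega I J) V"
    using Linf sub dom hom by (simp add: Omega_def)
  have pow: "\<beta> (x [^]\<^bsub>grp V\<^esub> n) = ((\<lambda>i. int n * fst (\<beta> x) i), (\<lambda>i. int n * snd (\<beta> x) i))" for x and n :: nat
    by (induction n) (simp_all add: one e \<beta>_add vadd_def algebra_simps)
  assume tf: "torsion_free (grp S)"
  have "pure (pred V i) (grp V)" if i: "i \<in> I" for i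
    unfolding pure_def
  proof (rule allI)
    fix n :: nat
    \<comment> \<open>For positive \<open>n\<close> this says that the quotient by the predicate is
      torsion-free. With closure under powers it gives both inclusions; for \<open>n = 0\<close>
      both sides consist of the neutral element.\<close>
    have pw: "x \<in> pred V i" if "n > 0" "x [^]\<^bsub>grp V\<^esub> n \<in> pred V i" for x
    proof -
      have *: "ker_pred i0 S i ((\<lambda>i. int n * fst (\<beta> x) i), (\<lambda>i. int n * snd (\<beta> x) i))"
        using that(2) unfolding V_pred[OF i] pow .
      show ?thesis unfolding V_pred[OF i]
      proof (cases "i = i0")
        case True
        then have "ev S (fst (\<beta> x)) [^]\<^bsub>grp S\<^esub> n = \<one>\<^bsub>grp S\<^esub>"
          using * by (simp add: ker_pred_def ev_scale[OF cg fs])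
        then have "ev S (fst (\<beta> x)) = \<one>\<^bsub>grp S\<^esub>" using tf \<open>n > 0\<close> unfolding torsion_free_def by auto
        then show "ker_pred i0 S i (\<beta> x)" using True by (simp add: ker_pred_def)
      next
        case False
        then show "ker_pred i0 S i (\<beta> x)"
          using * \<open>n > 0\<close> by (auto simp: ker_pred_def prod_eq_iff fun_eq_iff)
      qed
    qed
    have pc: "x [^]\<^bsub>grp V\<^esub> n \<in> pred V i" if "x \<in> pred V i" for x
    proof (induction n)
      case (Suc n)
      then show ?case using subgroup.m_closed[OF sub[OF i] Suc that] by simp
    qed (use subgroup.one_closed[OF sub[OF i]] in simp)
    have "\<one>\<^bsub>grp V\<^esub> \<in> pred V i" using subgroup.one_closed[OF sub[OF i]] .
    show "(\<lambda>x. x [^]\<^bsub>grp V\<^esub> n) ` carrier (grp V) \<inter> pred V i = (\<lambda>x. x [^]\<^bsub>grp V\<^esub> n) ` pred V i"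
    proof (cases "n = 0")
      case True
      then show ?thesis using \<open>\<one>\<^bsub>grp V\<^esub> \<in> pred V i\<close> by auto
    next
      case False
      then show ?thesis using pw pc
        unfolding carrier_grp by blast
    qed
  qed
  then show "holds (Omega_pure I J) V" using Om by (simp add: Omega_pure_def)
qed

section \<open>Isomorphisms of groups and of their presentations\<close>

definition transport2 :: "(nat \<Rightarrow> nat) \<Rightarrow> vec2 \<Rightarrow> vec2" where
  "transport2 h u = (transport h (fst u), transport h (snd u))"

lemma iso_grp_inv:
  assumes "h \<in> Group.iso (grp S) (grp T)"
  shows "inv_into UNIV h \<in> Group.iso (grp T) (grp S)"
proof -
  have h: "bij h" "\<And>x y. h (fst S (x, y)) = fst T (h x, h y)" using assms by (auto simp: iso_grp_iff)
  have hi: "h (inv_into UNIV h x) = x" "inv_into UNIV h (h x) = x" for x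
    using h(1) by (simp_all add: bij_is_inj bij_is_surj surj_f_inv_f)
  have "inv_into UNIV h (fst T (x, y)) = fst S (inv_into UNIV h x, inv_into UNIV h y)" for x y
    using h(2)[of "inv_into UNIV h x" "inv_into UNIV h y"] hi by metis
  then show ?thesis using bij_imp_bij_inv[OF h(1)] by (simp add: iso_grp_iff)
qed

lemma iso_grp_group_hom:
  assumes "comm_group (grp S)" "comm_group (grp T)" "h \<in> Group.iso (grp S) (grp T)"
  shows "group_hom (grp S) (grp T) h"
  unfolding group_hom_def group_hom_axioms_def
  using assms by (auto simp: Group.iso_def intro: comm_group.axioms(2))

lemma transport2_relations:
  assumes S: "comm_group (grp S)" and T: "comm_group (grp T)" and h: "h \<in> Group.iso (grp S) (grp T)"
    and u: "u \<in> relations S"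
  shows "transport2 h u \<in> relations T"
proof -
  interpret h: group_hom "grp S" "grp T" h
    by (rule iso_grp_group_hom[OF S T h])
  show ?thesis
    using u ev_transport[OF S T h] h.hom_one by (auto simp: relations_def transport2_def)
qed

lemma bij_betw_transport2:
  assumes S: "comm_group (grp S)" and T: "comm_group (grp T)" and h: "h \<in> Group.iso (grp S) (grp T)"
  shows "bij_betw (transport2 h) (relations S) (relations T)"
proof -
  have bij: "bij h" using h by (simp add: iso_grp_iff)
  have hi: "h (inv_into UNIV h x) = x" "inv_into UNIV h (h x) = x" for x
    using bij by (simp_all add: bij_is_inj bij_is_surj surj_f_inv_f)
  have inv: "inv_into UNIV (inv_into UNIV h) = h" using bij by (rule inv_inv_eq)
  show ?thesis
  proof (rule bij_betw_byWitness[where f' = "transport2 (inv_into UNIV h)"])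
    show "\<forall>u\<in>relations S. transport2 (inv_into UNIV h) (transport2 h u) = u"
      "\<forall>u\<in>relations T. transport2 h (transport2 (inv_into UNIV h) u) = u"
      by (simp_all add: transport2_def transport_def inv hi)
    show "transport2 h ` relations S \<subseteq> relations T"
      using transport2_relations[OF S T h] by blast
    show "transport2 (inv_into UNIV h) ` relations T \<subseteq> relations S"
      using transport2_relations[OF T S iso_grp_inv[OF h]] by blast
  qed
qed

text \<open>Either \<open>k\<close> preserves \<open>K\<close> + \<open>K\<close>, and the quotients
  of \<open>F\<close> + \<open>K\<close> are compared, or it commutes with the shift, and then
  kernel \<open>F\<close> + 0 modulo image \<open>K\<close> + 0 is compared. Both alternatives end
  in \<open>quotient_iso\<close>.\<close>

lemma relations_iso:
  fixes S T :: "('a, 'b) str" and k :: "vec2 \<Rightarrow> vec2"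
  assumes S: "comm_group (grp S)" and T: "comm_group (grp T)"
    and k: "bij_betw k (relations S) (relations T)"
    and k_add: "\<And>u v. u \<in> relations S \<Longrightarrow> v \<in> relations S \<Longrightarrow> k (vadd u v) = vadd (k u) (k v)"
    and cases: "(\<forall>u\<in>relations S. ev S (fst u) = \<one>\<^bsub>grp S\<^esub> \<longleftrightarrow> ev T (fst (k u)) = \<one>\<^bsub>grp T\<^esub>) \<or>
      (\<forall>u\<in>relations S. k (snd u, (\<lambda>i. 0)) = (snd (k u), (\<lambda>i. 0)))"
  obtains g where "g \<in> Group.iso (grp S) (grp T)"
proof -
  interpret S: comm_group "grp S" by (rule S)
  interpret T: comm_group "grp T" by (rule T)
  have ev_add': "ev A (fst (vadd u v)) = fst A (ev A (fst u), ev A (fst v))"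
    if "comm_group (grp A)" "u \<in> relations A" "v \<in> relations A" for A :: "('a, 'b) str" and u v
    using that ev_add[OF that(1), of "fst u" "fst v"] by (auto simp: vadd_def relations_def)
  \<comment> \<open>Surjectivity is proved already on vectors with second component zero, so that it
    serves both alternatives.\<close>
  have surj: "\<exists>u\<in>{u \<in> relations A. snd u = (\<lambda>i. 0)}. ev A (fst u) = a"
    if "comm_group (grp A)" for A :: "('a, 'b) str" and a
    using ev_single[OF that, of a] ev_zero[OF that] fin_supp_single[of a 1] fin_supp_zero
    by (intro bexI[of _ "((\<lambda>i. if i = a then 1 else 0), (\<lambda>i. 0))"]) (auto simp: relations_def)
  have vadd0: "snd (vadd u v) = (\<lambda>i. 0)" if "snd u = (\<lambda>i. 0)" "snd v = (\<lambda>i. 0)" for u v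
    using that by (simp add: vadd_def)
  from cases show thesis
  proof
    assume ker: "\<forall>u\<in>relations S. ev S (fst u) = \<one>\<^bsub>grp S\<^esub> \<longleftrightarrow> ev T (fst (k u)) = \<one>\<^bsub>grp T\<^esub>"
    obtain g where "bij g" "\<And>x y. g (fst S (x, y)) = fst T (g x, g y)"
    proof (rule quotient_iso[OF S.group_axioms T.group_axioms k, of vadd "\<lambda>u. ev S (fst u)" "\<lambda>u. ev T (fst u)"])
      show "\<exists>u\<in>relations S. ev S (fst u) = a" for a using surj[OF S, of a] by blast
      show "\<exists>u\<in>relations T. ev T (fst u) = a" for a using surj[OF T, of a] by blast
    qed (use ker ev_add' S T k_add relations_vadd[OF S] in \<open>auto\<close>)
    then show thesis by (intro that[of g]) (simp add: iso_grp_iff)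
  next
    assume sh: "\<forall>u\<in>relations S. k (snd u, (\<lambda>i. 0)) = (snd (k u), (\<lambda>i. 0))"
    let ?U = "{u \<in> relations S. snd u = (\<lambda>i. 0)}" and ?V = "{u \<in> relations T. snd u = (\<lambda>i. 0)}"
    have k_rel: "k u \<in> relations T" if "u \<in> relations S" for u using bij_betw_apply[OF k that] .
    have k_surj: "\<exists>u\<in>relations S. k u = v" if "v \<in> relations T" for v
      using that bij_betw_imp_surj_on[OF k] by (metis imageE)
    have k_inj: "u = v" if "u \<in> relations S" "v \<in> relations S" "k u = k v" for u v
      using that bij_betw_imp_inj_on[OF k] by (simp add: inj_on_def)
    have z: "vzero \<in> relations S" by (rule relations_zero[OF S])
    have "vadd vzero vzero = vzero" by (simp add: vadd_def)
    then have "k vzero = vadd (k vzero) (k vzero)" using k_add[OF z z] by simp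
    then have kz: "k vzero = vzero" by (simp add: vadd_def prod_eq_iff fun_eq_iff)
    have shift_rel: "(snd u, (\<lambda>i. 0)) \<in> relations S" if "u \<in> relations S" for u
      using that z by (auto simp: relations_def)
    have snd_iff: "snd u = (\<lambda>i. 0) \<longleftrightarrow> snd (k u) = (\<lambda>i. 0)" if u: "u \<in> relations S" for u
    proof
      assume "snd u = (\<lambda>i. 0)"
      then show "snd (k u) = (\<lambda>i. 0)" using sh u kz by force
    next
      assume "snd (k u) = (\<lambda>i. 0)"
      then have "k (snd u, (\<lambda>i. 0)) = k vzero" using sh u kz by simp
      then show "snd u = (\<lambda>i. 0)" using k_inj[OF shift_rel[OF u] z] by simp
    qed
    have kUV: "bij_betw k ?U ?V"
      unfolding bij_betw_def
    proof
      show "inj_on k ?U" using k_inj by (auto simp: inj_on_def)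
      show "k ` ?U = ?V" using k_rel snd_iff k_surj by blast
    qed
    have in_image: "ev A (fst u) = \<one>\<^bsub>grp A\<^esub> \<longleftrightarrow> (\<exists>w\<in>relations A. u = (snd w, (\<lambda>i. 0)))"
      if "u \<in> relations A" "snd u = (\<lambda>i. 0)" for A :: "('a, 'b) str" and u
    proof
      assume "ev A (fst u) = \<one>\<^bsub>grp A\<^esub>"
      \<comment> \<open>A preimage of \<open>u\<close> under the shift needs second component
        \<open>fst u\<close>; its first component is arbitrary, and \<open>fst u\<close> is a
        convenient choice.\<close>
      then have "(fst u, fst u) \<in> relations A" using that by (auto simp: relations_def)
      then show "\<exists>w\<in>relations A. u = (snd w, (\<lambda>i. 0))"
        using that(2) by (intro bexI[of _ "(fst u, fst u)"]) (auto simp: prod_eq_iff)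
    qed (auto simp: relations_def)
    have ker: "ev S (fst u) = \<one>\<^bsub>grp S\<^esub> \<longleftrightarrow> ev T (fst (k u)) = \<one>\<^bsub>grp T\<^esub>" if u: "u \<in> ?U" for u
    proof -
      have u': "u \<in> relations S" "snd u = (\<lambda>i. 0)" "k u \<in> relations T" "snd (k u) = (\<lambda>i. 0)"
        using u k_rel[of u] snd_iff[of u] by auto
      have "(\<exists>w\<in>relations S. u = (snd w, (\<lambda>i. 0))) \<longleftrightarrow> (\<exists>w\<in>relations T. k u = (snd w, (\<lambda>i. 0)))"
      proof
        assume "\<exists>w\<in>relations S. u = (snd w, (\<lambda>i. 0))"
        then obtain w where w: "w \<in> relations S" "u = (snd w, (\<lambda>i. 0))" by blast
        then have "k u = (snd (k w), (\<lambda>i. 0))" using sh by simp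
        then show "\<exists>w\<in>relations T. k u = (snd w, (\<lambda>i. 0))" using k_rel[OF w(1)] by blast
      next
        assume "\<exists>w\<in>relations T. k u = (snd w, (\<lambda>i. 0))"
        then obtain w where w: "w \<in> relations S" "k u = (snd (k w), (\<lambda>i. 0))" using k_surj by blast
        then have "k u = k (snd w, (\<lambda>i. 0))" using sh by simp
        then show "\<exists>w\<in>relations S. u = (snd w, (\<lambda>i. 0))"
          using k_inj[OF u'(1) shift_rel[OF w(1)]] w(1) by blast
      qed
      then show ?thesis using in_image[OF u'(1,2)] in_image[OF u'(3,4)] by simp
    qed
    obtain g where "bij g" "\<And>x y. g (fst S (x, y)) = fst T (g x, g y)"
    proof (rule quotient_iso[OF S.group_axioms T.group_axioms kUV, of vadd "\<lambda>u. ev S (fst u)" "\<lambda>u. ev T (fst u)"])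
      show "\<exists>u\<in>?U. ev S (fst u) = a" for a by (rule surj[OF S])
      show "\<exists>u\<in>?V. ev T (fst u) = a" for a by (rule surj[OF T])
    qed (use ker ev_add' S T k_add relations_vadd[OF S] vadd0 in \<open>auto\<close>)
    then show thesis by (intro that[of g]) (simp add: iso_grp_iff)
  qed
qed

text \<open>Stated for a general \<open>\<Phi>\<close> so that abelian and torsion-free groups, and
  targets with or without purity, are treated by one construction. An isomorphism of groups permutes
  the basis of \<open>F\<close>; conversely, one distinguished symbol is enough to recover the
  group.\<close>

theorem comm_group_reducible_Omega:
  fixes \<Phi> :: "('a, 'b) sentence" and I :: "'i set" and J :: "'j set"
  assumes cg: "\<And>S. holds \<Phi> S \<Longrightarrow> comm_group (grp S)"
    and \<Phi>: "preds \<Phi> = {}" "funs \<Phi> = {}" and IJ: "\<not> (I = {} \<and> J = {})"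
    and \<Psi>: "\<Psi> = Omega I J \<or> \<Psi> = Omega_pure I J \<and> (\<forall>S. holds \<Phi> S \<longrightarrow> torsion_free (grp S))"
  shows "\<Phi> \<le>\<^sub>B \<Psi>"
proof -
  have sp: "holds \<Phi> S" if "S \<in> space (Models \<Phi>)" for S using that by (simp add: space_Models)
  have cg': "comm_group (grp S)" if "S \<in> space (Models \<Phi>)" for S using cg[OF sp[OF that]] .
  \<comment> \<open>When \<open>I\<close> is empty this is an arbitrary value, but then no predicate
    refers to it; the same holds for \<open>j0\<close> and \<open>J\<close>.\<close>
  define i0 where "i0 = (SOME i. i \<in> I)"
  define j0 where "j0 = (SOME j. j \<in> J)"
  have i0: "i0 \<in> I" if "I \<noteq> {}" unfolding i0_def using that by (simp add: some_in_eq)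
  have j0: "j0 \<in> J" if "J \<noteq> {}" unfolding j0_def using that by (simp add: some_in_eq)
  have sig: "preds \<Psi> = I" "funs \<Psi> = J" using \<Psi> by (auto simp: Omega_def Omega_pure_def)
  obtain f \<beta> where f: "f \<in> Models \<Phi> \<rightarrow>\<^sub>M str_space I J"
    and \<beta>: "\<And>S. S \<in> space (Models \<Phi>) \<Longrightarrow> bij_betw (\<beta> S) UNIV (relations S)"
    and \<beta>_add: "\<And>S x y. S \<in> space (Models \<Phi>) \<Longrightarrow> \<beta> S (fst (f S) (x, y)) = vadd (\<beta> S x) (\<beta> S y)"
    and f_pred: "\<And>S i x. S \<in> space (Models \<Phi>) \<Longrightarrow> i \<in> I \<Longrightarrow> x \<in> pred (f S) i \<longleftrightarrow> ker_pred i0 S i (\<beta> S x)"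
    and f_fun: "\<And>S j x. S \<in> space (Models \<Phi>) \<Longrightarrow> j \<in> J \<Longrightarrow>
      map_option (\<beta> S) (pfun (f S) j x) = Some (shift_fun j0 j (\<beta> S x))"
    by (rule relations_presentation[of \<Phi> I J i0 j0, OF cg']) blast+
  show ?thesis
  proof (rule borel_reducibleI[where f = f])
    show "f \<in> Models \<Phi> \<rightarrow>\<^sub>M str_space (preds \<Psi>) (funs \<Psi>)" unfolding sig by (rule f)
  next
    fix S assume S: "S \<in> space (Models \<Phi>)"
    have "holds (Omega I J) (f S)"
      by (rule relations_structure(1)[OF cg'[OF S] \<beta>[OF S] \<beta>_add[OF S] f_pred[OF S] f_fun[OF S]])
    moreover have "holds (Omega_pure I J) (f S)" if "torsion_free (grp S)"
      by (rule relations_structure(2)[OF cg'[OF S] \<beta>[OF S] \<beta>_add[OF S] f_pred[OF S] f_fun[OF S] that])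
    ultimately show "holds \<Psi> (f S)" using \<Psi> sp[OF S] by blast
  next
    fix S T assume S: "S \<in> space (Models \<Phi>)" and T: "T \<in> space (Models \<Phi>)"
    have inj: "\<beta> T x = \<beta> T y \<longleftrightarrow> x = y" for x y
      using \<beta>[OF T] by (auto simp: bij_betw_def inj_on_def)
    have surjS: "\<exists>x. u = \<beta> S x" if "u \<in> relations S" for u
      using that bij_betw_imp_surj_on[OF \<beta>[OF S]] by (metis imageE)
    have rel: "\<beta> S x \<in> relations S" for x using bij_betw_apply[OF \<beta>[OF S]] by blast
    show "model_iso \<Phi> S T \<longleftrightarrow> model_iso \<Psi> (f S) (f T)"
    proof
      assume "model_iso \<Phi> S T"
      then obtain h where h: "h \<in> Group.iso (grp S) (grp T)" by (auto simp: model_iso_def str_iso_def)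
      interpret h: group_hom "grp S" "grp T" h
        by (rule iso_grp_group_hom[OF cg'[OF S] cg'[OF T] h])
      have bh: "bij h" using h by (simp add: iso_grp_iff)
      obtain g where g: "bij g" "\<And>x. \<beta> T (g x) = transport2 h (\<beta> S x)"
        using bij_betw_pullback[OF \<beta>[OF S] \<beta>[OF T] bij_betw_transport2[OF cg'[OF S] cg'[OF T] h]] by blast
      have "g (fst (f S) (x, y)) = fst (f T) (g x, g y)" for x y
        unfolding inj[symmetric] g(2) \<beta>_add[OF S] \<beta>_add[OF T]
        by (simp add: transport2_def vadd_def transport_def)
      moreover have "x \<in> pred (f S) i \<longleftrightarrow> g x \<in> pred (f T) i" if i: "i \<in> I" for i x
      proof -
        have "ev T (fst (\<beta> T (g x))) = \<one>\<^bsub>grp T\<^esub> \<longleftrightarrow> ev S (fst (\<beta> S x)) = \<one>\<^bsub>grp S\<^esub>"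
        proof -
          have "fst (\<beta> S x) \<in> fin_supp" using rel[of x] by (auto simp: relations_def)
          then have "ev T (fst (\<beta> T (g x))) = h (ev S (fst (\<beta> S x)))"
            using ev_transport(1)[OF cg'[OF S] cg'[OF T] h] by (simp add: g(2) transport2_def)
          then show ?thesis using h.hom_one inj_eq[OF bij_is_inj[OF bh]] by metis
        qed
        moreover have "\<beta> T (g x) = vzero \<longleftrightarrow> \<beta> S x = vzero"
        proof -
          have "transport2 h (\<beta> S x) = transport2 h vzero \<longleftrightarrow> \<beta> S x = vzero"
            using bij_betw_imp_inj_on[OF bij_betw_transport2[OF cg'[OF S] cg'[OF T] h]] rel[of x]
              relations_zero[OF cg'[OF S]] by (simp add: inj_on_eq_iff)
          moreover have "transport2 h vzero = vzero" by (simp add: transport2_def transport_def)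
          ultimately show ?thesis using g(2) by simp
        qed
        ultimately show ?thesis using f_pred[OF S i] f_pred[OF T i] by (simp add: ker_pred_def)
      qed
      moreover have "pfun (f T) j (g x) = map_option g (pfun (f S) j x)" if j: "j \<in> J" for j x
      proof -
        obtain y where y: "pfun (f S) j x = Some y" "\<beta> S y = shift_fun j0 j (\<beta> S x)"
          using f_fun[OF S j, of x] by auto
        obtain z where z: "pfun (f T) j (g x) = Some z" "\<beta> T z = shift_fun j0 j (\<beta> T (g x))"
          using f_fun[OF T j, of "g x"] by auto
        have "\<beta> T z = \<beta> T (g y)"
          by (simp add: z(2) g(2) y(2) shift_fun_def transport2_def transport_def)
        then show ?thesis using y(1) z(1) inj by simp
      qed
      ultimately show "model_iso \<Psi> (f S) (f T)"
        unfolding model_iso_def str_iso_def sig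
        by (intro bexI[of _ g]) (auto simp: iso_grp_iff g(1))
    next
      assume "model_iso \<Psi> (f S) (f T)"
      then obtain g where g: "bij g" "\<And>x y. g (fst (f S) (x, y)) = fst (f T) (g x, g y)"
        and g_pred: "\<And>i x. i \<in> I \<Longrightarrow> x \<in> pred (f S) i \<longleftrightarrow> g x \<in> pred (f T) i"
        and g_fun: "\<And>j x. j \<in> J \<Longrightarrow> pfun (f T) j (g x) = map_option g (pfun (f S) j x)"
        unfolding model_iso_def str_iso_def sig by (auto simp: iso_grp_iff)
      obtain k where k: "bij_betw k (relations S) (relations T)" "\<And>x. k (\<beta> S x) = \<beta> T (g x)"
        using bij_betw_pushforward[OF \<beta>[OF S] \<beta>[OF T] g(1)] by blast
      have "k (vadd u v) = vadd (k u) (k v)" if uv: "u \<in> relations S" "v \<in> relations S" for u v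
      proof -
        obtain x y where xy: "u = \<beta> S x" "v = \<beta> S y" using surjS[OF uv(1)] surjS[OF uv(2)] by blast
        show ?thesis unfolding xy \<beta>_add[OF S, symmetric] k(2) g(2) \<beta>_add[OF T] ..
      qed
      moreover have "(\<forall>u\<in>relations S. ev S (fst u) = \<one>\<^bsub>grp S\<^esub> \<longleftrightarrow> ev T (fst (k u)) = \<one>\<^bsub>grp T\<^esub>) \<or>
        (\<forall>u\<in>relations S. k (snd u, (\<lambda>i. 0)) = (snd (k u), (\<lambda>i. 0)))"
      \<comment> \<open>A predicate symbol supplies the first alternative of
        \<open>relations_iso\<close>. Without one, \<open>J\<close> is nonempty and
        \<open>j0\<close> supplies the second.\<close>
      proof (cases "I = {}")
        case False
        have "ev S (fst u) = \<one>\<^bsub>grp S\<^esub> \<longleftrightarrow> ev T (fst (k u)) = \<one>\<^bsub>grp T\<^esub>" if "u \<in> relations S" for u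
        proof -
          obtain x where x: "u = \<beta> S x" using surjS \<open>u \<in> relations S\<close> by blast
          show ?thesis
            using g_pred[OF i0[OF False], of x] f_pred[OF S i0[OF False]] f_pred[OF T i0[OF False]]
            by (simp add: x k(2) ker_pred_def)
        qed
        then show ?thesis by blast
      next
        case True
        then have j: "j0 \<in> J" using IJ j0 by blast
        have "k (snd u, (\<lambda>i. 0)) = (snd (k u), (\<lambda>i. 0))" if "u \<in> relations S" for u
        proof -
          obtain x where x: "u = \<beta> S x" using surjS \<open>u \<in> relations S\<close> by blast
          obtain y where y: "pfun (f S) j0 x = Some y" "\<beta> S y = shift_fun j0 j0 (\<beta> S x)"
            using f_fun[OF S j, of x] by auto
          have "pfun (f T) j0 (g x) = Some (g y)" using g_fun[OF j, of x] y(1) by simp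
          then have "\<beta> T (g y) = shift_fun j0 j0 (\<beta> T (g x))" using f_fun[OF T j, of "g x"] by simp
          then have "k (\<beta> S y) = (snd (k u), (\<lambda>i. 0))" by (simp add: x k(2) shift_fun_def)
          then show ?thesis using y(2) by (simp add: x shift_fun_def)
        qed
        then show ?thesis by blast
      qed
      ultimately obtain h where "h \<in> Group.iso (grp S) (grp T)"
        using relations_iso[OF cg'[OF S] cg'[OF T] k(1)] by blast
      then show "model_iso \<Phi> S T" by (auto simp: model_iso_def str_iso_def \<Phi>)
    qed
  qed
qed

theorem mainTheorem1:
  fixes I :: "'i set" and J :: "'j set"
  assumes "countable I" and "countable J" and "\<not> (I = {} \<and> J = {})"
  shows "Omega_pure I J \<sim>\<^sub>B Omega I J \<and> Omega I J \<sim>\<^sub>B TFAG \<and> TFAG \<sim>\<^sub>B AG"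
proof -
  have Omega_TFAG: "Omega I J \<le>\<^sub>B TFAG" by (rule Omega_reducible_TFAG[OF assms(1,2)])
  have AG_Omega: "AG \<le>\<^sub>B Omega I J"
    by (rule comm_group_reducible_Omega[OF _ _ _ assms(3)]) (simp_all add: AG_def)
  have TFAG_Omega: "TFAG \<le>\<^sub>B Omega I J"
    by (rule comm_group_reducible_Omega[OF _ _ _ assms(3)]) (simp_all add: TFAG_def)
  have TFAG_pure: "TFAG \<le>\<^sub>B Omega_pure I J"
    by (rule comm_group_reducible_Omega[OF _ _ _ assms(3)]) (simp_all add: TFAG_def)
  have pure_Omega: "Omega_pure I J \<le>\<^sub>B Omega I J"
    by (rule borel_reducible_strengthen) (simp_all add: Omega_pure_def Omega_def)
  have TFAG_AG: "TFAG \<le>\<^sub>B AG"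
    by (rule borel_reducible_strengthen) (simp_all add: TFAG_def AG_def)
  \<comment> \<open>The two missing directions are composites: \<open>Omega\<close> reaches
    \<open>Omega_pure\<close> through \<open>TFAG\<close>, and \<open>AG\<close> reaches
    \<open>TFAG\<close> through \<open>Omega\<close>.\<close>
  show ?thesis
    unfolding borel_equivalent_def
    using pure_Omega TFAG_AG Omega_TFAG TFAG_Omega
      borel_reducible_trans[OF Omega_TFAG TFAG_pure] borel_reducible_trans[OF AG_Omega Omega_TFAG]
    by blast
qed

end
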